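(* Let $p<q$ be prime numbers and let $G$ be a non-abelian group of order $p^{2}q$. Then one of the following cases occurs, and in each case the structure of $G\otimes G$ is as stated: (i) If $G^{ab}\cong\mathbb{Z}_{p^{2}}$, then $G\otimes G\cong \mathbb{Z}_{p^{2}q}$. (ii) If $G^{ab}\cong\mathbb{Z}_{p}\times\mathbb{Z}_{p}$, then $G\otimes G\cong (\mathbb{Z}_{p})^{4}\times \mathbb{Z}_{q}$. (iii) If $G^{ab}\cong\mathbb{Z}_{3}$, then $G\otimes G\cong \mathbb{Z}_{3}\times Q_{2}$, where $Q_{2}$ is the quaternion group of order $8$.
   Context: $G\otimes G$ denotes the non-abelian tensor square of $G$: the group generated by symbols $g\otimes h$ ($g,h\in G$) subject to the relations \[g_1g\otimes h=({}^{g_1}g\otimes {}^{g_1}h)(g_1\otimes h),\qquad g\otimes h_1h=(g\otimes h_1)({}^{h_1}g\otimes {}^{h_1}h)\] for all $g,g_1,h,h_1\in G$, where ${}^{x}y=xyx^{-1}$. $G^{ab}=G/G'$ is the abelianization of $G$, where $G'$ is the commutator subgroup. $\mathbb{Z}_m$ denotes the cyclic group of order $m$, and $(\mathbb{Z}_m)^k$ the direct product of $k$ copies of it. *)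

theory Defs
  imports "HOL-Algebra.Algebra" "HOL-Computational_Algebra.Primes"
begin

section \<open>Groups given by generators and relations\<close>

text \<open>
  The letter \<open>(x, True)\<close> stands for the generator \<open>x\<close>, and \<open>(x, False)\<close> for its formal inverse.
\<close>

type_synonym 'x word = "('x \<times> bool) list"

abbreviation gen :: "'x \<Rightarrow> 'x word" where
  "gen x \<equiv> [(x, True)]"

definition words :: "'x set \<Rightarrow> 'x word set" where
  "words S = lists (S \<times> UNIV)"

text \<open>
  The least congruence on the monoid of words over \<open>S\<close> that makes each letter inverse to its
  formal inverse and identifies the two sides of each relation in \<open>R\<close>. For empty \<open>R\<close> this is free
  equivalence, so the quotient monoid is the free group on \<open>S\<close> modulo the normal closure of the
  elements \<open>u v\<^sup>-\<^sup>1\<close> with \<open>(u, v) \<in> R\<close>.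
\<close>

inductive word_eq :: "'x set \<Rightarrow> ('x word \<times> 'x word) set \<Rightarrow> 'x word \<Rightarrow> 'x word \<Rightarrow> bool"
  for S :: "'x set" and R :: "('x word \<times> 'x word) set"
where
  refl: "w \<in> words S \<Longrightarrow> word_eq S R w w"
| sym: "word_eq S R u v \<Longrightarrow> word_eq S R v u"
| trans: "word_eq S R u v \<Longrightarrow> word_eq S R v w \<Longrightarrow> word_eq S R u w"
| append: "word_eq S R u u' \<Longrightarrow> word_eq S R v v' \<Longrightarrow> word_eq S R (u @ v) (u' @ v')"
| cancel: "x \<in> S \<Longrightarrow> word_eq S R [(x, b), (x, \<not> b)] []"
| rel: "(u, v) \<in> R \<Longrightarrow> u \<in> words S \<Longrightarrow> v \<in> words S \<Longrightarrow> word_eq S R u v"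

definition word_class :: "'x set \<Rightarrow> ('x word \<times> 'x word) set \<Rightarrow> 'x word \<Rightarrow> 'x word set" where
  "word_class S R u = {v. word_eq S R u v}"

definition presented_group :: "'x set \<Rightarrow> ('x word \<times> 'x word) set \<Rightarrow> 'x word set monoid" where
  "presented_group S R =
    \<lparr>carrier = word_class S R ` words S,
     monoid.mult = (\<lambda>A B. \<Union>u\<in>A. \<Union>v\<in>B. word_class S R (u @ v)),
     one = word_class S R []\<rparr>"


section \<open>The non-abelian tensor square\<close>

definition conj_by :: "('a, 'b) monoid_scheme \<Rightarrow> 'a \<Rightarrow> 'a \<Rightarrow> 'a" where
  "conj_by G x y = x \<otimes>\<^bsub>G\<^esub> y \<otimes>\<^bsub>G\<^esub> inv\<^bsub>G\<^esub> x"

text \<open>The pair \<open>(g, h)\<close> is the symbol usually written \<open>g \<otimes> h\<close>.\<close>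

definition tensor_relations ::
  "('a, 'b) monoid_scheme \<Rightarrow> (('a \<times> 'a) word \<times> ('a \<times> 'a) word) set" where
  "tensor_relations G =
    {(gen (g1 \<otimes>\<^bsub>G\<^esub> g, h), gen (conj_by G g1 g, conj_by G g1 h) @ gen (g1, h)) | g1 g h.
       g1 \<in> carrier G \<and> g \<in> carrier G \<and> h \<in> carrier G} \<union>
    {(gen (g, h1 \<otimes>\<^bsub>G\<^esub> h), gen (g, h1) @ gen (conj_by G h1 g, conj_by G h1 h)) | g h1 h.
       g \<in> carrier G \<and> h1 \<in> carrier G \<and> h \<in> carrier G}"

definition tensor_square :: "('a, 'b) monoid_scheme \<Rightarrow> ('a \<times> 'a) word set monoid" where
  "tensor_square G = presented_group (carrier G \<times> carrier G) (tensor_relations G)"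


section \<open>Abelianization, powers of cyclic groups, and the quaternion group\<close>

definition abelianization :: "('a, 'b) monoid_scheme \<Rightarrow> 'a set monoid" where
  "abelianization G = G Mod derived G (carrier G)"

definition cyclic_power :: "nat \<Rightarrow> nat \<Rightarrow> (nat \<Rightarrow> int) monoid" where
  "cyclic_power m k = product_group {..<k} (\<lambda>_. integer_mod_group m)"

datatype quat_unit = Q1 | QI | QJ | QK

text \<open>
  The pair \<open>(s, u)\<close> is \<open>u\<close> if \<open>s\<close> is \<open>False\<close> and \<open>-u\<close> if \<open>s\<close> is \<open>True\<close>.
\<close>

fun quat_unit_mult :: "quat_unit \<Rightarrow> quat_unit \<Rightarrow> bool \<times> quat_unit" where
  "quat_unit_mult Q1 u = (False, u)"
| "quat_unit_mult u Q1 = (False, u)"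
| "quat_unit_mult QI QI = (True, Q1)"
| "quat_unit_mult QJ QJ = (True, Q1)"
| "quat_unit_mult QK QK = (True, Q1)"
| "quat_unit_mult QI QJ = (False, QK)"
| "quat_unit_mult QJ QI = (True, QK)"
| "quat_unit_mult QJ QK = (False, QI)"
| "quat_unit_mult QK QJ = (True, QI)"
| "quat_unit_mult QK QI = (False, QJ)"
| "quat_unit_mult QI QK = (True, QJ)"

fun quat_mult :: "bool \<times> quat_unit \<Rightarrow> bool \<times> quat_unit \<Rightarrow> bool \<times> quat_unit" where
  "quat_mult (s, u) (t, v) = (let (r, w) = quat_unit_mult u v in ((s \<noteq> t) \<noteq> r, w))"

definition quaternion_group :: "(bool \<times> quat_unit) monoid" where
  "quaternion_group = \<lparr>carrier = UNIV, monoid.mult = quat_mult, one = (False, Q1)\<rparr>"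

end

theory Submission
  imports Defs
begin

text \<open>
  Write \<open>D\<close> for the derived subgroup of \<open>G\<close>. Homomorphisms from \<open>G \<otimes> G\<close> to a group \<open>M\<close> are the same as
  crossed pairings \<open>G \<times> G \<rightarrow> M\<close>, maps that satisfy the two relations of the tensor square. The proof
  finds enough of them onto known groups, and then bounds the order of \<open>G \<otimes> G\<close> so tightly that nothing
  else is left.

  Three pairings are used: the commutator map, with values in \<open>D\<close>; products of homomorphisms from \<open>G\<close> to a
  cyclic group, which factor through the tensor product of the abelianization with itself; and, for
  the alternating group of degree 4, the commutator map of its central extension by the quaternion group
  with a rotation of order 3, which has values in the quaternion group. In every case \<open>G \<otimes> G\<close> is thereby
  mapped onto two groups of coprime orders \<open>a\<close> and \<open>b\<close>, hence onto their product, and this is an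
  isomorphism if \<open>|G \<otimes> G| \<le> a b\<close> (\<open>iso_DirProd_if_coprime_epis\<close>).

  For the bound, suppose that \<open>D\<close> is abelian and that one element \<open>k\<close> of \<open>G\<close> centralizes no non-trivial
  element of \<open>D\<close>. Then every element of \<open>D\<close> has the form \<open>[c, k]\<close> with \<open>c\<close> in \<open>D\<close>, and the identity
  \<open>[c, k] \<otimes> h = (c \<otimes> k) (\<^sup>h c \<otimes> \<^sup>h k)\<^sup>-\<^sup>1\<close> puts all \<open>d \<otimes> h\<close> and \<open>h \<otimes> d\<close> with \<open>d\<close> in \<open>D\<close> into the set \<open>K\<close> of the
  elements \<open>n (c \<otimes> k)\<close>, where \<open>n\<close> runs over a central subgroup \<open>N\<close> that contains the \<open>c \<otimes> d\<close> with \<open>c\<close> and \<open>d\<close>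
  in \<open>D\<close>. Modulo \<open>K\<close> the symbol \<open>\<otimes>\<close> is bilinear on the abelianization, so that
  the order of \<open>G \<otimes> G\<close> is at most \<open>|N| |D| m ^ (r\<^sup>2)\<close> if the abelianization is generated by \<open>r\<close> elements
  whose orders divide \<open>m\<close> (\<open>card_le\<close>). Finally \<open>c \<otimes> c = 1\<close> for every commutator \<open>c\<close>, since \<open>[g, h] \<otimes> [g, h]\<close> is the commutator of
  \<open>g \<otimes> h\<close> with itself. Hence \<open>N\<close> is trivial if \<open>D\<close> has prime order, and has at most two elements if \<open>D\<close> is a
  Klein four-group.

  It remains to see that there are no other groups. Let \<open>H\<close> be a subgroup of order \<open>q\<close>. Outside the
  normalizer of \<open>H\<close> the double cosets of \<open>H\<close> have \<open>q\<^sup>2\<close> elements, and a count shows that either \<open>H\<close> is normal,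
  or \<open>p = 2\<close>, \<open>q = 3\<close> and \<open>H\<close> is its own normalizer. In the first case \<open>D = H\<close>, the abelianization has order
  \<open>p\<^sup>2\<close>, and \<open>D\<close> is not central, since otherwise \<open>[g, h]\<^sup>n = [g\<^sup>n, h] = 1\<close> for all \<open>g\<close> and \<open>h\<close>, both
  with \<open>n = p\<^sup>2\<close> and with \<open>n = q\<close>. In the second
  case \<open>G\<close> is the alternating group of degree 4: \<open>D\<close> is a Klein four-group, and the elements of order 3
  act on it without fixed points.
\<close>

section \<open>Homomorphisms out of presented groups\<close>

lemma word_eq_words:
  assumes "word_eq S R u v"
  shows "u \<in> words S \<and> v \<in> words S"
  using assms by (induction rule: word_eq.induct) (auto simp: words_def)

lemma word_class_eq_iff:
  assumes "u \<in> words S"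
  shows "word_class S R u = word_class S R v \<longleftrightarrow> word_eq S R u v"
proof
  assume "word_class S R u = word_class S R v"
  moreover have "u \<in> word_class S R u"
    using assms by (simp add: word_class_def word_eq.refl)
  ultimately have "word_eq S R v u"
    by (simp add: word_class_def)
  then show "word_eq S R u v"
    by (rule word_eq.sym)
next
  assume "word_eq S R u v"
  then show "word_class S R u = word_class S R v"
    unfolding word_class_def by (blast intro: word_eq.sym word_eq.trans)
qed

lemma carrier_presented_group:
  "carrier (presented_group S R) = word_class S R ` words S"
  by (simp add: presented_group_def)

lemma one_presented_group:
  "\<one>\<^bsub>presented_group S R\<^esub> = word_class S R []"
  by (simp add: presented_group_def)

lemma mult_presented_group:
  assumes "u \<in> words S" "v \<in> words S"
  shows "word_class S R u \<otimes>\<^bsub>presented_group S R\<^esub> word_class S R v = word_class S R (u @ v)"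
proof -
  have "word_class S R (u' @ v') = word_class S R (u @ v)"
    if "u' \<in> word_class S R u" "v' \<in> word_class S R v" for u' v'
  proof -
    have "word_eq S R (u @ v) (u' @ v')"
      using that by (auto simp: word_class_def intro: word_eq.append)
    moreover have "u @ v \<in> words S"
      using assms by (simp add: words_def)
    ultimately have "word_class S R (u @ v) = word_class S R (u' @ v')"
      by (simp add: word_class_eq_iff)
    then show ?thesis ..
  qed
  moreover have "u \<in> word_class S R u" "v \<in> word_class S R v"
    using assms by (simp_all add: word_class_def word_eq.refl)
  ultimately have "(\<Union>u'\<in>word_class S R u. \<Union>v'\<in>word_class S R v. word_class S R (u' @ v'))
      = word_class S R (u @ v)"
    by blast
  then show ?thesis
    by (simp add: presented_group_def)
qed

definition formal_inverse :: "'x word \<Rightarrow> 'x word" where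
  "formal_inverse w = rev (map (\<lambda>(x, b). (x, \<not> b)) w)"

lemma formal_inverse_words: "w \<in> words S \<Longrightarrow> formal_inverse w \<in> words S"
  unfolding words_def formal_inverse_def by (induction w) auto

lemma formal_inverse_cancel:
  assumes "w \<in> words S"
  shows "word_eq S R (formal_inverse w @ w) []"
  using assms
proof (induction w)
  case Nil
  then show ?case
    by (simp add: formal_inverse_def word_eq.refl)
next
  case (Cons a w)
  obtain x b where a: "a = (x, b)" by (cases a)
  have x: "x \<in> S" and w: "w \<in> words S"
    using Cons.prems a by (auto simp: words_def)
  have mid: "word_eq S R [(x, \<not> b), (x, b)] []"
    using word_eq.cancel[OF x, of R "\<not> b"] by simp
  have "word_eq S R (formal_inverse w @ ([(x, \<not> b), (x, b)] @ w)) (formal_inverse w @ ([] @ w))"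
    by (intro word_eq.append word_eq.refl mid w formal_inverse_words)
  also have "formal_inverse w @ ([(x, \<not> b), (x, b)] @ w) = formal_inverse (a # w) @ (a # w)"
    by (simp add: formal_inverse_def a)
  finally show ?case
    using Cons.IH[OF w] by (auto intro: word_eq.trans)
qed

lemma group_presented_group: "group (presented_group S R)"
proof (rule groupI)
  let ?P = "presented_group S R"
  note simps = carrier_presented_group one_presented_group mult_presented_group
  have nil: "[] \<in> words S" and app: "u @ v \<in> words S" if "u \<in> words S" "v \<in> words S" for u v
    using that by (auto simp: words_def)
  have nil: "[] \<in> words S"
    by (simp add: words_def)
  show "x \<otimes>\<^bsub>?P\<^esub> y \<in> carrier ?P" if "x \<in> carrier ?P" "y \<in> carrier ?P" for x y
    using that by (auto simp: simps app)
  show "\<one>\<^bsub>?P\<^esub> \<in> carrier ?P"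
    by (auto simp: simps nil)
  show "x \<otimes>\<^bsub>?P\<^esub> y \<otimes>\<^bsub>?P\<^esub> z = x \<otimes>\<^bsub>?P\<^esub> (y \<otimes>\<^bsub>?P\<^esub> z)"
    if "x \<in> carrier ?P" "y \<in> carrier ?P" "z \<in> carrier ?P" for x y z
    using that by (auto simp: simps app)
  show "\<one>\<^bsub>?P\<^esub> \<otimes>\<^bsub>?P\<^esub> x = x" if "x \<in> carrier ?P" for x
    using that by (auto simp: simps nil)
  show "\<exists>y\<in>carrier ?P. y \<otimes>\<^bsub>?P\<^esub> x = \<one>\<^bsub>?P\<^esub>" if x: "x \<in> carrier ?P" for x
  proof -
    obtain w where w: "w \<in> words S" "x = word_class S R w"
      using x by (auto simp: simps)
    have "word_class S R (formal_inverse w @ w) = word_class S R []"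
      using formal_inverse_cancel[OF w(1)] formal_inverse_words[OF w(1)] w(1)
      by (simp add: word_class_eq_iff app)
    then show ?thesis
      using w formal_inverse_words[OF w(1)]
      by (intro bexI[of _ "word_class S R (formal_inverse w)"]) (auto simp: simps)
  qed
qed

lemma presented_group_relation:
  assumes "(u, v) \<in> R" "u \<in> words S" "v \<in> words S"
  shows "word_class S R u = word_class S R v"
  using assms(2) word_eq.rel[OF assms] by (simp add: word_class_eq_iff)

lemma word_class_in_generate:
  assumes "w \<in> words S"
  shows "word_class S R w \<in> generate (presented_group S R) ((\<lambda>x. word_class S R (gen x)) ` S)"
    (is "_ \<in> generate ?P ?E")
  using assms
proof (induction w)
  case Nil
  have "\<one>\<^bsub>?P\<^esub> \<in> generate ?P ?E"
    by (rule generate.one)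
  then show ?case
    by (simp add: one_presented_group)
next
  case (Cons a w)
  interpret P: group ?P by (rule group_presented_group)
  obtain x b where a: "a = (x, b)" by (cases a)
  have x: "x \<in> S" and w: "w \<in> words S"
    using Cons.prems a by (auto simp: words_def)
  have letter: "[(x, c)] \<in> words S" for c
    using x by (simp add: words_def)
  have "word_class S R [(x, b)] \<in> generate ?P ?E"
  proof (cases b)
    case True
    then show ?thesis
      using x by (auto intro!: generate.incl)
  next
    case False
    have "word_class S R ([(x, False)] @ [(x, True)]) = word_class S R []"
      using word_eq.cancel[OF x, of R False] x by (simp add: word_class_eq_iff words_def)
    then have "word_class S R [(x, False)] \<otimes>\<^bsub>?P\<^esub> word_class S R (gen x) = \<one>\<^bsub>?P\<^esub>"
      using mult_presented_group[OF letter letter, of R False True] by (simp add: one_presented_group)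
    moreover have "word_class S R [(x, c)] \<in> carrier ?P" for c
      using letter by (auto simp: carrier_presented_group)
    ultimately have "inv\<^bsub>?P\<^esub> word_class S R (gen x) = word_class S R [(x, False)]"
      by (simp add: P.inv_equality)
    moreover have "inv\<^bsub>?P\<^esub> word_class S R (gen x) \<in> generate ?P ?E"
      using x by (auto intro!: generate.inv)
    ultimately show ?thesis
      using False by simp
  qed
  then have "word_class S R [(x, b)] \<otimes>\<^bsub>?P\<^esub> word_class S R w \<in> generate ?P ?E"
    using Cons.IH[OF w] by (rule generate.eng)
  then show ?case
    using mult_presented_group[OF letter w, of R b] a by simp
qed

lemma generate_presented_group:
  "generate (presented_group S R) ((\<lambda>x. word_class S R (gen x)) ` S) = carrier (presented_group S R)"
    (is "generate ?P ?E = _")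
proof
  interpret P: group ?P by (rule group_presented_group)
  have "?E \<subseteq> carrier ?P"
    by (auto simp: carrier_presented_group words_def)
  then show "generate ?P ?E \<subseteq> carrier ?P"
    by (rule P.generate_incl)
  show "carrier ?P \<subseteq> generate ?P ?E"
    by (auto simp: carrier_presented_group word_class_in_generate)
qed

definition word_value :: "('b, 'c) monoid_scheme \<Rightarrow> ('x \<Rightarrow> 'b) \<Rightarrow> 'x word \<Rightarrow> 'b" where
  "word_value L f w = foldr (\<lambda>(x, b) a. (if b then f x else inv\<^bsub>L\<^esub> f x) \<otimes>\<^bsub>L\<^esub> a) w \<one>\<^bsub>L\<^esub>"

context group
begin

lemma word_value_closed:
  assumes "w \<in> words S" "f ` S \<subseteq> carrier G"
  shows "word_value G f w \<in> carrier G"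
  using assms by (induction w) (auto simp: word_value_def words_def)

lemma word_value_append:
  assumes "u \<in> words S" "v \<in> words S" "f ` S \<subseteq> carrier G"
  shows "word_value G f (u @ v) = word_value G f u \<otimes> word_value G f v"
  using assms(1)
proof (induction u)
  case Nil
  then show ?case
    using word_value_closed[OF assms(2,3)] by (simp add: word_value_def)
next
  case (Cons a u)
  have "u \<in> words S" "fst a \<in> S"
    using Cons.prems by (auto simp: words_def)
  then show ?case
    using Cons.IH word_value_closed[OF _ assms(3)] assms
    by (cases a) (auto simp: word_value_def image_subset_iff m_assoc)
qed

lemma word_value_cong:
  assumes "word_eq S R u v" and f: "f ` S \<subseteq> carrier G"
    and rel: "\<And>u v. (u, v) \<in> R \<Longrightarrow> u \<in> words S \<Longrightarrow> v \<in> words S \<Longrightarrow> word_value G f u = word_value G f v"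
  shows "word_value G f u = word_value G f v"
  using assms(1)
proof (induction rule: word_eq.induct)
  case (append u u' v v')
  then show ?case
    by (simp add: word_value_append[OF _ _ f] word_eq_words)
next
  case (cancel x b)
  then have "f x \<in> carrier G"
    using f by auto
  then show ?case
    by (simp add: word_value_def)
qed (use rel in auto)

text \<open>
  Von Dyck's theorem. A class is sent to the value of any of its words, which is well defined because
  the values of words respect the relations.
\<close>
lemma presented_group_hom:
  assumes f: "f ` S \<subseteq> carrier G"
    and rel: "\<And>u v. (u, v) \<in> R \<Longrightarrow> u \<in> words S \<Longrightarrow> v \<in> words S \<Longrightarrow> word_value G f u = word_value G f v"
  obtains h where "h \<in> hom (presented_group S R) G"
    and "\<And>x. x \<in> S \<Longrightarrow> h (word_class S R (gen x)) = f x"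
proof
  define h where "h A = the_elem (word_value G f ` A)" for A
  have h: "h (word_class S R w) = word_value G f w" if "w \<in> words S" for w
  proof -
    have "w \<in> word_class S R w"
      using that by (simp add: word_class_def word_eq.refl)
    moreover have "word_value G f v = word_value G f w" if "v \<in> word_class S R w" for v
      using that word_value_cong[OF _ f rel] by (fastforce simp: word_class_def)
    ultimately have "word_value G f ` word_class S R w = {word_value G f w}"
      by blast
    then show ?thesis
      by (simp add: h_def)
  qed
  show "h \<in> hom (presented_group S R) G"
  proof (rule homI)
    fix A assume "A \<in> carrier (presented_group S R)"
    then show "h A \<in> carrier G"
      using word_value_closed f by (auto simp: carrier_presented_group h)
  next
    fix A B assume "A \<in> carrier (presented_group S R)" "B \<in> carrier (presented_group S R)"
    then obtain u v where uv: "u \<in> words S" "v \<in> words S" "A = word_class S R u" "B = word_class S R v"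
      by (auto simp: carrier_presented_group)
    then have "u @ v \<in> words S"
      by (simp add: words_def)
    then show "h (A \<otimes>\<^bsub>presented_group S R\<^esub> B) = h A \<otimes> h B"
      using uv by (simp add: mult_presented_group h word_value_append[OF _ _ f])
  qed
  show "h (word_class S R (gen x)) = f x" if "x \<in> S" for x
  proof -
    have "gen x \<in> words S" using that by (simp add: words_def)
    moreover have "f x \<in> carrier G" using that f by auto
    ultimately show ?thesis by (simp add: h word_value_def)
  qed
qed

end

section \<open>Conjugation and commutators\<close>

text \<open>
  With this order of the factors \<open>\<^sup>x y = [x, y] y\<close>, where \<open>\<^sup>x y = x y x\<^sup>-\<^sup>1\<close> is \<open>conj_by\<close>. Below, \<open>g \<otimes> h\<close> stands
  for \<open>\<tau> g h\<close> and \<open>\<^sup>x(g \<otimes> h)\<close> for \<open>\<^sup>x g \<otimes> \<^sup>x h\<close>.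
\<close>
definition commutator :: "('a, 'b) monoid_scheme \<Rightarrow> 'a \<Rightarrow> 'a \<Rightarrow> 'a" where
  "commutator G x y = x \<otimes>\<^bsub>G\<^esub> y \<otimes>\<^bsub>G\<^esub> inv\<^bsub>G\<^esub> x \<otimes>\<^bsub>G\<^esub> inv\<^bsub>G\<^esub> y"

context group
begin

lemma inv_cancel_left [simp]:
  "x \<in> carrier G \<Longrightarrow> y \<in> carrier G \<Longrightarrow> inv x \<otimes> (x \<otimes> y) = y"
  "x \<in> carrier G \<Longrightarrow> y \<in> carrier G \<Longrightarrow> x \<otimes> (inv x \<otimes> y) = y"
  by (simp_all flip: m_assoc)

lemma conj_by_closed [simp, intro]:
  "x \<in> carrier G \<Longrightarrow> y \<in> carrier G \<Longrightarrow> conj_by G x y \<in> carrier G"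
  by (simp add: conj_by_def)

lemma commutator_closed [simp, intro]:
  "x \<in> carrier G \<Longrightarrow> y \<in> carrier G \<Longrightarrow> commutator G x y \<in> carrier G"
  by (simp add: commutator_def)

lemma conj_by_conj_by:
  assumes "x \<in> carrier G" "y \<in> carrier G" "z \<in> carrier G"
  shows "conj_by G x (conj_by G y z) = conj_by G (x \<otimes> y) z"
  using assms by (simp add: conj_by_def m_assoc inv_mult_group)

lemma conj_by_mult:
  assumes "x \<in> carrier G" "y \<in> carrier G" "z \<in> carrier G"
  shows "conj_by G x (y \<otimes> z) = conj_by G x y \<otimes> conj_by G x z"
  using assms by (simp add: conj_by_def m_assoc)

lemma conj_by_one [simp]:
  "x \<in> carrier G \<Longrightarrow> conj_by G x \<one> = \<one>"
  "x \<in> carrier G \<Longrightarrow> conj_by G \<one> x = x"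
  by (simp_all add: conj_by_def)

lemma conj_by_inv:
  "x \<in> carrier G \<Longrightarrow> y \<in> carrier G \<Longrightarrow> inv (conj_by G x y) = conj_by G x (inv y)"
  by (simp add: conj_by_def m_assoc inv_mult_group)

lemma commutator_in_derived:
  assumes "x \<in> carrier G" "y \<in> carrier G"
  shows "commutator G x y \<in> derived G (carrier G)"
  unfolding derived_def commutator_def using assms by (blast intro: generate.incl)

lemma conj_by_eq_commutator_mult:
  "x \<in> carrier G \<Longrightarrow> y \<in> carrier G \<Longrightarrow> conj_by G x y = commutator G x y \<otimes> y"
  by (simp add: conj_by_def commutator_def m_assoc)

lemma conj_by_eq_self_iff:
  assumes "x \<in> carrier G" "y \<in> carrier G"
  shows "conj_by G x y = y \<longleftrightarrow> x \<otimes> y = y \<otimes> x"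
proof -
  have "conj_by G x y = y \<longleftrightarrow> conj_by G x y \<otimes> x = y \<otimes> x"
    using assms by simp
  then show ?thesis
    using assms by (simp add: conj_by_def m_assoc)
qed

lemma commutator_eqI:
  assumes "x \<in> carrier G" "y \<in> carrier G" "z \<in> carrier G" "x \<otimes> y = z \<otimes> (y \<otimes> x)"
  shows "commutator G x y = z"
  using assms by (simp add: commutator_def) (simp add: m_assoc)

lemma commutator_eq_one_iff:
  assumes "x \<in> carrier G" "y \<in> carrier G"
  shows "commutator G x y = \<one> \<longleftrightarrow> x \<otimes> y = y \<otimes> x"
  using conj_by_eq_self_iff[OF assms] conj_by_eq_commutator_mult[OF assms] assms
  by simp

end

lemma (in group) subgroup_centralizer:
  assumes [simp]: "x \<in> carrier G"
  shows "subgroup {y \<in> carrier G. x \<otimes> y = y \<otimes> x} G"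
proof (rule subgroupI)
  fix y assume "y \<in> {y \<in> carrier G. x \<otimes> y = y \<otimes> x}"
  then have [simp]: "y \<in> carrier G" and e: "y \<otimes> x = x \<otimes> y" by auto
  have "inv y \<otimes> (y \<otimes> x) \<otimes> inv y = inv y \<otimes> (x \<otimes> y) \<otimes> inv y" by (simp add: e)
  then have "x \<otimes> inv y = inv y \<otimes> x"
    by (simp add: m_assoc)
  then show "inv y \<in> {y \<in> carrier G. x \<otimes> y = y \<otimes> x}" by simp
next
  fix y z assume "y \<in> {y \<in> carrier G. x \<otimes> y = y \<otimes> x}" "z \<in> {y \<in> carrier G. x \<otimes> y = y \<otimes> x}"
  then have [simp]: "y \<in> carrier G" "z \<in> carrier G" and e: "x \<otimes> y = y \<otimes> x" "x \<otimes> z = z \<otimes> x"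
    by auto
  have "x \<otimes> (y \<otimes> z) = y \<otimes> (x \<otimes> z)"
    by (simp add: e(1) flip: m_assoc)
  then have "x \<otimes> (y \<otimes> z) = y \<otimes> z \<otimes> x"
    by (simp add: e(2) m_assoc)
  then show "y \<otimes> z \<in> {y \<in> carrier G. x \<otimes> y = y \<otimes> x}" by simp
qed (auto intro: exI[of _ \<one>])

lemma (in group) comm_group_if_commuting_generators:
  assumes E: "E \<subseteq> carrier G" "generate G E = carrier G"
    and comm: "\<And>x y. x \<in> E \<Longrightarrow> y \<in> E \<Longrightarrow> x \<otimes> y = y \<otimes> x"
  shows "comm_group G"
proof -
  have "generate G E \<subseteq> {y \<in> carrier G. x \<otimes> y = y \<otimes> x}" if "x \<in> E" for x
    using that E(1) comm by (intro generate_subgroup_incl subgroup_centralizer) auto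
  then have "E \<subseteq> {y \<in> carrier G. x \<otimes> y = y \<otimes> x}" if "x \<in> carrier G" for x
    using that E by fastforce
  then have "generate G E \<subseteq> {y \<in> carrier G. x \<otimes> y = y \<otimes> x}" if "x \<in> carrier G" for x
    using that by (intro generate_subgroup_incl subgroup_centralizer) auto
  then show ?thesis
    unfolding E(2) by (intro group_comm_groupI) auto
qed

section \<open>Crossed pairings\<close>

text \<open>
  The relations of the tensor square, read in an arbitrary group: homomorphisms from the tensor square
  of \<open>G\<close> to \<open>M\<close> correspond to crossed pairings of \<open>G\<close> with values in \<open>M\<close>.
\<close>
locale crossed_pairing = G: group G + M: group M
  for G :: "('a, 'c) monoid_scheme" (structure) and M :: "('b, 'd) monoid_scheme"
    and \<tau> :: "'a \<Rightarrow> 'a \<Rightarrow> 'b" +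
  assumes closed [simp, intro]:
      "g \<in> carrier G \<Longrightarrow> h \<in> carrier G \<Longrightarrow> \<tau> g h \<in> carrier M"
    and mult_left: "\<lbrakk>g1 \<in> carrier G; g \<in> carrier G; h \<in> carrier G\<rbrakk> \<Longrightarrow>
      \<tau> (g1 \<otimes> g) h = \<tau> (conj_by G g1 g) (conj_by G g1 h) \<otimes>\<^bsub>M\<^esub> \<tau> g1 h"
    and mult_right: "\<lbrakk>g \<in> carrier G; h1 \<in> carrier G; h \<in> carrier G\<rbrakk> \<Longrightarrow>
      \<tau> g (h1 \<otimes> h) = \<tau> g h1 \<otimes>\<^bsub>M\<^esub> \<tau> (conj_by G h1 g) (conj_by G h1 h)"
begin

abbreviation mult_M (infixl "\<cdot>" 70) where
  "x \<cdot> y \<equiv> x \<otimes>\<^bsub>M\<^esub> y"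

lemma one_left [simp]: "h \<in> carrier G \<Longrightarrow> \<tau> \<one> h = \<one>\<^bsub>M\<^esub>"
  using mult_left[of \<one> \<one> h] by (simp add: M.l_cancel_one')

lemma one_right [simp]: "g \<in> carrier G \<Longrightarrow> \<tau> g \<one> = \<one>\<^bsub>M\<^esub>"
  using mult_right[of g \<one> \<one>] by (simp add: M.l_cancel_one')

lemma inv_left:
  assumes "g \<in> carrier G" "h \<in> carrier G"
  shows "\<tau> (inv g) (conj_by G g h) = inv\<^bsub>M\<^esub> \<tau> g h"
proof -
  have "conj_by G g (inv g) = inv g"
    using assms by (simp add: conj_by_def)
  then have "\<tau> (inv g) (conj_by G g h) \<cdot> \<tau> g h = \<one>\<^bsub>M\<^esub>"
    using mult_left[of g "inv g" h] assms by simp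
  then show ?thesis
    using assms by (simp add: M.inv_equality)
qed

lemma inv_right:
  assumes "g \<in> carrier G" "h \<in> carrier G"
  shows "\<tau> (conj_by G h g) (inv h) = inv\<^bsub>M\<^esub> \<tau> g h"
proof -
  have "conj_by G h (inv h) = inv h"
    using assms by (simp add: conj_by_def)
  then have "\<tau> g h \<cdot> \<tau> (conj_by G h g) (inv h) = \<one>\<^bsub>M\<^esub>"
    using mult_right[of g h "inv h"] assms by simp
  then show ?thesis
    using assms by (metis M.inv_equality M.inv_inv G.conj_by_closed closed G.inv_closed)
qed

text \<open>
  Conjugation by \<open>g \<otimes> h\<close> is the action of \<open>[g, h]\<close>. This comes from expanding \<open>(g z) \<otimes> (h w)\<close> in
  both arguments in the two possible orders. The outer factors agree, and comparing the inner ones shows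
  that the action of \<open>g h\<close> on \<open>z \<otimes> w\<close>, multiplied by \<open>g \<otimes> h\<close> from the right, equals the action of \<open>h g\<close>
  multiplied by \<open>g \<otimes> h\<close> from the left.
\<close>
lemma conj_by_tau:
  assumes [simp]: "g \<in> carrier G" "h \<in> carrier G" "x \<in> carrier G" "y \<in> carrier G"
  shows "\<tau> g h \<cdot> \<tau> x y
    = \<tau> (conj_by G (commutator G g h) x) (conj_by G (commutator G g h) y) \<cdot> \<tau> g h"
proof -
  have swap: "\<tau> (conj_by G (g \<otimes> h) z) (conj_by G (g \<otimes> h) w) \<cdot> \<tau> g h
      = \<tau> g h \<cdot> \<tau> (conj_by G (h \<otimes> g) z) (conj_by G (h \<otimes> g) w)"
    if [simp]: "z \<in> carrier G" "w \<in> carrier G" for z w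
  proof -
    let ?a = "\<tau> (conj_by G g z) (conj_by G g h)" and ?b = "\<tau> (conj_by G h g) (conj_by G h w)"
    let ?s = "\<tau> (conj_by G (g \<otimes> h) z) (conj_by G (g \<otimes> h) w)"
    let ?t = "\<tau> (conj_by G (h \<otimes> g) z) (conj_by G (h \<otimes> g) w)"
    have e: "conj_by G g h \<otimes> g = g \<otimes> h" "conj_by G h g \<otimes> h = h \<otimes> g"
      by (simp_all add: conj_by_def G.m_assoc)
    have "\<tau> (g \<otimes> z) (h \<otimes> w) = (?a \<cdot> ?s) \<cdot> (\<tau> g h \<cdot> ?b)"
      by (simp only: mult_left[of g z "h \<otimes> w"] mult_right[of g h w] G.conj_by_mult G.conj_by_conj_by
          mult_right[of "conj_by G g z" "conj_by G g h" "conj_by G g w"]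
          that assms e G.m_closed G.conj_by_closed)
    moreover have "\<tau> (g \<otimes> z) (h \<otimes> w) = (?a \<cdot> \<tau> g h) \<cdot> (?t \<cdot> ?b)"
      by (simp only: mult_right[of "g \<otimes> z" h w] mult_left[of g z h] G.conj_by_mult G.conj_by_conj_by
          mult_left[of "conj_by G h g" "conj_by G h z" "conj_by G h w"]
          that assms e G.m_closed G.conj_by_closed)
    ultimately have "(?a \<cdot> ?s) \<cdot> (\<tau> g h \<cdot> ?b)
        = (?a \<cdot> \<tau> g h) \<cdot> (?t \<cdot> ?b)"
      by metis
    then have "?a \<cdot> ((?s \<cdot> \<tau> g h) \<cdot> ?b)
        = ?a \<cdot> ((\<tau> g h \<cdot> ?t) \<cdot> ?b)"
      by (simp only: M.m_assoc closed M.m_closed G.m_closed G.conj_by_closed that assms)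
    then show ?thesis
      by simp
  qed
  \<comment> \<open>move \<open>x\<close> and \<open>y\<close> back by \<open>h g\<close>, since \<open>g h (h g)\<^sup>-\<^sup>1 = [g, h]\<close>\<close>
  let ?u = "inv (h \<otimes> g)"
  have "g \<otimes> h \<otimes> ?u = commutator G g h"
    by (simp add: commutator_def G.inv_mult_group G.m_assoc)
  then show ?thesis
    using swap[of "conj_by G ?u x" "conj_by G ?u y"] by (simp add: G.conj_by_conj_by del: G.inv_mult_group)
qed

text \<open>
  Both sides are \<open>g \<otimes> (k h)\<close>, the left one because \<open>k h = h (h\<^sup>-\<^sup>1 k h)\<close>.
\<close>
lemma conj_right:
  assumes [simp]: "g \<in> carrier G" "h \<in> carrier G" "k \<in> carrier G"
  shows "\<tau> g h \<cdot> \<tau> (conj_by G h g) k = \<tau> g k \<cdot> \<tau> (conj_by G k g) (conj_by G k h)"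
proof -
  have "h \<otimes> (inv h \<otimes> k \<otimes> h) = k \<otimes> h" "conj_by G h (inv h \<otimes> k \<otimes> h) = k"
    by (simp_all add: conj_by_def G.m_assoc)
  then show ?thesis
    using mult_right[of g h "inv h \<otimes> k \<otimes> h"] mult_right[of g k h] by simp
qed

text \<open>
  Both sides are \<open>(k g) \<otimes> h\<close>.
\<close>
lemma conj_left:
  assumes [simp]: "g \<in> carrier G" "h \<in> carrier G" "k \<in> carrier G"
  shows "\<tau> k (conj_by G g h) \<cdot> \<tau> g h = \<tau> (conj_by G k g) (conj_by G k h) \<cdot> \<tau> k h"
proof -
  have "g \<otimes> (inv g \<otimes> k \<otimes> g) = k \<otimes> g" "conj_by G g (inv g \<otimes> k \<otimes> g) = k"
    by (simp_all add: conj_by_def G.m_assoc)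
  then show ?thesis
    using mult_left[of g "inv g \<otimes> k \<otimes> g" h] mult_left[of k g h] by simp
qed

text \<open>
  The identity \<open>k \<otimes> [g, h] = \<^sup>k(g \<otimes> h) (g \<otimes> h)\<^sup>-\<^sup>1\<close> of Brown and Loday. Write \<open>[g, h]\<close> as
  \<open>\<^sup>g h h\<^sup>-\<^sup>1\<close> and expand; as \<open>\<^sup>g h = [g, h] h\<close>, the second factor is the conjugate of
  \<open>\<^sup>h k \<otimes> h\<^sup>-\<^sup>1 = (k \<otimes> h)\<^sup>-\<^sup>1\<close> by \<open>g \<otimes> h\<close>.
\<close>
lemma commutator_right:
  assumes [simp]: "g \<in> carrier G" "h \<in> carrier G" "k \<in> carrier G"
  shows "\<tau> (conj_by G k g) (conj_by G k h) = \<tau> k (commutator G g h) \<cdot> \<tau> g h"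
proof -
  let ?d = "commutator G g h" and ?u = "\<tau> g h" and ?v = "\<tau> (conj_by G k g) (conj_by G k h)"
  let ?w = "\<tau> (conj_by G (conj_by G g h) k) (conj_by G (conj_by G g h) (inv h))"
  have d: "?d = conj_by G g h \<otimes> inv h" "?d \<otimes> h = conj_by G g h"
    by (simp_all add: commutator_def conj_by_def G.m_assoc)
  have "?u \<cdot> \<tau> (conj_by G h k) (inv h) = ?w \<cdot> ?u"
    using conj_by_tau[of g h "conj_by G h k" "conj_by G h (inv h)"]
    by (simp add: G.conj_by_conj_by d(2)) (simp add: conj_by_def)
  then have w: "?w \<cdot> ?u = ?u \<cdot> inv\<^bsub>M\<^esub> \<tau> k h"
    by (simp add: inv_right)
  have "\<tau> k ?d = \<tau> k (conj_by G g h) \<cdot> ?w"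
    by (simp add: d(1) mult_right)
  then have "\<tau> k ?d \<cdot> ?u = \<tau> k (conj_by G g h) \<cdot> ?u \<cdot> inv\<^bsub>M\<^esub> \<tau> k h"
    by (simp add: M.m_assoc w)
  also have "\<dots> = ?v"
    by (simp add: conj_left[OF assms] M.m_assoc)
  finally show ?thesis ..
qed

text \<open>
  The companion identity \<open>[g, h] \<otimes> k = (g \<otimes> h) \<^sup>k(g \<otimes> h)\<^sup>-\<^sup>1\<close>, from \<open>[g, h] = g \<^sup>h(g\<^sup>-\<^sup>1)\<close>.
\<close>
lemma commutator_left:
  assumes [simp]: "g \<in> carrier G" "h \<in> carrier G" "k \<in> carrier G"
  shows "\<tau> (commutator G g h) k \<cdot> \<tau> (conj_by G k g) (conj_by G k h) = \<tau> g h"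
proof -
  let ?d = "commutator G g h" and ?u = "\<tau> g h" and ?v = "\<tau> (conj_by G k g) (conj_by G k h)"
  let ?a = "inv g" and ?h = "conj_by G g h" and ?k = "conj_by G g k"
  have d: "?d = g \<otimes> conj_by G h ?a" "conj_by G g (conj_by G h ?a) = conj_by G ?h ?a"
    by (simp_all add: commutator_def conj_by_def G.m_assoc G.inv_mult_group)
  have 1: "\<tau> ?d k = \<tau> (conj_by G ?h ?a) ?k \<cdot> \<tau> g k"
    using mult_left[of g "conj_by G h ?a" k] d by simp
  have 2: "\<tau> (conj_by G ?k ?a) (conj_by G ?k ?h) \<cdot> \<tau> g k = \<tau> g k \<cdot> inv\<^bsub>M\<^esub> ?v"
  proof -
    let ?c = "commutator G g k" and ?x = "inv (conj_by G k g)"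
    let ?y = "conj_by G (conj_by G k g) (conj_by G k h)"
    have "conj_by G ?c ?x = conj_by G ?k ?a" "conj_by G ?c ?y = conj_by G ?k ?h"
      by (simp_all add: commutator_def conj_by_def G.m_assoc G.inv_mult_group)
    moreover have "inv\<^bsub>M\<^esub> ?v = \<tau> ?x ?y"
      by (simp add: inv_left)
    ultimately show ?thesis
      using conj_by_tau[of g k ?x ?y] by simp
  qed
  have 3: "inv\<^bsub>M\<^esub> ?u \<cdot> \<tau> (conj_by G ?h ?a) ?k = inv\<^bsub>M\<^esub> \<tau> g k \<cdot> \<tau> (conj_by G ?k ?a) (conj_by G ?k ?h)"
    using conj_right[of ?a ?h ?k] by (simp add: inv_left)
  let ?A = "\<tau> (conj_by G ?h ?a) ?k" and ?C = "\<tau> (conj_by G ?k ?a) (conj_by G ?k ?h)"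
  have "?A = ?u \<cdot> (inv\<^bsub>M\<^esub> ?u \<cdot> ?A)"
    by simp
  then have "\<tau> ?d k = ?u \<cdot> (inv\<^bsub>M\<^esub> \<tau> g k \<cdot> (?C \<cdot> \<tau> g k))"
    unfolding 1 3 by (simp add: M.m_assoc)
  also have "\<dots> = ?u \<cdot> inv\<^bsub>M\<^esub> ?v"
    unfolding 2 by simp
  finally show ?thesis
    by (simp add: M.m_assoc)
qed

end

section \<open>A bound for groups generated by a crossed pairing\<close>

lemma (in comm_group) card_generate_le:
  assumes "finite E" "E \<subseteq> carrier G" "m > 0" "\<And>e. e \<in> E \<Longrightarrow> e [^] (m :: nat) = \<one>"
  shows "finite (generate G E) \<and> card (generate G E) \<le> m ^ card E"
  using assms(1,2,4)
proof (induction E)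
  case empty
  then show ?case
    by (simp add: generate_empty)
next
  case (insert e E)
  have [simp]: "e \<in> carrier G" and E: "E \<subseteq> carrier G"
    using insert.prems by auto
  have "ord e dvd m"
    using insert.prems(2)[of e] by (simp add: pow_eq_id)
  then have e: "ord e \<noteq> 0" "ord e \<le> m"
    using assms(3) by (auto simp: dvd_imp_le)
  then have e_fin: "finite (generate G {e})" and e_card: "card (generate G {e}) \<le> m"
    using generate_pow_card[of e] card_gt_0_iff[of "generate G {e}"] by auto
  have IH: "finite (generate G E)" "card (generate G E) \<le> m ^ card E"
    using insert E by auto
  let ?H = "generate G {e} <#> generate G E"
  have "subgroup ?H G"
    using E by (intro mult_subgroups generate_is_subgroup) auto
  moreover have "insert e E \<subseteq> ?H"
  proof -
    have "e \<otimes> \<one> \<in> ?H"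
      unfolding set_mult_def by (blast intro: generate.intros)
    moreover have "\<one> \<otimes> x \<in> ?H" if "x \<in> E" for x
      unfolding set_mult_def using that by (blast intro: generate.intros)
    ultimately show ?thesis
      using E by fastforce
  qed
  ultimately have sub: "generate G (insert e E) \<subseteq> ?H"
    by (intro generate_subgroup_incl)
  have H: "?H = (\<lambda>(x, y). x \<otimes> y) ` (generate G {e} \<times> generate G E)"
    by (auto simp: set_mult_def)
  have "finite ?H"
    unfolding H using e_fin IH by auto
  moreover have "card ?H \<le> m * m ^ card E"
    unfolding H using e_card IH e_fin
    by (intro order_trans[OF card_image_le]) (auto simp: card_cartesian_product intro: mult_le_mono)
  ultimately show ?case
    using sub insert.hyps card_mono[of ?H] by (auto intro: finite_subset order_trans)
qed

text \<open>
  The element \<open>k\<close> moves the derived subgroup so freely that every element of it is a commutator with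
  \<open>k\<close>. The central subgroup \<open>N\<close> collects the values of the pairing on the derived subgroup; in the
  tensor squares below it has at most two elements.
\<close>
locale derived_pairing = crossed_pairing G M \<tau>
  for G :: "('a, 'c) monoid_scheme" (structure) and M :: "('b, 'd) monoid_scheme"
    and \<tau> :: "'a \<Rightarrow> 'a \<Rightarrow> 'b" +
  fixes k :: 'a and N :: "'b set"
  assumes k [simp, intro]: "k \<in> carrier G"
    and derived_comm: "\<lbrakk>c \<in> derived G (carrier G); d \<in> derived G (carrier G)\<rbrakk> \<Longrightarrow> c \<otimes> d = d \<otimes> c"
    and derived_commutator: "c \<in> derived G (carrier G) \<Longrightarrow>
      \<exists>c1 \<in> derived G (carrier G). c = commutator G c1 k"
    and N: "subgroup N M"
    and N_central: "\<lbrakk>n \<in> N; m \<in> carrier M\<rbrakk> \<Longrightarrow> m \<otimes>\<^bsub>M\<^esub> n = n \<otimes>\<^bsub>M\<^esub> m"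
    and tau_derived: "\<lbrakk>c \<in> derived G (carrier G); d \<in> derived G (carrier G)\<rbrakk> \<Longrightarrow> \<tau> c d \<in> N"
    and generated: "generate M {\<tau> g h | g h. g \<in> carrier G \<and> h \<in> carrier G} = carrier M"
begin

abbreviation D where "D \<equiv> derived G (carrier G)"

sublocale N: subgroup N M by (rule N)
sublocale D: normal D G using G.derived_self_is_normal .

declare D.subset [THEN subsetD, simp] N.subset [THEN subsetD, simp]

lemma commutator_in_D [simp, intro]:
  "g \<in> carrier G \<Longrightarrow> h \<in> carrier G \<Longrightarrow> commutator G g h \<in> D"
  by (rule G.commutator_in_derived)

lemma conj_by_D_mem [simp]: "g \<in> carrier G \<Longrightarrow> c \<in> D \<Longrightarrow> conj_by G g c \<in> D"
  unfolding conj_by_def by (rule D.inv_op_closed2)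

lemma conj_by_D_D [simp]: "c \<in> D \<Longrightarrow> d \<in> D \<Longrightarrow> conj_by G c d = d"
  by (simp add: conj_by_def derived_comm[of c d] G.m_assoc)

text \<open>
  The factor in \<open>N\<close> is \<open>d \<otimes> [g, h]\<close>, by \<open>commutator_right\<close>.
\<close>
lemma tau_conj_D:
  assumes "d \<in> D" "g \<in> carrier G" "h \<in> carrier G"
  obtains n where "n \<in> N" "\<tau> (conj_by G d g) (conj_by G d h) = n \<cdot> \<tau> g h"
  using commutator_right[of g h d] tau_derived[of d "commutator G g h"] assms by auto

text \<open>
  If \<open>M\<close> is the tensor square and \<open>N\<close> is generated by the elements \<open>c \<otimes> d\<close> with \<open>c\<close>, \<open>d\<close> in \<open>D\<close>, this is the
  kernel of the map to the tensor square of the abelianization. It is written with the single second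
  argument \<open>k\<close> because that bounds its order by \<open>|N| |D|\<close>.
\<close>
definition K where "K = {n \<cdot> \<tau> c k | n c. n \<in> N \<and> c \<in> D}"

lemma N_subset_K: "n \<in> N \<Longrightarrow> n \<in> K"
  unfolding K_def using D.one_closed by (force intro: exI[of _ n] exI[of _ \<one>])

lemma tau_k_in_K: "c \<in> D \<Longrightarrow> \<tau> c k \<in> K"
  unfolding K_def by (force intro: exI[of _ "\<one>\<^bsub>M\<^esub>"])

lemma N_mult_K: "n \<in> N \<Longrightarrow> x \<in> K \<Longrightarrow> n \<cdot> x \<in> K"
proof -
  assume n: "n \<in> N" and "x \<in> K"
  then obtain n' c where "x = n' \<cdot> \<tau> c k" "n' \<in> N" "c \<in> D"
    by (auto simp: K_def)
  moreover from this have "n \<cdot> x = (n \<cdot> n') \<cdot> \<tau> c k" "n \<cdot> n' \<in> N"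
    using n by (simp_all add: M.m_assoc)
  ultimately show ?thesis
    unfolding K_def by blast
qed

lemma K_subset: "K \<subseteq> carrier M"
  by (auto simp: K_def)

text \<open>
  Modulo \<open>N\<close>, the map \<open>c \<mapsto> c \<otimes> k\<close> is multiplicative on \<open>D\<close>.
\<close>
lemma K_mult:
  assumes "x \<in> K" "y \<in> K"
  shows "x \<cdot> y \<in> K"
proof -
  obtain n c n' c' where x: "x = n \<cdot> \<tau> c k" "n \<in> N" "c \<in> D"
    and y: "y = n' \<cdot> \<tau> c' k" "n' \<in> N" "c' \<in> D"
    using assms by (auto simp: K_def)
  obtain n1 where n1: "n1 \<in> N" "\<tau> (conj_by G c' c) (conj_by G c' k) = n1 \<cdot> \<tau> c k"
    using tau_conj_D[of c' c k] x y by auto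
  have e: "n1 \<cdot> (\<tau> c k \<cdot> \<tau> c' k) = \<tau> (c' \<otimes> c) k"
    using mult_left[of c' c k] n1 x y by (simp add: M.m_assoc)
  have "\<tau> c k \<cdot> \<tau> c' k = inv\<^bsub>M\<^esub> n1 \<cdot> \<tau> (c' \<otimes> c) k"
    unfolding e[symmetric] using n1 x y by simp
  moreover have "x \<cdot> y = n \<cdot> (n' \<cdot> (\<tau> c k \<cdot> \<tau> c' k))"
  proof -
    have "\<tau> c k \<cdot> (n' \<cdot> \<tau> c' k) = n' \<cdot> (\<tau> c k \<cdot> \<tau> c' k)"
      using N_central[of n' "\<tau> c k"] x y by (simp flip: M.m_assoc)
    then show ?thesis
      using x y by (simp add: M.m_assoc)
  qed
  ultimately show ?thesis
    using x y n1 by (simp add: N_mult_K tau_k_in_K)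
qed

lemma K_cong_inv:
  assumes "x \<in> carrier M" "y \<in> K" "x \<cdot> y \<in> K" "subgroup K M"
  shows "x \<in> K"
proof -
  have "x = (x \<cdot> y) \<cdot> inv\<^bsub>M\<^esub> y"
    using assms K_subset by (auto simp: M.m_assoc subset_iff)
  then show ?thesis
    using assms subgroup.m_closed subgroup.m_inv_closed by metis
qed

lemma subgroup_K: "subgroup K M"
proof (rule M.subgroupI)
  fix x assume "x \<in> K"
  then obtain n c where x: "x = n \<cdot> \<tau> c k" "n \<in> N" "c \<in> D"
    by (auto simp: K_def)
  obtain n1 where n1: "n1 \<in> N" "\<tau> (conj_by G (inv c) c) (conj_by G (inv c) k) = n1 \<cdot> \<tau> c k"
    using tau_conj_D[of "inv c" c k] x by auto
  have "n1 \<cdot> (\<tau> c k \<cdot> \<tau> (inv c) k) = \<one>\<^bsub>M\<^esub>"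
    using mult_left[of "inv c" c k] n1 x by (simp add: M.m_assoc)
  then have "inv\<^bsub>M\<^esub> \<tau> (inv c) k = n1 \<cdot> \<tau> c k"
    using n1 x by (intro M.inv_equality) (simp_all add: M.m_assoc)
  then have "\<tau> c k = inv\<^bsub>M\<^esub> n1 \<cdot> inv\<^bsub>M\<^esub> \<tau> (inv c) k"
    using n1 x by simp
  then have "inv\<^bsub>M\<^esub> \<tau> c k = inv\<^bsub>M\<^esub> (inv\<^bsub>M\<^esub> n1 \<cdot> inv\<^bsub>M\<^esub> \<tau> (inv c) k)"
    by (rule arg_cong)
  then have "inv\<^bsub>M\<^esub> \<tau> c k = \<tau> (inv c) k \<cdot> n1"
    using n1 x by (simp add: M.inv_mult_group)
  then have "inv\<^bsub>M\<^esub> x = (\<tau> (inv c) k \<cdot> n1) \<cdot> inv\<^bsub>M\<^esub> n"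
    using x by (simp add: M.inv_mult_group)
  then show "inv\<^bsub>M\<^esub> x \<in> K"
    using x n1 by (simp add: K_mult tau_k_in_K N_subset_K)
qed (use K_subset K_mult N_subset_K[OF N.one_closed] in auto)

sublocale K: subgroup K M by (rule subgroup_K)

text \<open>
  For \<open>c = [c1, k]\<close>, both \<open>c \<otimes> h\<close> and \<open>h \<otimes> c\<close> are quotients of \<open>c1 \<otimes> k\<close> and \<open>\<^sup>h c1 \<otimes> \<^sup>h k\<close>, and
  \<open>\<^sup>h k = [h, k] k\<close> differs from \<open>k\<close> by an element of \<open>D\<close> only.
\<close>
lemma tau_D_in_K:
  assumes "c \<in> D" "h \<in> carrier G"
  shows "\<tau> c h \<in> K" "\<tau> h c \<in> K"
proof -
  have dk: "\<tau> e (d \<otimes> k) \<in> K" if ed: "e \<in> D" "d \<in> D" for e d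
  proof -
    obtain n where n: "n \<in> N" "\<tau> (conj_by G d e) (conj_by G d k) = n \<cdot> \<tau> e k"
      using tau_conj_D[of d e k] ed by auto
    have "\<tau> e (d \<otimes> k) = \<tau> e d \<cdot> (n \<cdot> \<tau> e k)"
      using mult_right[of e d k] n that by simp
    then show ?thesis
      using n that by (simp add: N_mult_K tau_derived tau_k_in_K)
  qed
  obtain c1 where c1: "c1 \<in> D" "c = commutator G c1 k"
    using derived_commutator[OF assms(1)] by blast
  have conj: "\<tau> (conj_by G h c1) (conj_by G h k) \<in> K"
    unfolding G.conj_by_eq_commutator_mult[OF assms(2) k]
    using c1 assms by (intro dk) auto
  show "\<tau> c h \<in> K"
    using commutator_left[of c1 k h] c1 assms conj tau_k_in_K[of c1] by (auto intro: K_cong_inv subgroup_K)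
  show "\<tau> h c \<in> K"
    using commutator_right[of c1 k h] c1 assms conj tau_k_in_K[of c1] by (auto intro: K_cong_inv subgroup_K)
qed

text \<open>
  A generator \<open>g \<otimes> h\<close> acts on \<open>K\<close> by conjugation with \<open>[g, h]\<close> in \<open>D\<close>, hence trivially modulo \<open>N\<close>. In this
  form the claim passes to products and inverses of \<open>m\<close>.
\<close>
lemma conj_K:
  assumes "m \<in> carrier M" "x \<in> K"
  shows "\<exists>n\<in>N. m \<cdot> x = n \<cdot> (x \<cdot> m)"
proof -
  let ?T = "{\<tau> g h | g h. g \<in> carrier G \<and> h \<in> carrier G}"
  have x [simp]: "x \<in> carrier M"
    using assms K_subset by auto
  have gen: "\<exists>n\<in>N. t \<cdot> x = n \<cdot> (x \<cdot> t)" if tT: "t \<in> ?T" for t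
  proof -
    obtain g h where t: "t = \<tau> g h" and [simp]: "g \<in> carrier G" "h \<in> carrier G"
      using tT by auto
    obtain n c where nc: "x = n \<cdot> \<tau> c k" "n \<in> N" "c \<in> D"
      using assms by (auto simp: K_def)
    obtain n1 where n1: "n1 \<in> N" "\<tau> (conj_by G (commutator G g h) c) (conj_by G (commutator G g h) k) = n1 \<cdot> \<tau> c k"
      using tau_conj_D[of "commutator G g h" c k] nc by auto
    have "t \<cdot> x = n \<cdot> (t \<cdot> \<tau> c k)"
      using nc N_central[of n t] by (simp add: t flip: M.m_assoc)
    also have "\<dots> = n \<cdot> (n1 \<cdot> (\<tau> c k \<cdot> t))"
      using conj_by_tau[of g h c k] n1 nc by (simp add: t M.m_assoc)
    also have "\<dots> = n1 \<cdot> (x \<cdot> t)"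
      using nc n1 N_central[of n n1] by (simp add: t) (simp flip: M.m_assoc)
    finally show ?thesis
      using n1 by blast
  qed
  have T: "?T \<subseteq> carrier M"
    by auto
  have "m \<in> generate M ?T"
    using assms generated by simp
  then show ?thesis
  proof (induction m rule: generate.induct)
    case one
    show ?case
      by (rule bexI[of _ "\<one>\<^bsub>M\<^esub>"]) auto
  next
    case (incl h)
    then show ?case by (rule gen)
  next
    case (inv h)
    then have [simp]: "h \<in> carrier M" using T by auto
    obtain n where n: "n \<in> N" "h \<cdot> x = n \<cdot> (x \<cdot> h)"
      using gen[OF inv] by blast
    have "x \<cdot> inv\<^bsub>M\<^esub> h = inv\<^bsub>M\<^esub> h \<cdot> (h \<cdot> x) \<cdot> inv\<^bsub>M\<^esub> h"
      by simp
    also have "\<dots> = (inv\<^bsub>M\<^esub> h \<cdot> n) \<cdot> x"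
      using n by (simp add: M.m_assoc)
    also have "\<dots> = n \<cdot> (inv\<^bsub>M\<^esub> h \<cdot> x)"
      using n N_central[of n "inv\<^bsub>M\<^esub> h"] by (simp add: M.m_assoc)
    finally have "inv\<^bsub>M\<^esub> h \<cdot> x = inv\<^bsub>M\<^esub> n \<cdot> (x \<cdot> inv\<^bsub>M\<^esub> h)"
      using n by simp
    then show ?case
      using n by (intro bexI[of _ "inv\<^bsub>M\<^esub> n"]) auto
  next
    case (eng a b)
    have [simp]: "a \<in> carrier M" "b \<in> carrier M"
      using eng.hyps T M.generate_in_carrier by auto
    obtain n1 n2 where n: "n1 \<in> N" "n2 \<in> N" "a \<cdot> x = n1 \<cdot> (x \<cdot> a)"
      "b \<cdot> x = n2 \<cdot> (x \<cdot> b)"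
      using eng.IH by blast
    have "a \<cdot> b \<cdot> x = (a \<cdot> n2) \<cdot> (x \<cdot> b)"
      using n by (simp add: M.m_assoc)
    also have "\<dots> = n2 \<cdot> ((a \<cdot> x) \<cdot> b)"
      by (simp add: N_central[OF n(2)] n(1,2)) (simp add: M.m_assoc n(1,2))
    also have "\<dots> = n2 \<cdot> n1 \<cdot> (x \<cdot> (a \<cdot> b))"
      unfolding n(3) using n(1,2) by (simp add: M.m_assoc)
    finally show ?case
      using n by (intro bexI[of _ "n2 \<cdot> n1"]) auto
  qed
qed

lemma normal_K: "K \<lhd> M"
proof (rule M.normal_inv_iff[THEN iffD2], intro conjI ballI)
  fix m x assume m: "m \<in> carrier M" and x: "x \<in> K"
  obtain n where n: "n \<in> N" "m \<cdot> x = n \<cdot> (x \<cdot> m)"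
    using conj_K[OF m x] by blast
  then have "m \<cdot> x \<cdot> inv\<^bsub>M\<^esub> m = n \<cdot> x"
    using m x K_subset by (simp add: M.m_assoc subset_iff)
  then show "m \<cdot> x \<cdot> inv\<^bsub>M\<^esub> m \<in> K"
    using n x N_mult_K by simp
qed (rule subgroup_K)

sublocale K: normal K M by (rule normal_K)

sublocale Q: group "M Mod K" by (rule K.factorgroup_is_group)

abbreviation \<beta> where "\<beta> g h \<equiv> K #>\<^bsub>M\<^esub> \<tau> g h"

lemma coset_mult:
  "x \<in> carrier M \<Longrightarrow> y \<in> carrier M \<Longrightarrow>
    (K #>\<^bsub>M\<^esub> x) \<otimes>\<^bsub>M Mod K\<^esub> (K #>\<^bsub>M\<^esub> y) = K #>\<^bsub>M\<^esub> (x \<cdot> y)"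
  by (simp add: K.rcos_sum)

lemma coset_closed [simp]: "x \<in> carrier M \<Longrightarrow> K #>\<^bsub>M\<^esub> x \<in> carrier (M Mod K)"
  by (simp add: carrier_FactGroup)

lemma coset_K: "x \<in> K \<Longrightarrow> K #>\<^bsub>M\<^esub> x = \<one>\<^bsub>M Mod K\<^esub>"
  by (simp add: M.coset_join2 subgroup_K K.mem_carrier)

lemma coset_K_mult:
  assumes "x \<in> K" "y \<in> carrier M"
  shows "K #>\<^bsub>M\<^esub> (x \<cdot> y) = K #>\<^bsub>M\<^esub> y" "K #>\<^bsub>M\<^esub> (y \<cdot> x) = K #>\<^bsub>M\<^esub> y"
  using coset_mult[of x y] coset_mult[of y x] assms K_subset coset_K[of x] Q.l_one Q.r_one coset_closed[of y]
  by (auto simp: subset_iff simp del: mult_FactGroup one_FactGroup)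

lemma beta_conj_D:
  assumes "d \<in> D" "g \<in> carrier G" "h \<in> carrier G"
  shows "\<beta> (conj_by G d g) (conj_by G d h) = \<beta> g h"
proof -
  obtain n where "n \<in> N" "\<tau> (conj_by G d g) (conj_by G d h) = n \<cdot> \<tau> g h"
    using tau_conj_D assms by blast
  then show ?thesis
    using assms by (simp add: coset_K_mult N_subset_K)
qed

lemma beta_D_mult:
  assumes "d \<in> D" "g \<in> carrier G" "h \<in> carrier G"
  shows "\<beta> (d \<otimes> g) h = \<beta> g h" "\<beta> g (d \<otimes> h) = \<beta> g h"
  using assms by (simp_all add: mult_left mult_right coset_K_mult tau_D_in_K beta_conj_D)

lemma beta_conj:
  assumes "x \<in> carrier G" "g \<in> carrier G" "h \<in> carrier G"
  shows "\<beta> (conj_by G x g) (conj_by G x h) = \<beta> g h"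
  using assms by (simp add: G.conj_by_eq_commutator_mult beta_D_mult)

text \<open>
  Modulo \<open>K\<close> the pairing ignores factors in \<open>D\<close>, hence also conjugation, and the two axioms of a
  crossed pairing become bilinearity.
\<close>
lemma beta_mult:
  assumes "g1 \<in> carrier G" "g \<in> carrier G" "h \<in> carrier G"
  shows "\<beta> (g1 \<otimes> g) h = \<beta> g h \<otimes>\<^bsub>M Mod K\<^esub> \<beta> g1 h" "\<beta> g (g1 \<otimes> h) = \<beta> g g1 \<otimes>\<^bsub>M Mod K\<^esub> \<beta> g h"
  using coset_mult[of "\<tau> (conj_by G g1 g) (conj_by G g1 h)" "\<tau> g1 h"]
    coset_mult[of "\<tau> g g1" "\<tau> (conj_by G g1 g) (conj_by G g1 h)"] assms
  by (simp_all add: mult_left mult_right beta_conj)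

lemma beta_comm:
  assumes "g \<in> carrier G" "h \<in> carrier G" "a \<in> carrier G" "b \<in> carrier G"
  shows "\<beta> g h \<otimes>\<^bsub>M Mod K\<^esub> \<beta> a b = \<beta> a b \<otimes>\<^bsub>M Mod K\<^esub> \<beta> g h"
proof -
  let ?d = "commutator G g h"
  have "\<beta> g h \<otimes>\<^bsub>M Mod K\<^esub> \<beta> a b = \<beta> (conj_by G ?d a) (conj_by G ?d b) \<otimes>\<^bsub>M Mod K\<^esub> \<beta> g h"
    using assms conj_by_tau[of g h a b] coset_mult by simp
  then show ?thesis
    using assms by (simp add: beta_conj)
qed

lemma beta_D:
  assumes "d \<in> D" "g \<in> carrier G"
  shows "\<beta> d g = \<one>\<^bsub>M Mod K\<^esub>" "\<beta> g d = \<one>\<^bsub>M Mod K\<^esub>"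
  using assms coset_K tau_D_in_K by blast+

lemma beta_inv:
  assumes "g \<in> carrier G" "h \<in> carrier G"
  shows "\<beta> (inv g) h = inv\<^bsub>M Mod K\<^esub> \<beta> g h" "\<beta> g (inv h) = inv\<^bsub>M Mod K\<^esub> \<beta> g h"
proof -
  have "\<beta> (inv g) h \<otimes>\<^bsub>M Mod K\<^esub> \<beta> g h = \<one>\<^bsub>M Mod K\<^esub>"
    using beta_mult(1)[of g "inv g" h] beta_D(1)[of \<one> h] assms by (simp del: mult_FactGroup one_FactGroup)
  then show "\<beta> (inv g) h = inv\<^bsub>M Mod K\<^esub> \<beta> g h"
    using assms by (intro Q.inv_equality[symmetric]) auto
  have "\<beta> g (inv h) \<otimes>\<^bsub>M Mod K\<^esub> \<beta> g h = \<one>\<^bsub>M Mod K\<^esub>"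
    using beta_mult(2)[of "inv h" g h] beta_D(2)[of \<one> g] assms by (simp del: mult_FactGroup one_FactGroup)
  then show "\<beta> g (inv h) = inv\<^bsub>M Mod K\<^esub> \<beta> g h"
    using assms by (intro Q.inv_equality[symmetric]) auto
qed

lemma beta_pow:
  assumes "g \<in> carrier G" "h \<in> carrier G"
  shows "\<beta> (g [^] (n :: nat)) h = \<beta> g h [^]\<^bsub>M Mod K\<^esub> n"
proof (induction n)
  case 0
  show ?case
    using beta_D(1)[of \<one> h] assms by (simp del: one_FactGroup)
next
  case (Suc n)
  have "\<beta> (g [^] Suc n) h = \<beta> g h \<otimes>\<^bsub>M Mod K\<^esub> \<beta> g h [^]\<^bsub>M Mod K\<^esub> n"
    using assms Suc by (simp add: beta_mult(1) del: mult_FactGroup)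
  then show ?case
    using assms Q.nat_pow_Suc2[of "\<beta> g h" n] by (simp del: mult_FactGroup)
qed

lemma generate_coset_tau:
  "generate (M Mod K) {\<beta> g h | g h. g \<in> carrier G \<and> h \<in> carrier G} = carrier (M Mod K)"
proof -
  interpret \<pi>: group_hom M "M Mod K" "\<lambda>x. K #>\<^bsub>M\<^esub> x"
    by unfold_locales (rule K.r_coset_hom_Mod)
  let ?T = "{\<tau> g h | g h. g \<in> carrier G \<and> h \<in> carrier G}"
  have "carrier (M Mod K) = (\<lambda>x. K #>\<^bsub>M\<^esub> x) ` generate M ?T"
    unfolding generated by (rule carrier_FactGroup)
  also have "\<dots> = generate (M Mod K) ((\<lambda>x. K #>\<^bsub>M\<^esub> x) ` ?T)"
    by (rule \<pi>.generate_img[symmetric]) auto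
  also have "(\<lambda>x. K #>\<^bsub>M\<^esub> x) ` ?T = {\<beta> g h | g h. g \<in> carrier G \<and> h \<in> carrier G}"
    by auto
  finally show ?thesis ..
qed

lemma generate_coset_tau_generators:
  assumes A: "A \<subseteq> carrier G" "generate G (A \<union> D) = carrier G"
  shows "generate (M Mod K) {\<beta> a b | a b. a \<in> A \<and> b \<in> A} = carrier (M Mod K)"
    (is "generate _ ?E = _")
proof -
  let ?H = "generate (M Mod K) ?E"
  have E: "?E \<subseteq> carrier (M Mod K)"
    using subsetD[OF A(1)] by auto
  interpret H: subgroup ?H "M Mod K"
    using E by (rule Q.generate_is_subgroup)
  have sub: "A \<union> D \<subseteq> carrier G"
    using A by auto
  have 1: "\<beta> g b \<in> ?H" if b: "b \<in> A" and g: "g \<in> carrier G" for g b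
  proof -
    have "g \<in> generate G (A \<union> D)"
      using g A(2) by simp
    then show ?thesis
    proof (induction g rule: generate.induct)
      case one
      show ?case
        using b A H.one_closed by (simp add: subset_iff)
    next
      case (incl g)
      then show ?case
        using b A beta_D(1)[of g b] by (auto intro: generate.incl generate.one simp del: one_FactGroup)
    next
      case (inv g)
      then have "\<beta> g b \<in> ?H" "g \<in> carrier G"
        using b A beta_D(1)[of g b] by (auto intro: generate.incl generate.one simp del: one_FactGroup)
      then show ?case
        using b A by (auto simp: beta_inv)
    next
      case (eng g1 g)
      then have "g1 \<in> carrier G" "g \<in> carrier G"
        using G.generate_in_carrier[OF sub] by auto
      then show ?case
        using eng.IH b A by (auto simp: beta_mult simp del: mult_FactGroup)
    qed
  qed
  have 2: "\<beta> g h \<in> ?H" if g: "g \<in> carrier G" and h: "h \<in> carrier G" for g h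
  proof -
    have "h \<in> generate G (A \<union> D)"
      using h A(2) by simp
    then show ?thesis
    proof (induction h rule: generate.induct)
      case one
      show ?case
        using g beta_D(2)[of \<one> g] H.one_closed by (simp del: one_FactGroup one_right)
    next
      case (incl h)
      then show ?case
        using g 1 beta_D(2)[of h g] by (auto simp del: one_FactGroup)
    next
      case (inv h)
      then have "\<beta> g h \<in> ?H" "h \<in> carrier G"
        using g A 1 beta_D(2)[of h g] by (auto simp del: one_FactGroup)
      then show ?case
        using g by (auto simp: beta_inv)
    next
      case (eng h1 h)
      then have "h1 \<in> carrier G" "h \<in> carrier G"
        using G.generate_in_carrier[OF sub] by auto
      then show ?case
        using eng.IH g by (auto simp: beta_mult simp del: mult_FactGroup)
    qed
  qed
  have "{\<beta> g h | g h. g \<in> carrier G \<and> h \<in> carrier G} \<subseteq> ?H"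
    using 2 by blast
  then have "generate (M Mod K) {\<beta> g h | g h. g \<in> carrier G \<and> h \<in> carrier G} \<subseteq> ?H"
    by (rule Q.generate_subgroup_incl) (rule H.subgroup_axioms)
  then show ?thesis
    unfolding generate_coset_tau using H.subset by blast
qed

text \<open>
  The quotient \<open>M Mod K\<close> is abelian and generated by the \<open>|A|\<^sup>2\<close> elements \<open>\<beta> a b\<close>, whose orders divide \<open>m\<close>
  because \<open>\<beta> a b [^] m = \<beta> (a [^] m) b\<close> is trivial.
\<close>
lemma card_le:
  assumes A: "finite A" "A \<subseteq> carrier G" "generate G (A \<union> D) = carrier G"
    and m: "m > 0" "\<And>a. a \<in> A \<Longrightarrow> a [^] (m :: nat) \<in> D"
    and fin: "finite N" "finite D"
  shows "finite (carrier M)" "card (carrier M) \<le> m ^ (card A * card A) * (card N * card D)"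
proof -
  let ?E = "{\<beta> a b | a b. a \<in> A \<and> b \<in> A}"
  have gen: "generate (M Mod K) ?E = carrier (M Mod K)"
    by (rule generate_coset_tau_generators[OF A(2,3)])
  have E: "?E = (\<lambda>(a, b). \<beta> a b) ` (A \<times> A)"
    by auto
  have E_carrier: "?E \<subseteq> carrier (M Mod K)"
    using subsetD[OF A(2)] by auto
  have "comm_group (M Mod K)"
  proof (rule Q.comm_group_if_commuting_generators[OF E_carrier gen])
    fix x y assume "x \<in> ?E" "y \<in> ?E"
    then obtain a b c d where "x = \<beta> a b" "y = \<beta> c d" "a \<in> A" "b \<in> A" "c \<in> A" "d \<in> A"
      by blast
    then show "x \<otimes>\<^bsub>M Mod K\<^esub> y = y \<otimes>\<^bsub>M Mod K\<^esub> x"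
      using beta_comm[of a b c d] subsetD[OF A(2)] by simp
  qed
  then interpret Q: comm_group "M Mod K" .
  have "e [^]\<^bsub>M Mod K\<^esub> m = \<one>\<^bsub>M Mod K\<^esub>" if e: "e \<in> ?E" for e
  proof -
    obtain a b where "a \<in> A" "b \<in> A" "e = \<beta> a b"
      using e by auto
    then show ?thesis
      using beta_pow[of a b m] beta_D(1)[of "a [^] m" b] m A by (auto simp del: one_FactGroup)
  qed
  then have Q: "finite (carrier (M Mod K))" "card (carrier (M Mod K)) \<le> m ^ card ?E"
    using Q.card_generate_le[of ?E m] A(1) m E_carrier unfolding gen by (auto simp: E)
  have "card ?E \<le> card A * card A"
    unfolding E using A card_image_le[of "A \<times> A"] by (simp add: card_cartesian_product)
  then have card_Q: "card (carrier (M Mod K)) \<le> m ^ (card A * card A)"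
    using Q(2) m(1) power_increasing[of "card ?E" "card A * card A" m] by linarith
  have K_image: "K = (\<lambda>(n, c). n \<cdot> \<tau> c k) ` (N \<times> D)"
    by (auto simp: K_def)
  have card_K: "card K \<le> card N * card D" and fin_K: "finite K"
    unfolding K_image using fin card_image_le[of "N \<times> D"] by (auto simp: card_cartesian_product)
  have lag: "card (carrier (M Mod K)) * card K = order M"
    using M.lagrange[OF subgroup_K] by (simp add: FactGroup_def)
  then show "card (carrier M) \<le> m ^ (card A * card A) * (card N * card D)"
    using mult_le_mono[OF card_Q card_K] by (simp add: order_def)
  have "K \<noteq> {}" "carrier (M Mod K) \<noteq> {}"
    using N_subset_K[OF N.one_closed] Q.one_closed by blast+
  then have "card (carrier (M Mod K)) > 0" "card K > 0"
    using Q(1) fin_K by (simp_all add: card_gt_0_iff)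
  then show "finite (carrier M)"
    using lag by (metis M.order_gt_0_iff_finite nat_0_less_mult_iff)
qed

end

section \<open>Subgroups of prime order and groups of prime square order\<close>

context group
begin

lemma card_subgroup_dvd:
  assumes "subgroup H G" "subgroup L G" "H \<subseteq> L"
  shows "card H dvd card L"
proof -
  interpret L: group "G\<lparr>carrier := L\<rparr>"
    using assms(2) by (rule subgroup_imp_group)
  have "subgroup H (G\<lparr>carrier := L\<rparr>)"
    using assms by (simp add: subgroup_incl)
  then obtain n where "n * card H = card L"
    using L.lagrange[of H] by (auto simp: order_def)
  then show ?thesis
    using dvd_triv_right by metis
qed

lemma prime_subgroup_subset:
  assumes H: "subgroup H G" "Factorial_Ring.prime (card H)" and L: "subgroup L G"
    and y: "y \<in> H" "y \<in> L" "y \<noteq> \<one>"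
  shows "H \<subseteq> L"
proof -
  have sub: "subgroup (H \<inter> L) G"
    using H(1) L by (rule subgroups_Inter_pair)
  have fin: "finite H"
    using H(2) card_ge_0_finite prime_gt_0_nat by blast
  have "card (H \<inter> L) \<noteq> 1"
  proof
    assume "card (H \<inter> L) = 1"
    then obtain x where "H \<inter> L = {x}"
      by (rule card_1_singletonE)
    then have "y = x" "\<one> = x"
      using y subgroup.one_closed[OF sub] by blast+
    then show False
      using y by simp
  qed
  moreover have "card (H \<inter> L) dvd card H"
    using card_subgroup_dvd[OF sub H(1)] by simp
  ultimately have "card (H \<inter> L) = card H"
    using H(2) by (metis prime_nat_iff)
  then have "H \<inter> L = H"
    using fin by (intro card_subset_eq) auto
  then show ?thesis by blast
qed

definition normalizer :: "'a set \<Rightarrow> 'a set" where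
  "normalizer H = {g \<in> carrier G. \<forall>h\<in>H. conj_by G g h \<in> H}"

lemma subgroup_conj_vimage:
  assumes "subgroup H G" "x \<in> carrier G"
  shows "subgroup {h \<in> carrier G. conj_by G x h \<in> H} G"
  using assms
  by (intro subgroupI) (auto simp: conj_by_mult subgroup.one_closed subgroup.m_closed subgroup.m_inv_closed
      simp flip: conj_by_inv intro: exI[of _ \<one>])

lemma in_normalizer_if_conj_mem:
  assumes "subgroup H G" "Factorial_Ring.prime (card H)" "x \<in> carrier G"
    and "y \<in> H" "y \<noteq> \<one>" "conj_by G x y \<in> H"
  shows "x \<in> normalizer H"
proof -
  have "H \<subseteq> {h \<in> carrier G. conj_by G x h \<in> H}"
    using assms subgroup.mem_carrier[OF assms(1)]
    by (intro prime_subgroup_subset[OF assms(1,2) subgroup_conj_vimage[OF assms(1,3)] assms(4)]) auto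
  then show ?thesis
    using assms by (auto simp: normalizer_def)
qed

lemma subgroup_subset_normalizer:
  assumes "subgroup H G"
  shows "H \<subseteq> normalizer H"
  using assms unfolding normalizer_def conj_by_def
  by (auto simp: subgroup.m_closed subgroup.m_inv_closed subgroup.mem_carrier)

lemma subgroup_normalizer:
  assumes H: "subgroup H G" "finite H"
  shows "subgroup (normalizer H) G"
proof (rule subgroupI)
  have Hc: "h \<in> carrier G" if "h \<in> H" for h
    using that H(1) by (rule subgroup.mem_carrier[rotated])
  show "normalizer H \<subseteq> carrier G"
    by (auto simp: normalizer_def)
  show "normalizer H \<noteq> {}"
    using subgroup_subset_normalizer[OF H(1)] subgroup.one_closed[OF H(1)] by auto
  show "a \<otimes> b \<in> normalizer H" if "a \<in> normalizer H" "b \<in> normalizer H" for a b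
    using that by (auto simp: normalizer_def Hc simp flip: conj_by_conj_by)
  show "inv a \<in> normalizer H" if "a \<in> normalizer H" for a
  proof -
    have a [simp]: "a \<in> carrier G" and sub: "conj_by G a ` H \<subseteq> H"
      using that by (auto simp: normalizer_def)
    have "inj_on (conj_by G a) H"
      by (rule inj_onI) (auto simp: conj_by_def Hc)
    then have im: "conj_by G a ` H = H"
      using sub H(2) by (simp add: endo_inj_surj)
    have "conj_by G (inv a) h \<in> H" if h: "h \<in> H" for h
    proof -
      obtain h' where "h' \<in> H" "h = conj_by G a h'"
        using im h by blast
      then show ?thesis
        by (simp add: conj_by_conj_by Hc)
    qed
    then show ?thesis
      by (simp add: normalizer_def)
  qed
qed

lemma normalizer_eq_carrier_iff:
  assumes "subgroup H G"
  shows "normalizer H = carrier G \<longleftrightarrow> H \<lhd> G"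
  unfolding normal_inv_iff using assms by (auto simp: normalizer_def conj_by_def)

text \<open>
  The complement of the normalizer is a union of double cosets \<open>H x H\<close>. If two products \<open>a x b\<close>
  coincide, then \<open>x\<close> conjugates a non-trivial element of \<open>H\<close> into \<open>H\<close>, and as \<open>H\<close> has prime order \<open>x\<close>
  normalizes it; so each of these double cosets has \<open>q\<^sup>2\<close> elements.
\<close>
lemma prime_square_dvd_card_outside_normalizer:
  assumes fin: "finite (carrier G)" and H: "subgroup H G" "card H = q" and q: "Factorial_Ring.prime q"
  shows "q\<^sup>2 dvd card (carrier G - normalizer H)"
proof -
  let ?X = "carrier G - normalizer H"
  have Hc [simp]: "h \<in> carrier G" if "h \<in> H" for h
    using that H(1) by (rule subgroup.mem_carrier[rotated])
  note Hcl [simp] = subgroup.m_closed[OF H(1)] subgroup.m_inv_closed[OF H(1)] subgroup.one_closed[OF H(1)]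
  have fH: "finite H"
    using H q by (metis card_ge_0_finite prime_gt_0_nat)
  interpret S: subgroup "normalizer H" G
    using H(1) fH by (rule subgroup_normalizer)
  have HS: "h \<in> normalizer H" if "h \<in> H" for h
    using that subgroup_subset_normalizer[OF H(1)] by blast
  have X_closed: "a \<otimes> x \<otimes> b \<in> ?X" if "x \<in> ?X" "a \<in> H" "b \<in> H" for a x b
  proof -
    have "x \<in> normalizer H" if "a \<otimes> x \<otimes> b \<in> normalizer H"
    proof -
      have "inv a \<otimes> (a \<otimes> x \<otimes> b) \<otimes> inv b \<in> normalizer H"
        using \<open>a \<in> H\<close> \<open>b \<in> H\<close> HS by (intro S.m_closed[OF S.m_closed[OF _ that]] S.m_inv_closed) auto
      moreover have "inv a \<otimes> (a \<otimes> x \<otimes> b) \<otimes> inv b = x"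
        using \<open>x \<in> ?X\<close> \<open>a \<in> H\<close> \<open>b \<in> H\<close> by (simp add: m_assoc)
      ultimately show ?thesis
        by metis
    qed
    then show ?thesis
      using that by auto
  qed
  define r where "r = {(x, y). x \<in> ?X \<and> (\<exists>a\<in>H. \<exists>b\<in>H. y = a \<otimes> x \<otimes> b)}"
  have r_class: "r `` {x} = (\<lambda>(a, b). a \<otimes> x \<otimes> b) ` (H \<times> H)" if "x \<in> ?X" for x
    using that by (auto simp: r_def)
  have r_equiv: "equiv ?X r"
  proof (rule equivI)
    show "refl_on ?X r"
    proof (rule refl_onI)
      show "(x, x) \<in> r" if "x \<in> ?X" for x
        unfolding r_def using that by (auto intro!: bexI[of _ \<one>])
    qed
    show "r \<subseteq> ?X \<times> ?X"
      using X_closed by (auto simp: r_def)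
    show "sym r"
    proof (rule symI)
      fix x y assume "(x, y) \<in> r"
      then obtain a b where ab: "x \<in> ?X" "a \<in> H" "b \<in> H" "y = a \<otimes> x \<otimes> b"
        by (auto simp: r_def)
      then have "x = inv a \<otimes> y \<otimes> inv b"
        by (simp add: m_assoc)
      then show "(y, x) \<in> r"
        unfolding r_def using ab X_closed[of x a b]
        by simp (rule bexI[of _ "inv a"], rule bexI[of _ "inv b"], auto)
    qed
    show "trans r"
    proof (rule transI)
      fix x y z assume "(x, y) \<in> r" "(y, z) \<in> r"
      then obtain a b c d where ab: "x \<in> ?X" "a \<in> H" "b \<in> H" "c \<in> H" "d \<in> H" "z = c \<otimes> (a \<otimes> x \<otimes> b) \<otimes> d"
        by (auto simp: r_def)
      then have "z = (c \<otimes> a) \<otimes> x \<otimes> (b \<otimes> d)"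
        by (simp add: m_assoc)
      then show "(x, z) \<in> r"
        unfolding r_def using ab
        by simp (rule bexI[of _ "c \<otimes> a"], rule bexI[of _ "b \<otimes> d"], auto)
    qed
  qed
  have class_card: "q\<^sup>2 dvd card C" if C: "C \<in> ?X // r" for C
  proof -
    obtain x where x: "x \<in> ?X" and C: "C = (\<lambda>(a, b). a \<otimes> x \<otimes> b) ` (H \<times> H)"
      using C r_class by (auto elim!: quotientE)
    have xc [simp]: "x \<in> carrier G"
      using x by simp
    have "inj_on (\<lambda>(a, b). a \<otimes> x \<otimes> b) (H \<times> H)"
    proof (rule inj_onI, clarify)
      fix a b a' b' assume ab: "a \<in> H" "b \<in> H" "a' \<in> H" "b' \<in> H" and e: "a \<otimes> x \<otimes> b = a' \<otimes> x \<otimes> b'"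
      have "conj_by G x (b \<otimes> inv b') = inv a \<otimes> (a \<otimes> x \<otimes> b) \<otimes> inv b' \<otimes> inv x"
        using ab by (simp add: conj_by_def m_assoc)
      also have "\<dots> = inv a \<otimes> a'"
        unfolding e using ab by (simp add: m_assoc)
      finally have "conj_by G x (b \<otimes> inv b') \<in> H"
        using ab by simp
      then have "b \<otimes> inv b' = \<one>"
        using in_normalizer_if_conj_mem[of H x "b \<otimes> inv b'"] H q x ab by auto
      then have b: "b = b'"
        using ab inv_equality[of b "inv b'"] by simp
      then have "a \<otimes> (x \<otimes> b) = a' \<otimes> (x \<otimes> b)"
        using e ab by (simp add: m_assoc)
      then show "a = a' \<and> b = b'"
        using ab b by simp
    qed
    then show ?thesis
      unfolding C by (simp add: card_image card_cartesian_product H(2) power2_eq_square)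
  qed
  show ?thesis
    by (rule equiv_imp_dvd_card[OF _ r_equiv class_card]) (use fin in simp_all)
qed

text \<open>
  The number of elements outside the normalizer is a multiple of \<open>p\<^sup>2\<close> and less than \<open>p\<^sup>2\<close>, since the
  identity does not count.
\<close>
lemma order_prime_square_normal:
  assumes "Factorial_Ring.prime p" "order G = p\<^sup>2" "subgroup H G" "card H = p"
  shows "H \<lhd> G"
proof -
  have p: "p > 0"
    using assms(1) prime_gt_0_nat by blast
  then have fin: "finite (carrier G)"
    using assms(2) order_gt_0_iff_finite by simp
  have "\<one> \<in> normalizer H"
    by (auto simp: normalizer_def subgroup.mem_carrier[OF assms(3)])
  then have "card (carrier G - normalizer H) < card (carrier G)"
    using fin by (intro psubset_card_mono) auto
  moreover have "p\<^sup>2 dvd card (carrier G - normalizer H)"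
    using prime_square_dvd_card_outside_normalizer[OF fin assms(3,4,1)] .
  ultimately have "card (carrier G - normalizer H) = 0"
    using assms(2) by (metis dvd_imp_le gr_zeroI linorder_not_le order_def)
  then have "normalizer H = carrier G"
    using fin by (auto simp: normalizer_def)
  then show ?thesis
    using normalizer_eq_carrier_iff[OF assms(3)] by simp
qed

lemma ord_prime_square_cases:
  assumes "Factorial_Ring.prime p" "order G = p\<^sup>2" "x \<in> carrier G" "x \<noteq> \<one>"
  shows "ord x = p \<or> ord x = p\<^sup>2"
proof -
  have "ord x dvd p\<^sup>2"
    using ord_dvd_group_order[OF assms(3)] assms(2) by simp
  then obtain i where "i \<le> 2" "ord x = p ^ i"
    using divides_primepow_nat[OF assms(1)] by auto
  moreover have "i \<noteq> 0"
    using calculation assms ord_eq_1 by (metis power_0)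
  ultimately have "i = 1 \<or> i = 2"
    by linarith
  then show ?thesis
    using \<open>ord x = p ^ i\<close> by auto
qed

lemma generate_eq_carrier_if_ord:
  assumes "finite (carrier G)" "x \<in> carrier G" "ord x = order G"
  shows "generate G {x} = carrier G"
  using assms generate_incl[of "{x}"] generate_pow_card[of x] by (intro card_subset_eq) (auto simp: order_def)

text \<open>
  If no element has order \<open>p\<^sup>2\<close>, all non-trivial cyclic subgroups are normal of order \<open>p\<close>. The commutator
  of \<open>x\<close> and \<open>y\<close> lies in those generated by \<open>x\<close> and by \<open>y\<close>, which coincide or meet trivially.
\<close>
lemma comm_group_if_order_prime_square:
  assumes p: "Factorial_Ring.prime p" and o: "order G = p\<^sup>2"
  shows "comm_group G"
proof (cases "\<exists>x\<in>carrier G. ord x = p\<^sup>2")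
  have "p > 0"
    using p prime_gt_0_nat by blast
  then have fin: "finite (carrier G)"
    using o order_gt_0_iff_finite by simp
  {
    case True
    then obtain x where "x \<in> carrier G" "generate G {x} = carrier G"
      using generate_eq_carrier_if_ord fin o by auto
    then show ?thesis
      by (intro comm_group_if_commuting_generators[of "{x}"]) auto
  next
    case False
    have "x \<otimes> y = y \<otimes> x" if [simp]: "x \<in> carrier G" "y \<in> carrier G" for x y
    proof (rule ccontr)
      assume ne: "x \<otimes> y \<noteq> y \<otimes> x"
      have "x \<noteq> \<one>" "y \<noteq> \<one>"
        using ne by auto
      then have ords: "ord x = p" "ord y = p"
        using ord_prime_square_cases[OF p o] False by auto
      let ?P = "generate G {x}" and ?Q = "generate G {y}"
      have sub: "subgroup ?P G" "subgroup ?Q G"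
        by (auto intro: generate_is_subgroup)
      have card: "card ?P = p" "card ?Q = p"
        using ords generate_pow_card by auto
      interpret P: normal ?P G
        by (rule order_prime_square_normal[OF p o sub(1) card(1)])
      interpret Q: normal ?Q G
        by (rule order_prime_square_normal[OF p o sub(2) card(2)])
      have xy: "x \<in> ?P" "y \<in> ?Q"
        by (auto intro: generate.incl)
      have "commutator G x y = x \<otimes> (y \<otimes> inv x \<otimes> inv y)"
        by (simp add: commutator_def m_assoc)
      then have "commutator G x y \<in> ?P"
        using xy by (simp add: P.inv_op_closed2)
      moreover have "commutator G x y \<in> ?Q"
        unfolding commutator_def using xy by (simp add: Q.inv_op_closed2)
      moreover have "commutator G x y \<noteq> \<one>"
        using ne by (simp add: commutator_eq_one_iff)
      ultimately have "?Q \<subseteq> ?P"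
        using prime_subgroup_subset[OF sub(2) _ sub(1)] card p by auto
      then have y: "y \<in> ?P"
        using xy by auto
      have "?P \<subseteq> {z \<in> carrier G. x \<otimes> z = z \<otimes> x}"
        by (intro generate_subgroup_incl subgroup_centralizer) auto
      then show False
        using y ne by auto
    qed
    then show ?thesis
      by (intro group_comm_groupI) auto
  }
qed

lemma iso_if_inj_hom:
  assumes "group H" "h \<in> hom H G" "inj_on h (carrier H)" "finite (carrier G)"
    "card (carrier H) = card (carrier G)"
  shows "G \<cong> H"
proof -
  have "h ` carrier H = carrier G"
    using assms by (intro card_subset_eq) (auto simp: card_image hom_def)
  then have "H \<cong> G"
    using assms by (auto simp: is_iso_def iso_def bij_betw_def)
  then show ?thesis
    using assms(1) group.iso_sym by blast
qed

lemma cyclic_iso_integer_mod_group: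
  assumes "finite (carrier G)" "x \<in> carrier G" "ord x = order G"
  shows "G \<cong> integer_mod_group (order G)"
proof (rule iso_if_inj_hom[of _ "\<lambda>i. x [^] i"])
  have n: "order G > 0"
    using assms(1) order_gt_0_iff_finite by simp
  show "(\<lambda>i. x [^] i) \<in> hom (integer_mod_group (order G)) G"
  proof (rule homI)
    fix i j
    have "x [^] ((i + j) mod int (order G)) = x [^] (i + j)"
      using assms by (simp add: int_pow_eq mod_eq_dvd_iff[symmetric] del: int_pow_mult)
    then show "x [^] (i \<otimes>\<^bsub>integer_mod_group (order G)\<^esub> j) = x [^] i \<otimes> x [^] j"
      using assms by (simp add: int_pow_mult)
  qed (use assms in auto)
  show "inj_on (\<lambda>i. x [^] i) (carrier (integer_mod_group (order G)))"
  proof (rule inj_onI)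
    fix i j assume ij: "i \<in> carrier (integer_mod_group (order G))" "j \<in> carrier (integer_mod_group (order G))"
      and "x [^] i = x [^] j"
    then have "i mod int (order G) = j mod int (order G)"
      using assms by (simp add: int_pow_eq mod_eq_dvd_iff dvd_diff_commute)
    then show "i = j"
      using ij n by (simp add: carrier_integer_mod_group)
  qed
  show "card (carrier (integer_mod_group (order G))) = card (carrier G)"
    using n by (simp add: carrier_integer_mod_group order_def)
qed (use assms in simp_all)

lemma iso_if_order_prime_square:
  assumes p: "Factorial_Ring.prime p" and o: "order G = p\<^sup>2"
  shows "G \<cong> integer_mod_group (p\<^sup>2) \<or> G \<cong> integer_mod_group p \<times>\<times> integer_mod_group p"
proof (cases "\<exists>x\<in>carrier G. ord x = p\<^sup>2")
  have p0: "p > 0"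
    using p prime_gt_0_nat by blast
  then have fin: "finite (carrier G)"
    using o order_gt_0_iff_finite by simp
  interpret comm_group G
    using p o by (rule comm_group_if_order_prime_square)
  {
    case True
    then show ?thesis
      using cyclic_iso_integer_mod_group fin o by metis
  next
    case False
    have ord: "ord x = p" if "x \<in> carrier G" "x \<noteq> \<one>" for x
      using that ord_prime_square_cases[OF p o] False by auto
    have "card (carrier G) > 1"
      using o one_less_power[OF prime_gt_1_nat[OF p], of 2] by (simp add: order_def)
    then obtain a where a [simp]: "a \<in> carrier G" "a \<noteq> \<one>"
      by (metis card.empty card_1_singleton_iff is_singletonI' is_singleton_altdef less_irrefl not_one_less_zero one_closed empty_iff)
    let ?P = "generate G {a}"
    have subP: "subgroup ?P G" and cardP: "card ?P = p"
      using ord[of a] generate_pow_card[of a] by (auto intro: generate_is_subgroup)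
    have "card ?P < card (carrier G)"
      using o cardP prime_gt_1_nat[OF p] by (simp add: order_def power2_eq_square)
    then have "?P \<noteq> carrier G"
      by auto
    moreover have "?P \<subseteq> carrier G"
      by (rule generate_incl) simp
    ultimately obtain b where b [simp]: "b \<in> carrier G" "b \<notin> ?P"
      by blast
    have b1: "b \<noteq> \<one>"
      using b generate.one by metis
    let ?Q = "generate G {b}"
    have subQ: "subgroup ?Q G" and cardQ: "card ?Q = p"
      using ord[of b] b1 generate_pow_card[of b] by (auto intro: generate_is_subgroup)
    let ?Z = "integer_mod_group p"
    have pow_mod: "x [^] ((i + j) mod int p) = x [^] i \<otimes> x [^] j" if "x \<in> carrier G" "x \<noteq> \<one>" for x and i j :: int
    proof -
      have "x [^] ((i + j) mod int p) = x [^] (i + j)"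
        using that ord[of x] by (simp add: int_pow_eq mod_eq_dvd_iff[symmetric] del: int_pow_mult)
      then show ?thesis
        using that by (simp add: int_pow_mult)
    qed
    have inj1: "i = 0" if "x \<in> carrier G" "x \<noteq> \<one>" "i \<in> carrier ?Z" "x [^] i = \<one>" for x i
      using that ord[of x] p0 by (auto simp: int_pow_eq_id carrier_integer_mod_group dest: zdvd_imp_le)
    have "G \<cong> ?Z \<times>\<times> ?Z"
    proof (rule iso_if_inj_hom)
      show g: "group (?Z \<times>\<times> ?Z)"
        by (simp add: DirProd_group)
      let ?h = "\<lambda>(i, j). a [^] i \<otimes> b [^] j"
      show h: "?h \<in> hom (?Z \<times>\<times> ?Z) G"
        by (rule homI) (auto simp: DirProd_def pow_mod b1 m_ac)
      interpret h: group_hom "?Z \<times>\<times> ?Z" G ?h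
        using g h by (simp add: group_hom_def group_hom_axioms_def)
      show "inj_on ?h (carrier (?Z \<times>\<times> ?Z))"
        unfolding h.inj_on_one_iff
      proof clarify
        fix i j assume ij: "(i, j) \<in> carrier (?Z \<times>\<times> ?Z)" and e: "a [^] i \<otimes> b [^] j = \<one>"
        have "b [^] j = inv (a [^] i)"
          using e by (metis a(1) b(1) int_pow_closed inv_equality m_comm)
        then have "b [^] j \<in> ?P"
          using generate_m_inv_closed[of "{a}" "a [^] i"] by (auto simp: generate_pow)
        moreover have "b [^] j \<in> ?Q"
          by (auto simp: generate_pow)
        moreover have "\<not> ?Q \<subseteq> ?P"
          using b generate.incl[of b "{b}" G] by blast
        ultimately have bj: "b [^] j = \<one>"
          using prime_subgroup_subset[OF subQ _ subP] cardQ p by auto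
        then have "a [^] i = \<one>"
          using e by simp
        then show "(i, j) = \<one>\<^bsub>?Z \<times>\<times> ?Z\<^esub>"
          using bj ij inj1[of a i] inj1[of b j] b1 by (simp add: DirProd_def)
      qed
      show "card (carrier (?Z \<times>\<times> ?Z)) = card (carrier G)"
        using o p0 by (simp add: DirProd_def carrier_integer_mod_group card_cartesian_product order_def power2_eq_square)
    qed (rule fin)
    then show ?thesis ..
  }
qed

end

section \<open>The derived subgroup of a group of order \<open>p\<^sup>2 q\<close>\<close>

context group
begin

text \<open>
  Let the normalizer have order \<open>q n\<close>, where \<open>n\<close> divides \<open>p\<^sup>2\<close>. The double coset count gives that \<open>q\<close>
  divides \<open>p\<^sup>2 - n\<close>. This excludes \<open>n = p\<close>, and for \<open>n = 1\<close> it leaves only \<open>q = p + 1\<close>.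
\<close>
lemma normal_or_self_normalizing:
  assumes p: "Factorial_Ring.prime p" and q: "Factorial_Ring.prime q" and "p < q"
    and o: "order G = p\<^sup>2 * q" and H: "subgroup H G" "card H = q"
  shows "H \<lhd> G \<or> p = 2 \<and> q = 3 \<and> normalizer H = H"
proof -
  have pos: "p > 0" "q > 0"
    using p q prime_gt_0_nat by blast+
  then have fin: "finite (carrier G)"
    using o order_gt_0_iff_finite by simp
  have fH: "finite H"
    using fin H(1) subgroup.subset finite_subset by blast
  let ?S = "normalizer H"
  have S: "subgroup ?S G" "?S \<subseteq> carrier G"
    using subgroup_normalizer[OF H(1) fH] subgroup.subset by blast+
  obtain n where n: "card ?S = q * n"
    using card_subgroup_dvd[OF H(1) S(1) subgroup_subset_normalizer[OF H(1)]] H(2) by auto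
  have "q * n dvd p\<^sup>2 * q"
    using lagrange[OF S(1)] n o by (metis dvd_triv_right)
  then have "n dvd p\<^sup>2"
    using pos by (simp add: mult.commute)
  then obtain i where "i \<le> 2" and ni: "n = p ^ i"
    using divides_primepow_nat[OF p] by auto
  then have i: "i = 0 \<or> i = 1 \<or> i = 2"
    by linarith
  have "card (carrier G - ?S) = p\<^sup>2 * q - q * n"
    using S(2) fin o n by (simp add: card_Diff_subset finite_subset order_def)
  also have "\<dots> = q * (p\<^sup>2 - n)"
    by (simp add: diff_mult_distrib2 mult.commute)
  finally have "q * q dvd q * (p\<^sup>2 - n)"
    using prime_square_dvd_card_outside_normalizer[OF fin H q] by (simp add: power2_eq_square)
  then have dvd: "q dvd p\<^sup>2 - n"
    using pos by simp
  consider "i = 0" | "i = 1" | "i = 2"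
    using i by blast
  then show ?thesis
  proof cases
    case 1
    have "p\<^sup>2 - 1 = (p - 1) * (p + 1)"
      by (simp add: power2_eq_square algebra_simps)
    then have "q dvd (p - 1) * (p + 1)"
      using dvd 1 ni by simp
    then have "q dvd p - 1 \<or> q dvd p + 1"
      using q prime_dvd_multD by blast
    moreover have "\<not> q dvd p - 1"
      using \<open>p < q\<close> prime_gt_1_nat[OF p] by (auto dest: dvd_imp_le)
    ultimately have "q \<le> p + 1"
      by (auto dest: dvd_imp_le)
    then have q_eq: "q = p + 1"
      using \<open>p < q\<close> by simp
    have "p = 2"
    proof (rule ccontr)
      assume "p \<noteq> 2"
      then have "odd p" "q \<noteq> 2"
        using p q_eq prime_odd_nat[of p] prime_gt_1_nat[OF p] by auto
      moreover have "odd q"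
        using q \<open>q \<noteq> 2\<close> prime_odd_nat[of q] prime_gt_1_nat[OF q] by auto
      ultimately show False
        using q_eq by simp
    qed
    moreover have "?S = H"
      using fin S n ni 1 H subgroup_subset_normalizer[OF H(1)]
      by (intro card_subset_eq[symmetric]) (auto intro: finite_subset)
    ultimately show ?thesis
      using q_eq by simp
  next
    case 2
    have "p\<^sup>2 - n = p * (p - 1)"
      using ni 2 by (simp add: power2_eq_square algebra_simps)
    then have "q dvd p \<or> q dvd p - 1"
      using dvd q prime_dvd_multD by metis
    then show ?thesis
      using \<open>p < q\<close> prime_gt_1_nat[OF p] by (auto dest: dvd_imp_le)
  next
    case 3
    then have "card ?S = card (carrier G)"
      using n ni o by (simp add: order_def mult.commute)
    then have "?S = carrier G"
      using fin S(2) by (simp add: card_subset_eq)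
    then show ?thesis
      using normalizer_eq_carrier_iff[OF H(1)] by simp
  qed
qed

lemma prime_order_generator:
  assumes "Factorial_Ring.prime (order G)"
  obtains x where "x \<in> carrier G" "x \<noteq> \<one>" "generate G {x} = carrier G" "ord x = order G"
proof -
  have "carrier G \<noteq> {\<one>}"
    using assms prime_gt_1_nat[of "order G"] by (auto simp: order_def)
  then obtain x where x: "x \<in> carrier G" "x \<noteq> \<one>"
    using one_closed by auto
  have "x \<in> generate G {x}"
    by (simp add: generate.incl)
  then have "carrier G \<subseteq> generate G {x}"
    using prime_subgroup_subset[OF subgroup_self _ generate_is_subgroup[of "{x}"], of x] x assms
    by (simp add: order_def)
  then have "generate G {x} = carrier G"
    using generate_incl[of "{x}"] x by auto
  then show ?thesis
    using that x generate_pow_card[of x] by (simp add: order_def)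
qed

lemma inj_on_commutator:
  assumes V: "subgroup V G" and [simp]: "k \<in> carrier G"
    and fpf: "\<And>e. e \<in> V \<Longrightarrow> e \<otimes> k = k \<otimes> e \<Longrightarrow> e = \<one>"
  shows "inj_on (\<lambda>c. commutator G c k) V"
proof (rule inj_onI)
  fix c d assume cd: "c \<in> V" "d \<in> V" and e: "commutator G c k = commutator G d k"
  have [simp]: "c \<in> carrier G" "d \<in> carrier G"
    using cd subgroup.mem_carrier[OF V] by auto
  have "conj_by G c k = conj_by G d k"
    using e by (simp add: commutator_def conj_by_def)
  then have "inv d \<otimes> (conj_by G c k) \<otimes> c = inv d \<otimes> (conj_by G d k) \<otimes> c"
    by simp
  then have "(inv d \<otimes> c) \<otimes> k = k \<otimes> (inv d \<otimes> c)"
    by (simp add: conj_by_def m_assoc)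
  then have "inv d \<otimes> c = \<one>"
    using cd V by (intro fpf) (auto simp: subgroup.m_closed subgroup.m_inv_closed)
  then have "d \<otimes> (inv d \<otimes> c) = d"
    by simp
  then show "c = d"
    by (simp del: r_cancel_one l_cancel_one)
qed

text \<open>
  If \<open>k\<close> centralizes no non-trivial element of the derived subgroup, then \<open>c \<mapsto> [c, k]\<close> is an injective
  map of this finite set to itself.
\<close>
lemma derived_eq_commutators:
  assumes fin: "finite (derived G (carrier G))" and k: "k \<in> carrier G"
    and fpf: "\<And>e. e \<in> derived G (carrier G) \<Longrightarrow> e \<otimes> k = k \<otimes> e \<Longrightarrow> e = \<one>"
    and c: "c \<in> derived G (carrier G)"
  shows "\<exists>c1\<in>derived G (carrier G). c = commutator G c1 k"
proof -
  let ?D = "derived G (carrier G)"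
  have sub: "subgroup ?D G"
    by (simp add: derived_is_subgroup)
  have "(\<lambda>c. commutator G c k) ` ?D \<subseteq> ?D"
    using k subgroup.mem_carrier[OF sub] by (auto intro: commutator_in_derived)
  then have "(\<lambda>c. commutator G c k) ` ?D = ?D"
    using fin inj_on_commutator[OF sub k fpf] by (simp add: endo_inj_surj)
  then show ?thesis
    using c by blast
qed

lemma comm_group_iff_derived: "comm_group G \<longleftrightarrow> derived G (carrier G) = {\<one>}"
proof
  assume "comm_group G"
  then show "derived G (carrier G) = {\<one>}"
    by (simp add: comm_group.derived_eq_singleton)
next
  assume D: "derived G (carrier G) = {\<one>}"
  show "comm_group G"
  proof (rule group_comm_groupI)
    fix x y assume "x \<in> carrier G" "y \<in> carrier G"
    then show "x \<otimes> y = y \<otimes> x"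
      using commutator_in_derived[of x y] D by (simp add: commutator_eq_one_iff)
  qed
qed

lemma commutator_pow_left:
  assumes central: "\<And>c g. c \<in> derived G (carrier G) \<Longrightarrow> g \<in> carrier G \<Longrightarrow> c \<otimes> g = g \<otimes> c"
    and [simp]: "g \<in> carrier G" "h \<in> carrier G"
  shows "commutator G (g [^] (n :: nat)) h = commutator G g h [^] n"
proof (induction n)
  case (Suc n)
  let ?c = "commutator G g h"
  have "commutator G (g [^] n \<otimes> g) h = g [^] n \<otimes> ?c \<otimes> (h \<otimes> inv (g [^] n) \<otimes> inv h)"
    by (simp add: commutator_def m_assoc inv_mult_group)
  also have "g [^] n \<otimes> ?c = ?c \<otimes> g [^] n"
    by (rule central[symmetric]) (auto intro: commutator_in_derived)
  also have "?c \<otimes> g [^] n \<otimes> (h \<otimes> inv (g [^] n) \<otimes> inv h) = ?c \<otimes> commutator G (g [^] n) h"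
    by (simp add: commutator_def m_assoc)
  finally show ?case
    using Suc nat_pow_Suc2[of ?c n] by simp
qed (simp add: commutator_def)

lemma pow_index_mem:
  assumes "N \<lhd> G" "g \<in> carrier G"
  shows "g [^] card (rcosets N) \<in> N"
proof -
  interpret N: normal N G by fact
  interpret Q: group "G Mod N" by (rule N.factorgroup_is_group)
  have o: "order (G Mod N) = card (rcosets N)"
    by (simp add: order_def FactGroup_def)
  have "N #> g \<in> carrier (G Mod N)"
    using assms by (simp add: carrier_FactGroup)
  then have "(N #> g) [^]\<^bsub>G Mod N\<^esub> card (rcosets N) = \<one>\<^bsub>G Mod N\<^esub>"
    unfolding o[symmetric] by (rule Q.pow_order_eq_1)
  then have "N #> (g [^] card (rcosets N)) = N"
    using assms by (simp add: N.FactGroup_pow)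
  then show ?thesis
    using assms by (intro coset_join1[OF _ _ N.subgroup_axioms]) auto
qed

text \<open>
  If the derived subgroup were central, then \<open>[g, h]\<^sup>n = [g\<^sup>n, h]\<close> would be trivial for \<open>n\<close> the index of the
  derived subgroup, and a power with exponent its order is trivial as well.
\<close>
lemma derived_not_central:
  assumes nc: "\<not> comm_group G" and fin: "finite (carrier G)"
    and cop: "coprime (card (derived G (carrier G))) (card (rcosets (derived G (carrier G))))"
  obtains c k where "c \<in> derived G (carrier G)" "k \<in> carrier G" "c \<otimes> k \<noteq> k \<otimes> c"
proof (rule ccontr)
  let ?D = "derived G (carrier G)"
  assume "\<not> thesis"
  then have central: "c \<otimes> g = g \<otimes> c" if "c \<in> ?D" "g \<in> carrier G" for c g
    using that by (meson \<open>\<And>c k. \<lbrakk>c \<in> ?D; k \<in> carrier G; c \<otimes> k \<noteq> k \<otimes> c\<rbrakk> \<Longrightarrow> thesis\<close>)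
  interpret D: normal ?D G
    by (rule derived_self_is_normal)
  have "commutator G g h = \<one>" if [simp]: "g \<in> carrier G" "h \<in> carrier G" for g h
  proof -
    let ?c = "commutator G g h" and ?n = "card (rcosets ?D)"
    have c: "?c \<in> ?D"
      by (simp add: commutator_in_derived)
    have "?c [^] ?n = commutator G (g [^] ?n) h"
      by (rule commutator_pow_left[symmetric]) (auto intro: central)
    also have "\<dots> = \<one>"
      using central pow_index_mem[OF D.normal_axioms] by (simp add: commutator_eq_one_iff)
    finally have "ord ?c dvd ?n"
      by (simp add: pow_eq_id)
    moreover have "ord ?c dvd card ?D"
    proof -
      have "generate G {?c} \<subseteq> ?D"
        using c by (intro generate_subgroup_incl D.subgroup_axioms) auto
      then have "card (generate G {?c}) dvd card ?D"
        by (intro card_subgroup_dvd generate_is_subgroup D.subgroup_axioms) auto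
      then show ?thesis
        by (simp add: generate_pow_card)
    qed
    ultimately have "is_unit (ord ?c)"
      using cop coprime_common_divisor by blast
    then show ?thesis
      using ord_eq_1[of ?c] by simp
  qed
  then show False
    using nc by (auto simp: commutator_eq_one_iff intro: group_comm_groupI)
qed

end

context group
begin

lemma conj_by_eq_one_iff:
  assumes "x \<in> carrier G" "y \<in> carrier G"
  shows "conj_by G x y = \<one> \<longleftrightarrow> y = \<one>"
proof
  assume "conj_by G x y = \<one>"
  then have "conj_by G (inv x) (conj_by G x y) = \<one>"
    using assms by simp
  then show "y = \<one>"
    using assms by (simp add: conj_by_conj_by)
qed (use assms in simp)

lemma card_derived_if_normal_prime:
  assumes p: "Factorial_Ring.prime p" and q: "Factorial_Ring.prime q"
    and o: "order G = p\<^sup>2 * q" and H: "H \<lhd> G" "card H = q" and nc: "\<not> comm_group G"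
  shows "card (derived G (carrier G)) = q" "card (rcosets (derived G (carrier G))) = p\<^sup>2"
proof -
  interpret H: normal H G by fact
  interpret Q: group "G Mod H" by (rule H.factorgroup_is_group)
  have pos: "p > 0" "q > 0"
    using p q prime_gt_0_nat by blast+
  have "card (rcosets H) = p\<^sup>2"
    using lagrange[OF H.subgroup_axioms] H o pos by simp
  then have "comm_group (G Mod H)"
    by (intro Q.comm_group_if_order_prime_square[OF p]) (simp add: order_def FactGroup_def)
  then have sub: "derived G (carrier G) \<subseteq> H"
    by (rule derived_minimal[OF H(1)])
  have D: "subgroup (derived G (carrier G)) G"
    by (simp add: derived_is_subgroup)
  have "card (derived G (carrier G)) dvd q"
    using card_subgroup_dvd[OF D H.subgroup_axioms sub] H(2) by simp
  moreover have "card (derived G (carrier G)) \<noteq> 1"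
  proof
    assume "card (derived G (carrier G)) = 1"
    then obtain x where "derived G (carrier G) = {x}"
      by (rule card_1_singletonE)
    then have "derived G (carrier G) = {\<one>}"
      using subgroup.one_closed[OF D] by auto
    then show False
      using nc comm_group_iff_derived by simp
  qed
  ultimately show card: "card (derived G (carrier G)) = q"
    using q by (metis prime_nat_iff)
  show "card (rcosets (derived G (carrier G))) = p\<^sup>2"
    using lagrange[OF D] card o pos by simp
qed

end

text \<open>
  In the alternating group of degree 4, the typical pair consists of a 3-cycle \<open>x\<close> and a double
  transposition \<open>u\<close>; conjugation by \<open>x\<close> permutes the three involutions of the derived subgroup cyclically.
\<close>
locale alternating_pair = group +
  fixes x u
  assumes x [simp]: "x \<in> carrier G" and u [simp]: "u \<in> carrier G"
    and cube: "x [^] (3 :: nat) = \<one>"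
    and square: "u \<otimes> u = \<one>" "conj_by G x u \<otimes> conj_by G x u = \<one>"
    and conj_by_twice: "conj_by G x (conj_by G x u) = u \<otimes> conj_by G x u"
    and commute: "conj_by G x u \<otimes> u = u \<otimes> conj_by G x u"
    and derived_eq: "derived G (carrier G) = {\<one>, u, conj_by G x u, u \<otimes> conj_by G x u}"
    and card_derived: "card (derived G (carrier G)) = 4"
    and not_derived: "x \<notin> derived G (carrier G)"
    and fixed_point_free: "\<lbrakk>e \<in> derived G (carrier G); e \<otimes> x = x \<otimes> e\<rbrakk> \<Longrightarrow> e = \<one>"

context group
begin

text \<open>
  There are eight elements of order 3, so the remaining four form the only Sylow 2-subgroup \<open>V\<close>, which
  is therefore normal. A generator \<open>x\<close> of \<open>H\<close> centralizes no non-trivial element of \<open>V\<close>. Hence the four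
  commutators of elements of \<open>V\<close> with \<open>x\<close> are distinct and \<open>V\<close> is the derived subgroup; and an
  involution \<open>u\<close> of \<open>V\<close> has three conjugates under \<open>x\<close>, so that \<open>V\<close> is not cyclic.
\<close>
lemma alternating_pair_if_self_normalizing:
  assumes o: "order G = 12" and H: "subgroup H G" "card H = 3" "normalizer H = H"
  obtains x u where "alternating_pair G x u"
proof -
  have p3: "Factorial_Ring.prime (3::nat)" and p2: "Factorial_Ring.prime (2::nat)"
    by simp_all
  have fin: "finite (carrier G)"
    using o order_gt_0_iff_finite by simp
  obtain V where V: "subgroup V G" "card V = 4"
    using sylow_thm[OF p2 is_group, of 2 3] o fin by auto
  note Vs = subgroup.m_closed[OF V(1)] subgroup.m_inv_closed[OF V(1)] subgroup.one_closed[OF V(1)]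
  note Hs = subgroup.m_closed[OF H(1)] subgroup.m_inv_closed[OF H(1)] subgroup.one_closed[OF H(1)]
  have Vc: "v \<in> carrier G" if "v \<in> V" for v
    using that subgroup.mem_carrier[OF V(1)] by simp
  have Hc: "h \<in> carrier G" if "h \<in> H" for h
    using that subgroup.mem_carrier[OF H(1)] by simp
  have fV: "finite V" and fH: "finite H"
    using V(2) H(2) by (auto intro: card_ge_0_finite)
  have no_sub: "\<not> H \<subseteq> L" if "subgroup L G" "card L = 4" for L
    using card_subgroup_dvd[OF H(1) that(1)] that(2) H(2) by auto
  have HV: "y = \<one>" if "y \<in> H" "y \<in> V" for y
    using prime_subgroup_subset[OF H(1) _ V(1), of y] that no_sub[OF V] H(2) p3 by auto
  have N: "v = \<one>" if "v \<in> V" "y \<in> H" "y \<noteq> \<one>" "conj_by G v y \<in> H" for v y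
    using in_normalizer_if_conj_mem[of H v y] that H p3 HV Vc by auto
  \<comment> \<open>the eight elements outside \<open>V\<close> are the conjugates of the generators of \<open>H\<close> by elements of \<open>V\<close>\<close>
  let ?f = "\<lambda>(v, y). conj_by G v y" and ?W = "V \<times> (H - {\<one>})"
  have inj: "inj_on ?f ?W"
  proof (rule inj_onI)
    fix s t assume "s \<in> ?W" "t \<in> ?W" "?f s = ?f t"
    then obtain v y w z where st: "s = (v, y)" "t = (w, z)" and vw: "v \<in> V" "w \<in> V"
      and yz: "y \<in> H" "y \<noteq> \<one>" "z \<in> H" "z \<noteq> \<one>" and e: "conj_by G v y = conj_by G w z"
      by auto
    have "conj_by G (inv w \<otimes> v) y = conj_by G (inv w) (conj_by G w z)"
      using vw yz by (simp add: Vc Hc e flip: conj_by_conj_by)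
    also have "\<dots> = z"
      using vw yz by (simp add: Vc Hc conj_by_conj_by)
    finally have "inv w \<otimes> v = \<one>"
      using vw yz by (intro N[of _ y]) (auto simp: Vs)
    then have "w \<otimes> (inv w \<otimes> v) = w"
      using vw by (simp add: Vc)
    then have "v = w"
      using vw by (simp add: Vc del: l_cancel_one r_cancel_one)
    then show "s = t"
      using e vw yz by (simp add: conj_by_def Vc Hc st)
  qed
  have disj: "conj_by G v y \<notin> V" if vy: "v \<in> V" "y \<in> H" "y \<noteq> \<one>" for v y
  proof
    assume a: "conj_by G v y \<in> V"
    have "inv v \<otimes> conj_by G v y \<otimes> v = y"
      using vy by (simp add: conj_by_def Vc Hc m_assoc)
    moreover have "inv v \<otimes> conj_by G v y \<otimes> v \<in> V"
      using a vy by (simp add: Vs)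
    ultimately show False
      using HV vy by auto
  qed
  have "card (?f ` ?W) = 8"
    using inj V H Hs(3) fH by (simp add: card_image card_cartesian_product)
  moreover have "?f ` ?W \<inter> V = {}"
    using disj by auto
  ultimately have "card (?f ` ?W \<union> V) = card (carrier G)"
    using fV fH V o by (subst card_Un_disjoint) (auto simp: order_def)
  moreover have "?f ` ?W \<union> V \<subseteq> carrier G"
    using Vc Hc by auto
  ultimately have G_eq: "?f ` ?W \<union> V = carrier G"
    using fin by (simp add: card_subset_eq)
  have "V \<lhd> G"
    unfolding normal_inv_iff
  proof (intro conjI ballI)
    fix g v assume g: "g \<in> carrier G" and v: "v \<in> V"
    show "g \<otimes> v \<otimes> inv g \<in> V"
    proof (rule ccontr)
      assume "g \<otimes> v \<otimes> inv g \<notin> V"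
      moreover have "g \<otimes> v \<otimes> inv g \<in> ?f ` ?W \<union> V"
        unfolding G_eq using g v by (simp add: Vc)
      ultimately obtain w y where wy: "w \<in> V" "y \<in> H" "y \<noteq> \<one>" and e: "conj_by G g v = conj_by G w y"
        by (auto simp: conj_by_def)
      let ?u = "inv w \<otimes> g"
      have u: "?u \<in> carrier G"
        using wy g by (simp add: Vc)
      have "y = conj_by G (inv w) (conj_by G w y)"
        using wy by (simp add: Vc Hc conj_by_conj_by)
      then have y: "y = conj_by G ?u v"
        using wy g v by (simp add: Vc conj_by_conj_by flip: e)
      let ?L = "{h \<in> carrier G. conj_by G (inv ?u) h \<in> V}"
      have L: "subgroup ?L G"
        using u by (intro subgroup_conj_vimage V) auto
      have "conj_by G (inv ?u) y = v"
        unfolding y using u v by (simp add: conj_by_conj_by Vc del: inv_mult_group)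
      then have "H \<subseteq> ?L"
        using wy v H p3 Hc by (intro prime_subgroup_subset[OF H(1) _ L, of y]) auto
      moreover have "card ?L = card V"
      proof (rule bij_betw_same_card[of "conj_by G (inv ?u)"], rule bij_betwI')
        fix h h' assume "h \<in> ?L" "h' \<in> ?L"
        then show "conj_by G (inv ?u) h = conj_by G (inv ?u) h' \<longleftrightarrow> h = h'"
          using u by (simp add: conj_by_def del: inv_mult_group)
      next
        fix z assume z: "z \<in> V"
        have "z = conj_by G (inv ?u) (conj_by G ?u z)"
          using u z by (simp add: conj_by_conj_by Vc del: inv_mult_group)
        then show "\<exists>h\<in>?L. z = conj_by G (inv ?u) h"
          using u z by (intro bexI[of _ "conj_by G ?u z"]) (auto simp: Vc)
      qed auto
      ultimately show False
        using no_sub[OF L] V by simp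
    qed
  qed (rule V)
  then interpret V: normal V G .
  interpret VQ: group "G Mod V" by (rule V.factorgroup_is_group)
  have "order (G Mod V) = 3"
    using lagrange[OF V(1)] V o by (simp add: order_def FactGroup_def)
  then obtain C where "C \<in> carrier (G Mod V)" "generate (G Mod V) {C} = carrier (G Mod V)"
    using VQ.prime_order_generator p3 by metis
  then have "comm_group (G Mod V)"
    by (intro VQ.comm_group_if_commuting_generators[of "{C}"]) auto
  then have DV: "derived G (carrier G) \<subseteq> V"
    by (rule derived_minimal[OF V.normal_axioms])
  obtain x where x: "x \<in> H" "x \<noteq> \<one>"
    using H(2) Hs(3) card_1_singleton_iff[of H] by (metis One_nat_def insertI1 is_singletonI' is_singleton_altdef numeral_eq_one_iff semiring_norm(86) emptyE)
  note xc [simp] = Hc[OF x(1)]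
  have fpf: "e = \<one>" if "e \<in> V" "e \<otimes> x = x \<otimes> e" for e
    using that x by (intro N[of e x]) (auto simp: Vc conj_by_eq_self_iff[THEN iffD2])
  have "(\<lambda>c. commutator G c x) ` V \<subseteq> derived G (carrier G)"
    using Vc by (auto intro: commutator_in_derived)
  then have "card V \<le> card (derived G (carrier G))"
    using inj_on_commutator[OF V(1) xc fpf] DV fV by (metis card_image card_mono finite_subset)
  then have D: "derived G (carrier G) = V"
    using DV fV by (simp add: card_seteq)
  interpret Vg: group "G\<lparr>carrier := V\<rparr>"
    using V(1) by (rule subgroup_imp_group)
  have "comm_group (G\<lparr>carrier := V\<rparr>)"
    using V by (intro Vg.comm_group_if_order_prime_square[OF p2]) (simp add: order_def)
  then have comm: "v \<otimes> w = w \<otimes> v" if "v \<in> V" "w \<in> V" for v w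
    using comm_groupE(4)[of "G\<lparr>carrier := V\<rparr>" v w] that by simp
  have pow4: "(v \<otimes> v) \<otimes> (v \<otimes> v) = \<one>" if "v \<in> V" for v
  proof -
    have "v [^]\<^bsub>G\<lparr>carrier := V\<rparr>\<^esub> (4 :: nat) = \<one>"
      using Vg.pow_order_eq_1[of v] that V by (simp add: order_def)
    then have "v [^] (4 :: nat) = \<one>"
      by (simp add: nat_pow_consistent[symmetric])
    then show ?thesis
      using that by (simp add: numeral_eq_Suc m_assoc Vc)
  qed
  obtain u where u: "u \<in> V" "u \<noteq> \<one>" "u \<otimes> u = \<one>"
  proof -
    have "V \<noteq> {\<one>}"
      using V(2) by auto
    then obtain v where v: "v \<in> V" "v \<noteq> \<one>"
      using Vs(3) by auto
    show ?thesis
      using that[of v] that[of "v \<otimes> v"] v pow4[of v] Vs(1)[of v v] by blast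
  qed
  note uc [simp] = Vc[OF u(1)]
  let ?u' = "conj_by G x u"
  have u': "?u' \<in> V"
    using V.inv_op_closed2[OF xc u(1)] by (simp add: conj_by_def)
  have u'u': "?u' \<otimes> ?u' = \<one>"
    using u by (simp flip: conj_by_mult)
  have fixed: "e = \<one>" if "e \<in> V" "conj_by G x e = e" for e
    using that fpf[of e] by (simp add: conj_by_eq_self_iff Vc)
  have ne1: "?u' \<noteq> u" "?u' \<noteq> \<one>"
    using fixed[of u] u by (auto simp: conj_by_eq_one_iff)
  have ne2: "u \<otimes> ?u' \<noteq> \<one>" "u \<otimes> ?u' \<noteq> u" "u \<otimes> ?u' \<noteq> ?u'"
  proof -
    show "u \<otimes> ?u' \<noteq> \<one>"
    proof
      assume "u \<otimes> ?u' = \<one>"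
      then have "u \<otimes> (u \<otimes> ?u') = u" by simp
      then have "?u' = u"
        using u by (simp add: m_assoc[symmetric] del: l_cancel_one r_cancel_one)
      then show False using ne1 by simp
    qed
  qed (use u ne1 in auto)
  have sub: "{\<one>, u, ?u', u \<otimes> ?u'} \<subseteq> V" and card: "card {\<one>, u, ?u', u \<otimes> ?u'} = 4"
    using u u' ne1 ne2 by (auto simp: Vs card_insert_if)
  then have V_eq: "V = {\<one>, u, ?u', u \<otimes> ?u'}"
    using fV V by (intro card_subset_eq[symmetric]) auto
  have "conj_by G x ?u' \<in> V"
    using V.inv_op_closed2[OF xc u'] by (simp add: conj_by_def)
  moreover have "conj_by G x ?u' \<noteq> \<one>"
    using ne1 by (simp add: conj_by_eq_one_iff)
  moreover have "conj_by G x ?u' \<noteq> ?u'"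
    using fixed[OF u'] ne1 by blast
  moreover have "conj_by G x ?u' \<noteq> u"
  proof
    assume "conj_by G x ?u' = u"
    then have "conj_by G x (u \<otimes> ?u') = u \<otimes> ?u'"
      using comm[OF u(1) u'] by (simp add: conj_by_mult)
    then show False
      using fixed[of "u \<otimes> ?u'"] u u' ne2 by (simp add: Vs)
  qed
  ultimately have twice: "conj_by G x ?u' = u \<otimes> ?u'"
    using V_eq by blast
  have cube: "x [^] (3 :: nat) = \<one>"
  proof -
    interpret Hg: group "G\<lparr>carrier := H\<rparr>"
      using H(1) by (rule subgroup_imp_group)
    have "x [^]\<^bsub>G\<lparr>carrier := H\<rparr>\<^esub> (3 :: nat) = \<one>"
      using Hg.pow_order_eq_1[of x] x H by (simp add: order_def)
    then show ?thesis
      by (simp add: nat_pow_consistent[symmetric])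
  qed
  have xV: "x \<notin> V"
    using x HV by blast
  have "alternating_pair_axioms G x u"
    by (rule alternating_pair_axioms.intro, unfold D, fact xc, fact uc, fact cube, fact u(3), fact u'u',
        fact twice, fact comm[OF u' u(1)], fact V_eq, fact V(2), fact xV, rule fpf)
  then have "alternating_pair G x u"
    by (intro alternating_pair.intro is_group)
  then show ?thesis
    by (rule that)
qed

lemma derived_cases:
  assumes p: "Factorial_Ring.prime p" and q: "Factorial_Ring.prime q" and "p < q"
    and o: "order G = p\<^sup>2 * q" and nc: "\<not> comm_group G"
  obtains (prime) "card (derived G (carrier G)) = q" "card (rcosets (derived G (carrier G))) = p\<^sup>2"
  | (alternating) x u where "p = 2" "q = 3" "alternating_pair G x u"
proof -
  have pos: "p > 0" "q > 0"
    using p q prime_gt_0_nat by blast+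
  then have "finite (carrier G)"
    using o order_gt_0_iff_finite by simp
  then obtain H where H: "subgroup H G" "card H = q"
    using sylow_thm[OF q is_group, of 1 "p\<^sup>2"] o by (auto simp: mult.commute)
  show ?thesis
    using normal_or_self_normalizing[OF p q \<open>p < q\<close> o H]
  proof
    assume "H \<lhd> G"
    then show ?thesis
      using card_derived_if_normal_prime[OF p q o _ H(2) nc] prime by blast
  next
    assume "p = 2 \<and> q = 3 \<and> normalizer H = H"
    then show ?thesis
      using alternating_pair_if_self_normalizing[of H] H o alternating by auto
  qed
qed

end

section \<open>The tensor square as universal crossed pairing\<close>

definition simple_tensor :: "('a, 'b) monoid_scheme \<Rightarrow> 'a \<Rightarrow> 'a \<Rightarrow> ('a \<times> 'a) word set" where
  "simple_tensor G g h = word_class (carrier G \<times> carrier G) (tensor_relations G) (gen (g, h))"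

context group
begin

lemma crossed_pairing_simple_tensor: "crossed_pairing G (tensor_square G) (simple_tensor G)"
proof -
  let ?S = "carrier G \<times> carrier G" and ?R = "tensor_relations G"
  interpret T: group "tensor_square G"
    unfolding tensor_square_def by (rule group_presented_group)
  have gen: "gen (g, h) \<in> words ?S" if "g \<in> carrier G" "h \<in> carrier G" for g h
    using that by (simp add: words_def)
  have word: "simple_tensor G a b \<otimes>\<^bsub>tensor_square G\<^esub> simple_tensor G c d = word_class ?S ?R (gen (a, b) @ gen (c, d))"
    if "a \<in> carrier G" "b \<in> carrier G" "c \<in> carrier G" "d \<in> carrier G" for a b c d
    unfolding simple_tensor_def tensor_square_def using that by (intro mult_presented_group gen)
  have two: "gen (a, b) @ gen (c, d) \<in> words ?S"
    if "a \<in> carrier G" "b \<in> carrier G" "c \<in> carrier G" "d \<in> carrier G" for a b c d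
    using that by (simp add: words_def)
  show ?thesis
  proof unfold_locales
    show "simple_tensor G g h \<in> carrier (tensor_square G)" if "g \<in> carrier G" "h \<in> carrier G" for g h
      unfolding simple_tensor_def tensor_square_def carrier_presented_group using gen[OF that] by blast
    fix g1 g h assume c: "g1 \<in> carrier G" "g \<in> carrier G" "h \<in> carrier G"
    have "(gen (g1 \<otimes> g, h), gen (conj_by G g1 g, conj_by G g1 h) @ gen (g1, h)) \<in> ?R"
      unfolding tensor_relations_def using c by blast
    then have "simple_tensor G (g1 \<otimes> g) h
        = word_class ?S ?R (gen (conj_by G g1 g, conj_by G g1 h) @ gen (g1, h))"
      unfolding simple_tensor_def using c by (intro presented_group_relation gen two) auto
    then show "simple_tensor G (g1 \<otimes> g) h
        = simple_tensor G (conj_by G g1 g) (conj_by G g1 h) \<otimes>\<^bsub>tensor_square G\<^esub> simple_tensor G g1 h"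
      using c by (subst word) auto
  next
    fix g h1 h assume c: "g \<in> carrier G" "h1 \<in> carrier G" "h \<in> carrier G"
    have "(gen (g, h1 \<otimes> h), gen (g, h1) @ gen (conj_by G h1 g, conj_by G h1 h)) \<in> ?R"
      unfolding tensor_relations_def using c by blast
    then have "simple_tensor G g (h1 \<otimes> h)
        = word_class ?S ?R (gen (g, h1) @ gen (conj_by G h1 g, conj_by G h1 h))"
      unfolding simple_tensor_def using c by (intro presented_group_relation gen two) auto
    then show "simple_tensor G g (h1 \<otimes> h)
        = simple_tensor G g h1 \<otimes>\<^bsub>tensor_square G\<^esub> simple_tensor G (conj_by G h1 g) (conj_by G h1 h)"
      using c by (subst word) auto
  qed
qed

lemma generate_simple_tensor:
  "generate (tensor_square G) {simple_tensor G g h | g h. g \<in> carrier G \<and> h \<in> carrier G}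
    = carrier (tensor_square G)"
proof -
  have "{simple_tensor G g h | g h. g \<in> carrier G \<and> h \<in> carrier G}
      = (\<lambda>x. word_class (carrier G \<times> carrier G) (tensor_relations G) (gen x)) ` (carrier G \<times> carrier G)"
    by (auto simp: simple_tensor_def)
  then show ?thesis
    unfolding tensor_square_def using generate_presented_group by metis
qed

end

lemma (in crossed_pairing) tensor_square_hom:
  obtains f where "f \<in> hom (tensor_square G) M"
    and "\<And>g h. g \<in> carrier G \<Longrightarrow> h \<in> carrier G \<Longrightarrow> f (simple_tensor G g h) = \<tau> g h"
proof -
  let ?S = "carrier G \<times> carrier G"
  have im: "case_prod \<tau> ` ?S \<subseteq> carrier M"
    by auto
  have gen: "gen (g, h) \<in> words ?S" if "g \<in> carrier G" "h \<in> carrier G" for g h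
    using that by (simp add: words_def)
  have val1: "word_value M (case_prod \<tau>) (gen (g, h)) = \<tau> g h"
    if "g \<in> carrier G" "h \<in> carrier G" for g h
    using that by (simp add: word_value_def)
  have val2: "word_value M (case_prod \<tau>) (gen (a, b) @ gen (c, d)) = \<tau> a b \<otimes>\<^bsub>M\<^esub> \<tau> c d"
    if "a \<in> carrier G" "b \<in> carrier G" "c \<in> carrier G" "d \<in> carrier G" for a b c d
    using that by (simp add: word_value_def)
  have rel: "word_value M (case_prod \<tau>) u = word_value M (case_prod \<tau>) v"
    if uv: "(u, v) \<in> tensor_relations G" for u v
  proof -
    consider g1 g h where "u = gen (g1 \<otimes> g, h)" "v = gen (conj_by G g1 g, conj_by G g1 h) @ gen (g1, h)"
        "g1 \<in> carrier G" "g \<in> carrier G" "h \<in> carrier G"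
      | g h1 h where "u = gen (g, h1 \<otimes> h)" "v = gen (g, h1) @ gen (conj_by G h1 g, conj_by G h1 h)"
        "g \<in> carrier G" "h1 \<in> carrier G" "h \<in> carrier G"
      using uv unfolding tensor_relations_def by blast
    then show ?thesis
    proof cases
      case 1
      then show ?thesis
        unfolding 1(1,2) by (subst val1, simp, simp, subst val2) (auto simp: mult_left)
    next
      case 2
      then show ?thesis
        unfolding 2(1,2) by (subst val1, simp, simp, subst val2) (auto simp: mult_right)
    qed
  qed
  obtain f where f: "f \<in> hom (presented_group ?S (tensor_relations G)) M"
    "\<And>x. x \<in> ?S \<Longrightarrow> f (word_class ?S (tensor_relations G) (gen x)) = case_prod \<tau> x"
    using M.presented_group_hom[OF im rel] by metis
  show ?thesis
    using f by (intro that[of f]) (auto simp: tensor_square_def simple_tensor_def)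
qed

lemma (in crossed_pairing) tensor_square_epi:
  assumes "generate M B = carrier M" and "B \<subseteq> generate M {\<tau> g h | g h. g \<in> carrier G \<and> h \<in> carrier G}"
  obtains f where "f \<in> hom (tensor_square G) M" "f ` carrier (tensor_square G) = carrier M"
proof -
  let ?T = "{\<tau> g h | g h. g \<in> carrier G \<and> h \<in> carrier G}"
  obtain f where f: "f \<in> hom (tensor_square G) M"
    "\<And>g h. g \<in> carrier G \<Longrightarrow> h \<in> carrier G \<Longrightarrow> f (simple_tensor G g h) = \<tau> g h"
    using tensor_square_hom by blast
  interpret S: crossed_pairing G "tensor_square G" "simple_tensor G"
    by (rule G.crossed_pairing_simple_tensor)
  interpret f: group_hom "tensor_square G" M f
    using f(1) by unfold_locales
  have sub: "{simple_tensor G g h | g h. g \<in> carrier G \<and> h \<in> carrier G} \<subseteq> carrier (tensor_square G)"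
    by auto
  have "f ` {simple_tensor G g h | g h. g \<in> carrier G \<and> h \<in> carrier G} = ?T"
    using f(2) by (auto simp: image_iff) metis+
  then have im: "f ` carrier (tensor_square G) = generate M ?T"
    using f.generate_img[OF sub] G.generate_simple_tensor by simp
  have "generate M B \<subseteq> generate M ?T"
    by (rule M.generate_subgroup_incl[OF assms(2)]) (rule M.generate_is_subgroup, auto)
  moreover have "generate M ?T \<subseteq> carrier M"
    by (rule M.generate_incl) auto
  ultimately show ?thesis
    using im assms(1) f(1) by (intro that[of f]) auto
qed

lemma (in group_hom) card_epimorphic_image_dvd:
  assumes "h ` carrier G = carrier H"
  shows "card (carrier H) dvd order G"
proof -
  have "G Mod kernel G H h \<cong> H"
    using assms by (rule FactGroup_iso)
  then have "card (rcosets kernel G H h) = card (carrier H)"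
    using iso_same_card by (fastforce simp: FactGroup_def)
  then show ?thesis
    using G.lagrange[OF subgroup_kernel] dvd_triv_left by metis
qed

text \<open>
  The image of \<open>G\<close> in the product projects onto both factors, so its order is divisible by both of their
  coprime orders. The bound on the order of \<open>G\<close> then leaves no room for a kernel.
\<close>
lemma (in group) iso_DirProd_if_coprime_epis:
  assumes fin: "finite (carrier G)" and A: "group A" "finite (carrier A)" and B: "group B" "finite (carrier B)"
    and f: "f \<in> hom G A" "f ` carrier G = carrier A"
    and g: "g \<in> hom G B" "g ` carrier G = carrier B"
    and cop: "coprime (card (carrier A)) (card (carrier B))"
    and card: "card (carrier G) \<le> card (carrier A) * card (carrier B)"
  shows "G \<cong> A \<times>\<times> B"
proof -
  interpret A: group A by fact
  interpret B: group B by fact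
  interpret AB: group "A \<times>\<times> B"
    using A B by (simp add: DirProd_group)
  let ?h = "\<lambda>x. (f x, g x)"
  have h: "?h \<in> hom G (A \<times>\<times> B)"
    using f(1) g(1) by (auto simp: hom_def DirProd_def)
  interpret h: group_hom G "A \<times>\<times> B" ?h
    using h by unfold_locales
  let ?I = "?h ` carrier G"
  have I: "subgroup ?I (A \<times>\<times> B)"
    by (rule h.img_is_subgroup)
  have finI: "finite ?I"
    using fin by simp
  interpret I: group "(A \<times>\<times> B)\<lparr>carrier := ?I\<rparr>"
    using I by (rule AB.subgroup_imp_group)
  interpret a: group_hom "(A \<times>\<times> B)\<lparr>carrier := ?I\<rparr>" A fst
    using f(1) by unfold_locales (auto simp: hom_def)
  interpret b: group_hom "(A \<times>\<times> B)\<lparr>carrier := ?I\<rparr>" B snd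
    using g(1) by unfold_locales (auto simp: hom_def)
  have "card (carrier A) dvd card ?I"
    using a.card_epimorphic_image_dvd f(2) by (simp add: image_image order_def)
  moreover have "card (carrier B) dvd card ?I"
    using b.card_epimorphic_image_dvd g(2) by (simp add: image_image order_def)
  ultimately have "card (carrier A) * card (carrier B) dvd card ?I"
    using cop by (rule divides_mult)
  moreover have "card ?I > 0"
    using finI subgroup.one_closed[OF I] by (auto simp: card_gt_0_iff)
  ultimately have ge: "card (carrier A) * card (carrier B) \<le> card ?I"
    by (rule dvd_imp_le)
  then have "card ?I = card (carrier G)"
    using card card_image_le[OF fin, of ?h] by linarith
  then have inj: "inj_on ?h (carrier G)"
    using fin by (intro eq_card_imp_inj_on)
  have "?I = carrier (A \<times>\<times> B)"
    using ge A(2) B(2) subgroup.subset[OF I] 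
    by (intro card_seteq) (auto simp: DirProd_def card_cartesian_product)
  then show ?thesis
    using h inj by (auto simp: is_iso_def iso_def bij_betw_def)
qed

section \<open>The quaternion group and its extension by rotations\<close>

lemma carrier_quaternion_group [simp]: "carrier quaternion_group = UNIV"
  by (simp add: quaternion_group_def)

lemma one_quaternion_group [simp]: "\<one>\<^bsub>quaternion_group\<^esub> = (False, Q1)"
  by (simp add: quaternion_group_def)

lemma mult_quaternion_group [simp]: "monoid.mult quaternion_group = quat_mult"
  by (simp add: quaternion_group_def)

lemma quat_mult_assoc: "quat_mult (quat_mult a b) c = quat_mult a (quat_mult b c)"
proof -
  obtain r s t u v w where "a = (r, u)" "b = (s, v)" "c = (t, w)"
    by (metis surj_pair)
  then show ?thesis
    by (cases u; cases v; cases w) auto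
qed

lemma group_quaternion_group: "group quaternion_group"
proof (rule groupI)
  fix x :: "bool \<times> quat_unit"
  obtain s u where x: "x = (s, u)"
    by (cases x)
  show "\<one>\<^bsub>quaternion_group\<^esub> \<otimes>\<^bsub>quaternion_group\<^esub> x = x"
    by (cases u) (simp_all add: x)
  have "quat_mult (if u = Q1 then s else \<not> s, u) (s, u) = (False, Q1)"
    by (cases u) simp_all
  then show "\<exists>y\<in>carrier quaternion_group. y \<otimes>\<^bsub>quaternion_group\<^esub> x = \<one>\<^bsub>quaternion_group\<^esub>"
    unfolding x by auto
qed (simp_all add: quat_mult_assoc)

lemma UNIV_quat_unit: "UNIV = {Q1, QI, QJ, QK}"
  using quat_unit.exhaust by auto

lemma finite_quaternion_group: "finite (carrier quaternion_group)"
  by (simp add: finite_prod UNIV_quat_unit)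

lemma card_quaternion_group: "card (carrier quaternion_group) = 8"
proof -
  have "card (UNIV :: quat_unit set) = 4"
    by (simp add: UNIV_quat_unit)
  moreover have "carrier quaternion_group = (UNIV :: bool set) \<times> (UNIV :: quat_unit set)"
    by simp
  ultimately show ?thesis
    by (simp only: card_cartesian_product) simp
qed

lemma generate_quaternion_group:
  "generate quaternion_group {(False, QI), (False, QJ), (False, QK)} = carrier quaternion_group" (is "?H = _")
proof -
  interpret Q: group quaternion_group by (rule group_quaternion_group)
  interpret H: subgroup ?H quaternion_group
    by (rule Q.generate_is_subgroup) simp
  have pos: "(False, w) \<in> ?H" for w
    using H.one_closed by (cases w) (auto intro: generate.incl)
  have neg1: "(True, Q1) \<in> ?H"
    using H.m_closed[OF pos[of QI] pos[of QI]] by simp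
  have "(s, w) \<in> ?H" for s w
    using H.m_closed[OF neg1 pos[of w]] pos[of w] by (cases s) simp_all
  then show ?thesis
    by auto
qed

lemma (in group_hom) commutator_hom:
  assumes "x \<in> carrier G" "y \<in> carrier G"
  shows "h (commutator G x y) = commutator H (h x) (h y)"
  using assms by (simp add: commutator_def)

text \<open>
  Multiplying \<open>x\<close> or \<open>y\<close> by a central element does not change their commutator, so commutators in a central
  extension depend only on the images of their entries.
\<close>
lemma (in group_hom) central_extension_pairing:
  assumes surj: "h ` carrier G = carrier H"
    and central: "\<And>z g. z \<in> carrier G \<Longrightarrow> h z = \<one>\<^bsub>H\<^esub> \<Longrightarrow> g \<in> carrier G \<Longrightarrow> z \<otimes> g = g \<otimes> z"
  obtains \<tau> where "crossed_pairing H G \<tau>"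
    and "\<And>x y. x \<in> carrier G \<Longrightarrow> y \<in> carrier G \<Longrightarrow> \<tau> (h x) (h y) = commutator G x y"
proof -
  have indep: "commutator G x y = commutator G x' y'"
    if c [simp]: "x \<in> carrier G" "y \<in> carrier G" "x' \<in> carrier G" "y' \<in> carrier G"
      and e: "h x = h x'" "h y = h y'" for x y x' y'
  proof -
    have left: "commutator G (z \<otimes> a) b = commutator G a b"
      if z: "z \<in> carrier G" "h z = \<one>\<^bsub>H\<^esub>" and [simp]: "a \<in> carrier G" "b \<in> carrier G" for z a b
    proof -
      have "commutator G (z \<otimes> a) b = z \<otimes> (a \<otimes> b \<otimes> inv a) \<otimes> inv z \<otimes> inv b"
        using z by (simp add: commutator_def G.m_assoc G.inv_mult_group)
      also have "z \<otimes> (a \<otimes> b \<otimes> inv a) = (a \<otimes> b \<otimes> inv a) \<otimes> z"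
        using z by (intro central) auto
      finally show ?thesis
        using z by (simp add: commutator_def G.m_assoc)
    qed
    have right: "commutator G a (z \<otimes> b) = commutator G a b"
      if z: "z \<in> carrier G" "h z = \<one>\<^bsub>H\<^esub>" and [simp]: "a \<in> carrier G" "b \<in> carrier G" for z a b
    proof -
      have "commutator G a (z \<otimes> b) = (a \<otimes> z) \<otimes> (b \<otimes> inv a \<otimes> inv b) \<otimes> inv z"
        using z by (simp add: commutator_def G.m_assoc G.inv_mult_group)
      also have "a \<otimes> z = z \<otimes> a"
        using z by (intro central[symmetric]) auto
      also have "z \<otimes> a \<otimes> (b \<otimes> inv a \<otimes> inv b) \<otimes> inv z = (z \<otimes> commutator G a b) \<otimes> inv z"
        using z by (simp add: commutator_def G.m_assoc)
      also have "z \<otimes> commutator G a b = commutator G a b \<otimes> z"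
        using z by (intro central) auto
      finally show ?thesis
        using z by (simp add: G.m_assoc)
    qed
    have quot: "a = (a \<otimes> inv a') \<otimes> a'" "h (a \<otimes> inv a') = \<one>\<^bsub>H\<^esub>"
      if "a \<in> carrier G" "a' \<in> carrier G" "h a = h a'" for a a'
      using that by (simp_all add: G.m_assoc)
    have "commutator G x y = commutator G x' y"
      using left[of "x \<otimes> inv x'" x' y] quot[of x x'] e by simp
    also have "\<dots> = commutator G x' y'"
      using right[of "y \<otimes> inv y'" x' y'] quot[of y y'] e by simp
    finally show ?thesis .
  qed
  define s where "s g = (SOME x. x \<in> carrier G \<and> h x = g)" for g
  have s: "s g \<in> carrier G \<and> h (s g) = g" if "g \<in> carrier H" for g
  proof -
    have "g \<in> h ` carrier G"
      using that surj by simp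
    then have "\<exists>x. x \<in> carrier G \<and> h x = g"
      by auto
    then show ?thesis
      unfolding s_def by (rule someI_ex)
  qed
  let ?\<tau> = "\<lambda>g k. commutator G (s g) (s k)"
  have \<tau>: "?\<tau> (h x) (h y) = commutator G x y" if "x \<in> carrier G" "y \<in> carrier G" for x y
    using that s[of "h x"] s[of "h y"] by (intro indep) auto
  have conj: "h (conj_by G x y) = conj_by H (h x) (h y)" if "x \<in> carrier G" "y \<in> carrier G" for x y
    using that by (simp add: conj_by_def)
  have pre: "\<exists>a\<in>carrier G. g = h a" if "g \<in> carrier H" for g
    using s[OF that] by (intro bexI[of _ "s g"]) simp_all
  have "crossed_pairing H G ?\<tau>"
  proof unfold_locales
    show "?\<tau> g k \<in> carrier G" if "g \<in> carrier H" "k \<in> carrier H" for g k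
      using s[OF that(1)] s[OF that(2)] by simp
  next
    fix g1 g k assume "g1 \<in> carrier H" "g \<in> carrier H" "k \<in> carrier H"
    then obtain a b c where e: "g1 = h a" "g = h b" "k = h c"
      and [simp]: "a \<in> carrier G" "b \<in> carrier G" "c \<in> carrier G"
      using pre[of g1] pre[of g] pre[of k] by auto
    have "commutator G (a \<otimes> b) c = commutator G (conj_by G a b) (conj_by G a c) \<otimes> commutator G a c"
      by (simp add: commutator_def conj_by_def G.m_assoc G.inv_mult_group)
    moreover have "h a \<otimes>\<^bsub>H\<^esub> h b = h (a \<otimes> b)"
      "conj_by H (h a) (h b) = h (conj_by G a b)" "conj_by H (h a) (h c) = h (conj_by G a c)"
      by (simp_all add: conj)
    ultimately show "?\<tau> (g1 \<otimes>\<^bsub>H\<^esub> g) k = ?\<tau> (conj_by H g1 g) (conj_by H g1 k) \<otimes> ?\<tau> g1 k"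
      unfolding e by (simp only: \<tau> G.m_closed G.conj_by_closed
        \<open>a \<in> carrier G\<close> \<open>b \<in> carrier G\<close> \<open>c \<in> carrier G\<close>)
  next
    fix g k1 k assume "g \<in> carrier H" "k1 \<in> carrier H" "k \<in> carrier H"
    then obtain a b c where e: "g = h a" "k1 = h b" "k = h c"
      and [simp]: "a \<in> carrier G" "b \<in> carrier G" "c \<in> carrier G"
      using pre[of g] pre[of k1] pre[of k] by auto
    have "commutator G a (b \<otimes> c) = commutator G a b \<otimes> commutator G (conj_by G b a) (conj_by G b c)"
      by (simp add: commutator_def conj_by_def G.m_assoc G.inv_mult_group)
    moreover have "h b \<otimes>\<^bsub>H\<^esub> h c = h (b \<otimes> c)"
      "conj_by H (h b) (h a) = h (conj_by G b a)" "conj_by H (h b) (h c) = h (conj_by G b c)"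
      by (simp_all add: conj)
    ultimately show "?\<tau> g (k1 \<otimes>\<^bsub>H\<^esub> k) = ?\<tau> g k1 \<otimes> ?\<tau> (conj_by H k1 g) (conj_by H k1 k)"
      unfolding e by (simp only: \<tau> G.m_closed G.conj_by_closed
        \<open>a \<in> carrier G\<close> \<open>b \<in> carrier G\<close> \<open>c \<in> carrier G\<close>)
  qed
  then show ?thesis
    using \<tau> by (rule that)
qed

fun rotate_unit :: "quat_unit \<Rightarrow> quat_unit" where
  "rotate_unit Q1 = Q1"
| "rotate_unit QI = QJ"
| "rotate_unit QJ = QK"
| "rotate_unit QK = QI"

fun rotate_quat :: "bool \<times> quat_unit \<Rightarrow> bool \<times> quat_unit" where
  "rotate_quat (s, w) = (s, rotate_unit w)"

lemma rotate_quat_mult: "rotate_quat (quat_mult a b) = quat_mult (rotate_quat a) (rotate_quat b)"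
proof -
  obtain r s u v where "a = (r, u)" "b = (s, v)"
    by (metis surj_pair)
  then show ?thesis
    by (cases u; cases v) auto
qed

lemma rotate_quat_funpow_mult:
  "(rotate_quat ^^ n) (quat_mult a b) = quat_mult ((rotate_quat ^^ n) a) ((rotate_quat ^^ n) b)"
  by (induction n) (simp_all add: rotate_quat_mult del: quat_mult.simps)

lemma rotate_quat_cube: "(rotate_quat ^^ 3) a = a"
proof -
  obtain s u where "a = (s, u)"
    by (cases a)
  then show ?thesis
    by (cases u) (simp_all add: numeral_eq_Suc)
qed

lemma rotate_quat_funpow_mod: "(rotate_quat ^^ (n mod 3)) a = (rotate_quat ^^ n) a"
  by (rule funpow_mod_eq) (rule rotate_quat_cube)

text \<open>
  This is \<open>SL(2, 3)\<close>, built as the semidirect product of the quaternion group with the cyclic group of order 3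
  that rotates the quaternion units.
\<close>
definition binary_tetrahedral_group :: "((bool \<times> quat_unit) \<times> nat) monoid" where
  "binary_tetrahedral_group = \<lparr>carrier = UNIV \<times> {..<3},
     monoid.mult = (\<lambda>(a, i) (b, j). (quat_mult a ((rotate_quat ^^ i) b), (i + j) mod 3)),
     one = ((False, Q1), 0)\<rparr>"

lemma carrier_binary_tetrahedral_group [simp]: "carrier binary_tetrahedral_group = UNIV \<times> {..<3}"
  by (simp add: binary_tetrahedral_group_def)

lemma one_binary_tetrahedral_group [simp]: "\<one>\<^bsub>binary_tetrahedral_group\<^esub> = ((False, Q1), 0)"
  by (simp add: binary_tetrahedral_group_def)

lemma mult_binary_tetrahedral_group [simp]:
  "(a, i) \<otimes>\<^bsub>binary_tetrahedral_group\<^esub> (b, j) = (quat_mult a ((rotate_quat ^^ i) b), (i + j) mod 3)"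
  by (simp add: binary_tetrahedral_group_def)

lemma group_binary_tetrahedral_group: "group binary_tetrahedral_group" (is "group ?E")
proof (rule groupI)
  interpret Q: group quaternion_group by (rule group_quaternion_group)
  fix x assume x: "x \<in> carrier ?E"
  obtain a i where ai: "x = (a, i)" "i < 3"
    using x by auto
  show "\<one>\<^bsub>?E\<^esub> \<otimes>\<^bsub>?E\<^esub> x = x"
    using ai Q.l_one[of a] by simp
  show "\<exists>y\<in>carrier ?E. y \<otimes>\<^bsub>?E\<^esub> x = \<one>\<^bsub>?E\<^esub>"
  proof (rule bexI)
    let ?j = "(3 - i) mod 3"
    let ?y = "(inv\<^bsub>quaternion_group\<^esub> ((rotate_quat ^^ ?j) a), ?j)"
    have "(?j + i) mod 3 = 0"
      using ai by (simp add: mod_add_left_eq)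
    then show "?y \<otimes>\<^bsub>?E\<^esub> x = \<one>\<^bsub>?E\<^esub>"
      using ai Q.l_inv[of "(rotate_quat ^^ ?j) a"] by simp
    show "?y \<in> carrier ?E"
      by simp
  qed
next
  fix x y z assume "x \<in> carrier ?E" "y \<in> carrier ?E" "z \<in> carrier ?E"
  then obtain a i b j c k where "x = (a, i)" "y = (b, j)" "z = (c, k)"
    by (metis surj_pair)
  then show "x \<otimes>\<^bsub>?E\<^esub> y \<otimes>\<^bsub>?E\<^esub> z = x \<otimes>\<^bsub>?E\<^esub> (y \<otimes>\<^bsub>?E\<^esub> z)"
    by (simp add: rotate_quat_funpow_mod rotate_quat_funpow_mult quat_mult_assoc funpow_add
        mod_add_left_eq mod_add_right_eq add.assoc del: quat_mult.simps)
qed auto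

text \<open>
  The quaternion group modulo signs is a Klein four-group, here identified with the derived subgroup of
  an alternating group of degree 4 in such a way that \<open>rotate_unit\<close> becomes conjugation by \<open>x\<close>.
\<close>
fun klein_unit :: "('a, 'b) monoid_scheme \<Rightarrow> 'a \<Rightarrow> 'a \<Rightarrow> quat_unit \<Rightarrow> 'a" where
  "klein_unit G x u Q1 = \<one>\<^bsub>G\<^esub>"
| "klein_unit G x u QI = u"
| "klein_unit G x u QJ = conj_by G x u"
| "klein_unit G x u QK = u \<otimes>\<^bsub>G\<^esub> conj_by G x u"

context alternating_pair
begin

text \<open>
  The generator of the cyclic factor goes to \<open>x\<close>. The map is onto because its image contains the
  derived subgroup and \<open>x\<close>, of coprime orders 4 and 3; the kernel consists of the two signs.
\<close>
lemma binary_tetrahedral_epi: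
  assumes o: "order G = 12"
  defines "f \<equiv> \<lambda>((s :: bool, w), i). klein_unit G x u w \<otimes> x [^] (i :: nat)"
  shows "f \<in> hom binary_tetrahedral_group G" "f ` carrier binary_tetrahedral_group = carrier G"
    and "\<And>z. z \<in> carrier binary_tetrahedral_group \<Longrightarrow> f z = \<one> \<Longrightarrow> \<exists>s. z = ((s, Q1), 0)"
proof -
  let ?E = "binary_tetrahedral_group" and ?\<phi> = "klein_unit G x u" and ?v = "conj_by G x u"
  let ?D = "derived G (carrier G)"
  note sq = square and twice = conj_by_twice and comm = commute
    and D = derived_eq card_derived not_derived
  have [simp]: "?\<phi> w \<in> carrier G" for w
    by (cases w) simp_all
  have sq': "u \<otimes> (u \<otimes> a) = a" "?v \<otimes> (?v \<otimes> a) = a" if "a \<in> carrier G" for a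
    using that sq by (simp_all flip: m_assoc)
  have comm': "?v \<otimes> (u \<otimes> a) = u \<otimes> (?v \<otimes> a)" if "a \<in> carrier G" for a
    using that by (simp add: comm flip: m_assoc)
  have \<phi>_mult: "?\<phi> (snd (quat_unit_mult w w')) = ?\<phi> w \<otimes> ?\<phi> w'" for w w'
    by (cases w; cases w') (simp_all add: sq sq' comm comm' m_assoc)
  have \<phi>_rot: "?\<phi> (rotate_unit w) = conj_by G x (?\<phi> w)" for w
    by (cases w) (simp_all add: twice conj_by_mult comm' sq sq')
  have \<phi>_pow: "x [^] i \<otimes> ?\<phi> w = ?\<phi> ((rotate_unit ^^ i) w) \<otimes> x [^] i" for i :: nat and w
  proof (induction i)
    case (Suc i)
    have "x [^] Suc i \<otimes> ?\<phi> w = x \<otimes> (x [^] i \<otimes> ?\<phi> w)"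
      using nat_pow_Suc2[OF x, of i] by (simp add: m_assoc)
    also have "\<dots> = conj_by G x (?\<phi> ((rotate_unit ^^ i) w)) \<otimes> (x \<otimes> x [^] i)"
      by (simp add: Suc conj_by_def m_assoc)
    also have "x \<otimes> x [^] i = x [^] Suc i"
      by (rule nat_pow_Suc2[OF x, symmetric])
    finally show ?case
      by (simp only: \<phi>_rot funpow.simps comp_apply)
  qed simp
  have pow_mod: "x [^] (n mod 3) = x [^] n" for n :: nat
  proof -
    have "x [^] n = x [^] (3 * (n div 3) + n mod 3)"
      by simp
    also have "\<dots> = (x [^] (3 :: nat)) [^] (n div 3) \<otimes> x [^] (n mod 3)"
      by (simp only: nat_pow_mult[symmetric] nat_pow_pow x)
    finally show ?thesis
      by (simp add: cube)
  qed
  have rot: "(rotate_quat ^^ i) (s, w) = (s, (rotate_unit ^^ i) w)" for i s w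
    by (induction i) simp_all
  have f: "f ((s, w), i) = ?\<phi> w \<otimes> x [^] i" for s w i
    by (simp add: f_def)
  have f_mult: "f (quat_mult (s, w) (t, w'), i) = ?\<phi> w \<otimes> ?\<phi> w' \<otimes> x [^] i" for s w t w' i
    by (simp add: f_def case_prod_unfold Let_def \<phi>_mult)
  show hom: "f \<in> hom ?E G"
  proof (rule homI)
    fix a b assume "a \<in> carrier ?E" "b \<in> carrier ?E"
    then obtain s w i t w' j where ab: "a = ((s, w), i)" "b = ((t, w'), j)"
      by (metis surj_pair)
    have "f (a \<otimes>\<^bsub>?E\<^esub> b) = ?\<phi> w \<otimes> ?\<phi> ((rotate_unit ^^ i) w') \<otimes> x [^] (i + j)"
      unfolding ab mult_binary_tetrahedral_group rot f_mult pow_mod ..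
    also have "\<dots> = ?\<phi> w \<otimes> (?\<phi> ((rotate_unit ^^ i) w') \<otimes> x [^] i) \<otimes> x [^] j"
      by (simp add: nat_pow_mult[symmetric] m_assoc)
    also have "\<dots> = f a \<otimes> f b"
      by (simp add: ab f \<phi>_pow[symmetric] m_assoc)
    finally show "f (a \<otimes>\<^bsub>?E\<^esub> b) = f a \<otimes> f b" .
  next
    fix a assume "a \<in> carrier ?E"
    then show "f a \<in> carrier G"
      by (cases a; cases "fst a") (simp add: f)
  qed
  interpret f: group_hom ?E G f
    using hom group_binary_tetrahedral_group is_group by (simp add: group_hom_def group_hom_axioms_def)
  have D_sub: "subgroup ?D G"
    by (simp add: derived_is_subgroup)
  have I: "subgroup (f ` carrier ?E) G"
    by (rule f.img_is_subgroup)
  have fin: "finite (carrier G)"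
    using o order_gt_0_iff_finite by simp
  have "f ((False, w), 0) \<in> f ` carrier ?E" for w
    by (rule imageI) simp
  then have "?\<phi> w \<in> f ` carrier ?E" for w
    by (simp add: f)
  from this[of Q1] this[of QI] this[of QJ] this[of QK] have "?D \<subseteq> f ` carrier ?E"
    unfolding D by simp
  then have "4 dvd card (f ` carrier ?E)"
    using card_subgroup_dvd[OF D_sub I] D by simp
  moreover have "3 dvd card (f ` carrier ?E)"
  proof -
    have "x \<noteq> \<one>"
      using D by auto
    then have "ord x \<noteq> 1"
      using ord_eq_1[OF x] by simp
    moreover have "ord x dvd 3"
      using cube by (simp add: pow_eq_id)
    ultimately have "ord x = 3"
      using prime_nat_iff[of 3] by auto
    then have "card (generate G {x}) = 3"
      using generate_pow_card[OF x] by simp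
    moreover have "f ((False, Q1), 1) \<in> f ` carrier ?E"
      by (rule imageI) simp
    then have "generate G {x} \<subseteq> f ` carrier ?E"
      by (intro generate_subgroup_incl I) (simp add: f)
    ultimately show ?thesis
      using card_subgroup_dvd[OF generate_is_subgroup I, of "{x}"] by simp
  qed
  ultimately have "4 * 3 dvd card (f ` carrier ?E)"
    by (intro divides_mult) (auto simp: coprime_iff_gcd_eq_1 gcd_nat.simps)
  moreover have sub: "f ` carrier ?E \<subseteq> carrier G"
    by (rule subgroup.subset[OF I])
  moreover have "card (f ` carrier ?E) > 0"
    using fin sub subgroup.one_closed[OF I] finite_subset by (auto simp: card_gt_0_iff)
  ultimately show "f ` carrier ?E = carrier G"
    using fin o by (intro card_seteq) (auto simp: order_def dest: dvd_imp_le)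
  show "\<exists>s. z = ((s, Q1), 0)" if z: "z \<in> carrier ?E" "f z = \<one>" for z
  proof -
    obtain s w i where z_eq: "z = ((s, w), i)" and i: "i < 3"
      using z(1) by (metis carrier_binary_tetrahedral_group lessThan_iff mem_Sigma_iff surj_pair)
    have \<phi>D: "?\<phi> w \<in> ?D"
      unfolding D by (cases w) simp_all
    have e: "?\<phi> w \<otimes> x [^] i = \<one>"
      using z(2) by (simp add: z_eq f)
    have "inv (x [^] i) = ?\<phi> w"
      using e by (simp add: inv_equality)
    then have "inv (inv (x [^] i)) \<in> ?D"
      using \<phi>D D_sub by (simp only: subgroup.m_inv_closed)
    then have xi: "x [^] i \<in> ?D"
      by simp
    \<comment> \<open>otherwise \<open>?D\<close> would contain \<open>x\<close>, which is the square of \<open>x\<^sup>2\<close>\<close>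
    have "x [^] (2 :: nat) \<notin> ?D"
    proof
      assume "x [^] (2 :: nat) \<in> ?D"
      then have "x [^] (2 :: nat) \<otimes> x [^] (2 :: nat) \<in> ?D"
        using D_sub by (simp add: subgroup.m_closed)
      then have "x [^] (4 mod 3 :: nat) \<in> ?D"
        unfolding pow_mod by (simp add: nat_pow_mult)
      then show False
        using D by simp
    qed
    moreover have "i = 0 \<or> i = 1 \<or> i = 2"
      using i by linarith
    ultimately have "i = 0"
      using xi D(3) by auto
    moreover have "w = Q1"
    proof -
      have "inj_on ?\<phi> UNIV"
        using D by (intro eq_card_imp_inj_on) (simp_all add: UNIV_quat_unit)
      moreover have "?\<phi> w = ?\<phi> Q1"
        using e \<open>i = 0\<close> by simp
      ultimately show ?thesis
        by (simp add: inj_on_def)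
    qed
    ultimately show ?thesis
      by (simp add: z_eq)
  qed
qed

text \<open>
  Commutators in the binary tetrahedral group lie in its quaternion subgroup and, as the kernel over
  the alternating group is central, they define a crossed pairing on the latter.
\<close>
lemma tensor_square_epi_quaternion_group:
  assumes o: "order G = 12"
  obtains f where "f \<in> hom (tensor_square G) quaternion_group"
    and "f ` carrier (tensor_square G) = carrier quaternion_group"
proof -
  let ?E = "binary_tetrahedral_group"
  interpret Q: group quaternion_group by (rule group_quaternion_group)
  obtain f where f: "f \<in> hom ?E G" "f ` carrier ?E = carrier G"
    and ker: "\<And>z. z \<in> carrier ?E \<Longrightarrow> f z = \<one> \<Longrightarrow> \<exists>s. z = ((s, Q1), 0)"
    using binary_tetrahedral_epi[OF o] by blast
  interpret f: group_hom ?E G f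
    using f group_binary_tetrahedral_group is_group by (simp add: group_hom_def group_hom_axioms_def)
  have "z \<otimes>\<^bsub>?E\<^esub> g = g \<otimes>\<^bsub>?E\<^esub> z" if z: "z \<in> carrier ?E" "f z = \<one>" and g: "g \<in> carrier ?E" for z g
  proof -
    obtain s where s: "z = ((s, Q1), 0)"
      using ker[OF z] by blast
    obtain t w i where g_eq: "g = ((t, w), i)" "i < 3"
      using g by (metis carrier_binary_tetrahedral_group lessThan_iff mem_Sigma_iff surj_pair)
    have "(rotate_quat ^^ i) (s, Q1) = (s, Q1)"
      by (induction i) simp_all
    then show ?thesis
      using g_eq(2) by (cases w) (auto simp: s g_eq(1))
  qed
  then obtain \<tau> where \<tau>: "crossed_pairing G ?E \<tau>"
    and \<tau>_comm: "\<And>a b. a \<in> carrier ?E \<Longrightarrow> b \<in> carrier ?E \<Longrightarrow> \<tau> (f a) (f b) = commutator ?E a b"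
    using f.central_extension_pairing[OF f(2)] by blast
  interpret \<tau>: crossed_pairing G ?E \<tau> by (rule \<tau>)
  interpret Z: comm_group "integer_mod_group 3" by simp
  have "(\<lambda>a. int (snd a)) \<in> hom ?E (integer_mod_group 3)"
  proof (rule homI)
    fix a b assume "a \<in> carrier ?E" "b \<in> carrier ?E"
    show "int (snd (a \<otimes>\<^bsub>?E\<^esub> b)) = int (snd a) \<otimes>\<^bsub>integer_mod_group 3\<^esub> int (snd b)"
      by (cases a; cases b) (simp add: zmod_int)
  qed (auto simp: carrier_integer_mod_group)
  then interpret i: group_hom ?E "integer_mod_group 3" "\<lambda>a. int (snd a)"
    by (intro group_hom.intro group_hom_axioms.intro group_binary_tetrahedral_group group_integer_mod_group)
  have snd_zero: "snd (\<tau> g h) = 0" if gh: "g \<in> carrier G" "h \<in> carrier G" for g h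
  proof -
    have "g \<in> f ` carrier ?E" "h \<in> f ` carrier ?E"
      unfolding f(2) by (rule gh)+
    then obtain a b where ab: "a \<in> carrier ?E" "b \<in> carrier ?E" "g = f a" "h = f b"
      by blast
    have "int (snd (commutator ?E a b)) = commutator (integer_mod_group 3) (int (snd a)) (int (snd b))"
      using ab(1,2) by (rule i.commutator_hom)
    also have "\<dots> = \<one>\<^bsub>integer_mod_group 3\<^esub>"
      using i.hom_closed[OF ab(1)] i.hom_closed[OF ab(2)] by (subst Z.commutator_eq_one_iff) (simp_all only: Z.m_comm)
    finally show ?thesis
      by (simp only: ab \<tau>_comm) simp
  qed
  define \<psi> where "\<psi> g h = fst (\<tau> g h)" for g h
  have \<tau>_eq: "\<tau> g h = (\<psi> g h, 0)" if "g \<in> carrier G" "h \<in> carrier G" for g h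
    using snd_zero[OF that] by (simp add: \<psi>_def prod_eq_iff)
  interpret \<psi>: crossed_pairing G quaternion_group \<psi>
  proof unfold_locales
    fix g1 g h assume c: "g1 \<in> carrier G" "g \<in> carrier G" "h \<in> carrier G"
    show "\<psi> (g1 \<otimes> g) h = \<psi> (conj_by G g1 g) (conj_by G g1 h) \<otimes>\<^bsub>quaternion_group\<^esub> \<psi> g1 h"
      using \<tau>.mult_left[OF c] c by (simp add: \<tau>_eq)
    show "\<psi> g1 (g \<otimes> h) = \<psi> g1 g \<otimes>\<^bsub>quaternion_group\<^esub> \<psi> (conj_by G g g1) (conj_by G g h)"
      using \<tau>.mult_right[OF c] c by (simp add: \<tau>_eq)
  qed simp
  have vals: "c \<in> generate quaternion_group {\<psi> g h | g h. g \<in> carrier G \<and> h \<in> carrier G}"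
    if c: "quat_mult c (False, w) = (False, rotate_unit w)" for c w
  proof -
    \<comment> \<open>\<open>[t, w] = t w t\<^sup>-\<^sup>1 w\<^sup>-\<^sup>1\<close>, where \<open>t\<close> is the generator that rotates the quaternion units\<close>
    let ?t = "((False, Q1), 1 :: nat)" and ?w = "((False, w), 0 :: nat)" and ?c = "(c, 0 :: nat)"
    have [simp]: "?t \<in> carrier ?E" "?w \<in> carrier ?E" "?c \<in> carrier ?E"
      by simp_all
    have "?t \<otimes>\<^bsub>?E\<^esub> ?w = ?c \<otimes>\<^bsub>?E\<^esub> (?w \<otimes>\<^bsub>?E\<^esub> ?t)"
      using c by (cases w) simp_all
    then have "commutator ?E ?t ?w = ?c"
      by (rule f.G.commutator_eqI[rotated 3]) simp_all
    then have "\<tau> (f ?t) (f ?w) = ?c"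
      by (simp add: \<tau>_comm)
    then have "\<psi> (f ?t) (f ?w) = c"
      by (simp add: \<psi>_def)
    moreover have "f ?t \<in> carrier G" "f ?w \<in> carrier G"
      by simp_all
    ultimately show ?thesis
      by (intro generate.incl) blast
  qed
  have "{(False, QI), (False, QJ), (False, QK)}
      \<subseteq> generate quaternion_group {\<psi> g h | g h. g \<in> carrier G \<and> h \<in> carrier G}"
    using vals[of "(False, QK)" QI] vals[of "(False, QI)" QJ] vals[of "(False, QJ)" QK] by simp
  then show ?thesis
    using \<psi>.tensor_square_epi[OF generate_quaternion_group] that by blast
qed

end

section \<open>Homomorphisms from the tensor square to abelian groups\<close>

context group
begin

lemma abelianization_epi:
  assumes L: "abelianization G \<cong> L" "group L"
  obtains \<phi> where "\<phi> \<in> hom G L" "\<phi> ` carrier G = carrier L"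
    and "\<forall>g\<in>carrier G. \<phi> g = \<one>\<^bsub>L\<^esub> \<longleftrightarrow> g \<in> derived G (carrier G)"
proof -
  let ?D = "derived G (carrier G)"
  interpret D: normal ?D G
    by (rule derived_self_is_normal)
  interpret Q: group "G Mod ?D" by (rule D.factorgroup_is_group)
  obtain h where h: "h \<in> iso (G Mod ?D) L"
    using L(1) unfolding abelianization_def is_iso_def by auto
  interpret h: group_hom "G Mod ?D" L h
    using h L(2) by (simp add: group_hom_def group_hom_axioms_def iso_def Q.is_group)
  have bij: "bij_betw h (carrier (G Mod ?D)) (carrier L)"
    using h by (simp add: iso_def)
  let ?\<phi> = "\<lambda>g. h (?D #> g)"
  have coset: "?D #> g \<in> carrier (G Mod ?D)" if "g \<in> carrier G" for g
    using that by (simp add: carrier_FactGroup)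
  show ?thesis
  proof (rule that[of ?\<phi>])
    show "?\<phi> \<in> hom G L"
    proof (rule homI)
      fix x y assume xy: "x \<in> carrier G" "y \<in> carrier G"
      then show "?\<phi> (x \<otimes> y) = ?\<phi> x \<otimes>\<^bsub>L\<^esub> ?\<phi> y"
        using h.hom_mult[OF coset[OF xy(1)] coset[OF xy(2)]] by (simp add: D.rcos_sum)
    qed (use coset in simp)
    show "?\<phi> ` carrier G = carrier L"
      using bij_betw_imp_surj_on[OF bij] by (simp add: carrier_FactGroup image_image)
    show "\<forall>g\<in>carrier G. ?\<phi> g = \<one>\<^bsub>L\<^esub> \<longleftrightarrow> g \<in> ?D"
    proof
      fix g assume g: "g \<in> carrier G"
      have "?\<phi> g = \<one>\<^bsub>L\<^esub> \<longleftrightarrow> ?\<phi> g = h \<one>\<^bsub>G Mod ?D\<^esub>"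
        by (simp only: h.hom_one)
      also have "\<dots> \<longleftrightarrow> ?D #> g = \<one>\<^bsub>G Mod ?D\<^esub>"
        using inj_on_eq_iff[OF bij_betw_imp_inj_on[OF bij] coset[OF g] Q.one_closed] .
      also have "\<dots> \<longleftrightarrow> g \<in> ?D"
        using coset_join1[OF _ g D.subgroup_axioms] coset_join2[OF g D.subgroup_axioms] by auto
      finally show "?\<phi> g = \<one>\<^bsub>L\<^esub> \<longleftrightarrow> g \<in> ?D" .
    qed
  qed
qed

lemma card_rcosets_derived:
  assumes "abelianization G \<cong> L"
  shows "card (rcosets (derived G (carrier G))) = card (carrier L)"
  using assms iso_same_card unfolding abelianization_def by (fastforce simp: FactGroup_def)

lemma generate_if_image_generates:
  assumes \<phi>: "\<phi> \<in> hom G L" "group L"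
    and ker: "\<And>g. g \<in> carrier G \<Longrightarrow> \<phi> g = \<one>\<^bsub>L\<^esub> \<Longrightarrow> g \<in> N" and N: "N \<subseteq> carrier G"
    and A: "A \<subseteq> carrier G" "generate L (\<phi> ` A) = carrier L"
  shows "generate G (A \<union> N) = carrier G"
proof
  interpret \<phi>: group_hom G L \<phi>
    using \<phi> is_group by (simp add: group_hom_def group_hom_axioms_def)
  have sub: "A \<union> N \<subseteq> carrier G"
    using A N by auto
  interpret H: subgroup "generate G (A \<union> N)" G
    by (rule generate_is_subgroup[OF sub])
  show "carrier G \<subseteq> generate G (A \<union> N)"
  proof
    fix g assume g: "g \<in> carrier G"
    have "\<phi> g \<in> generate L (\<phi> ` A)"
      unfolding A(2) using g by simp
    then have "\<phi> g \<in> \<phi> ` generate G A"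
      unfolding \<phi>.generate_img[OF A(1)] .
    then obtain h where h: "h \<in> generate G A" "\<phi> g = \<phi> h"
      by auto
    have hc: "h \<in> carrier G"
      using h(1) A generate_in_carrier by blast
    have "\<phi> (g \<otimes> inv h) = \<one>\<^bsub>L\<^esub>"
      using g hc h(2) by simp
    then have "g \<otimes> inv h \<in> N"
      using g hc ker by simp
    then have "g \<otimes> inv h \<in> generate G (A \<union> N)"
      by (intro generate.incl) simp
    moreover have "h \<in> generate G (A \<union> N)"
      using h(1) mono_generate[of A "A \<union> N"] by auto
    ultimately have "g \<otimes> inv h \<otimes> h \<in> generate G (A \<union> N)"
      by (rule H.m_closed)
    then show "g \<in> generate G (A \<union> N)"
      using g hc by (simp add: m_assoc)
  qed
qed (rule generate_incl, use A N in auto)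

end

lemma generate_integer_mod_group:
  assumes "m > 1"
  shows "generate (integer_mod_group m) {1} = carrier (integer_mod_group m)"
proof -
  interpret Z: group "integer_mod_group m" by simp
  have one: "1 \<in> carrier (integer_mod_group m)"
    using assms by simp
  have "i \<in> generate (integer_mod_group m) {1}" if "i \<in> carrier (integer_mod_group m)" for i
  proof -
    have "i = 1 [^]\<^bsub>integer_mod_group m\<^esub> i"
      using that assms by (simp add: int_pow_integer_mod_group carrier_integer_mod_group)
    then show ?thesis
      using Z.generate_pow[OF one] by blast
  qed
  then show ?thesis
    using Z.generate_incl[of "{1}"] one by blast
qed

lemma pow_DirProd_integer_mod_group:
  "(i, j) [^]\<^bsub>integer_mod_group m \<times>\<times> integer_mod_group m\<^esub> (n :: nat)
    = ((int n * i) mod int m, (int n * j) mod int m)"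
  by (induction n) (simp_all add: mod_simps algebra_simps)

lemma generate_DirProd_integer_mod_group:
  assumes "m > 1"
  shows "generate (integer_mod_group m \<times>\<times> integer_mod_group m) {(1, 0), (0, 1)}
    = carrier (integer_mod_group m \<times>\<times> integer_mod_group m)" (is "generate ?L ?A = _")
proof -
  interpret L: group ?L by (simp add: DirProd_group)
  have A: "?A \<subseteq> carrier ?L"
    using assms by simp
  interpret H: subgroup "generate ?L ?A" ?L
    by (rule L.generate_is_subgroup[OF A])
  have pow_mem: "x [^]\<^bsub>?L\<^esub> n \<in> generate ?L ?A" if "x \<in> ?A" for x and n :: nat
    using that A by (induction n) (auto intro: generate.incl simp del: mult_DirProd one_DirProd)
  have "(i, j) \<in> generate ?L ?A" if ij: "i \<in> carrier (integer_mod_group m)" "j \<in> carrier (integer_mod_group m)" for i j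
  proof -
    have "(1, 0) [^]\<^bsub>?L\<^esub> nat i \<otimes>\<^bsub>?L\<^esub> (0, 1) [^]\<^bsub>?L\<^esub> nat j \<in> generate ?L ?A"
      by (intro H.m_closed pow_mem) auto
    moreover have "(1, 0) [^]\<^bsub>?L\<^esub> nat i \<otimes>\<^bsub>?L\<^esub> (0, 1) [^]\<^bsub>?L\<^esub> nat j = (i, j)"
      unfolding pow_DirProd_integer_mod_group using ij assms by (simp add: carrier_integer_mod_group)
    ultimately show ?thesis
      by simp
  qed
  then show ?thesis
    using L.generate_incl[OF A] by auto
qed

lemma generate_cyclic_power_four:
  assumes "m > 1"
  shows "generate (cyclic_power m 4) ((\<lambda>k. \<lambda>i\<in>{..<4}. if i = k then 1 else 0) ` {..<4}) = carrier (cyclic_power m 4)"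
    (is "generate ?L (?e ` _) = _")
proof -
  interpret L: group ?L by (simp add: cyclic_power_def)
  have A: "?e ` {..<4} \<subseteq> carrier ?L"
    using assms by (auto simp: cyclic_power_def)
  interpret H: subgroup "generate ?L (?e ` {..<4})" ?L
    by (rule L.generate_is_subgroup[OF A])
  have pow: "?e k [^]\<^bsub>?L\<^esub> n = (\<lambda>i\<in>{..<4}. if i = k then int n mod int m else 0)" for k and n :: nat
    by (induction n) (auto simp: cyclic_power_def mod_simps algebra_simps fun_eq_iff restrict_def)
  have pow_mem: "?e k [^]\<^bsub>?L\<^esub> n \<in> generate ?L (?e ` {..<4})" if "k < 4" for k and n :: nat
    using that A by (induction n) (auto intro: generate.incl)
  have "x \<in> generate ?L (?e ` {..<4})" if x: "x \<in> carrier ?L" for x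
  proof -
    let ?p = "\<lambda>k. ?e k [^]\<^bsub>?L\<^esub> nat (x k)"
    have xi: "0 \<le> x i \<and> x i < int m" if "i < 4" for i
      using x that assms by (auto simp: cyclic_power_def carrier_integer_mod_group PiE_iff)
    define y where "y = ?p 0 \<otimes>\<^bsub>?L\<^esub> (?p 1 \<otimes>\<^bsub>?L\<^esub> (?p 2 \<otimes>\<^bsub>?L\<^esub> ?p 3))"
    have y: "y \<in> generate ?L (?e ` {..<4})"
      unfolding y_def by (intro H.m_closed pow_mem) simp_all
    have ext: "z \<in> extensional {..<4}" if "z \<in> carrier ?L" for z
      using that unfolding cyclic_power_def carrier_product_group PiE_def by (rule IntD2)
    have mult: "(v \<otimes>\<^bsub>?L\<^esub> w) i = (v i + w i) mod int m" if "i < 4" for v w i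
      using that by (simp add: cyclic_power_def)
    have pi: "?p 0 i = (if i = 0 then x 0 else 0)" "?p 1 i = (if i = 1 then x 1 else 0)"
      "?p 2 i = (if i = 2 then x 2 else 0)" "?p 3 i = (if i = 3 then x 3 else 0)" if i: "i \<in> {..<4}" for i
      unfolding pow restrict_apply'[OF i] using xi[of 0] xi[of 1] xi[of 2] xi[of 3] by simp_all
    have "y i = x i" if i: "i \<in> {..<4}" for i
    proof -
      have "y i = (?p 0 i + (?p 1 i + (?p 2 i + ?p 3 i) mod int m) mod int m) mod int m"
        unfolding y_def using i by (simp only: mult lessThan_iff)
      also have "\<dots> = ((if i = 0 then x 0 else 0) + ((if i = 1 then x 1 else 0)
          + ((if i = 2 then x 2 else 0) + (if i = 3 then x 3 else 0)) mod int m) mod int m) mod int m"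
        by (simp only: pi[OF i])
      also have "\<dots> = x i"
      proof -
        consider "i = 0" | "i = 1" | "i = 2" | "i = 3"
          using i by fastforce
        then show ?thesis
          using xi[of i] i by cases simp_all
      qed
      finally show ?thesis .
    qed
    then have "y = x"
      using ext[OF H.mem_carrier[OF y]] ext[OF x] extensionalityI by blast
    then show ?thesis
      using y by simp
  qed
  then show ?thesis
    using L.generate_incl[OF A] by auto
qed

lemma card_cyclic_power:
  assumes "m > 0"
  shows "finite (carrier (cyclic_power m n))" "card (carrier (cyclic_power m n)) = m ^ n"
  using assms by (auto simp: cyclic_power_def carrier_integer_mod_group card_PiE intro!: finite_PiE)

lemma DirProd_integer_mod_group_iso:
  assumes "coprime m n" "m > 0" "n > 0"
  shows "integer_mod_group m \<times>\<times> integer_mod_group n \<cong> integer_mod_group (m * n)"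
proof -
  interpret L: group "integer_mod_group m \<times>\<times> integer_mod_group n"
    by (simp add: DirProd_group)
  let ?h = "\<lambda>i. (i mod int m, i mod int n)"
  show ?thesis
  proof (rule L.iso_if_inj_hom[of _ ?h])
    show "?h \<in> hom (integer_mod_group (m * n)) (integer_mod_group m \<times>\<times> integer_mod_group n)"
      using assms by (intro homI) (auto simp: carrier_integer_mod_group mod_mod_cancel mod_simps)
    show "inj_on ?h (carrier (integer_mod_group (m * n)))"
    proof (rule inj_onI)
      fix i j assume ij: "i \<in> carrier (integer_mod_group (m * n))" "j \<in> carrier (integer_mod_group (m * n))"
        and "?h i = ?h j"
      then have "int m dvd i - j" "int n dvd i - j"
        by (simp_all add: mod_eq_dvd_iff)
      then have "int m * int n dvd i - j"
        using assms by (intro divides_mult) auto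
      then have "i mod int (m * n) = j mod int (m * n)"
        by (simp add: mod_eq_dvd_iff)
      then show "i = j"
        using ij assms by (simp add: carrier_integer_mod_group)
    qed
  qed (use assms in \<open>simp_all add: carrier_integer_mod_group nat_mult_distrib\<close>)
qed

context group
begin

lemma conj_by_hom_comm:
  assumes "\<phi> \<in> hom G L" "comm_group L" "x \<in> carrier G" "y \<in> carrier G"
  shows "\<phi> (conj_by G x y) = \<phi> y"
proof -
  interpret L: comm_group L by fact
  interpret \<phi>: group_hom G L \<phi>
    using assms is_group L.is_group by (simp add: group_hom_def group_hom_axioms_def)
  show ?thesis
    using assms by (simp add: conj_by_def L.m_comm[of "\<phi> x" "\<phi> y"] L.m_assoc)
qed

lemma crossed_pairing_product:
  assumes "\<phi> \<in> hom G (integer_mod_group m)" "\<psi> \<in> hom G (integer_mod_group m)" "m > 0"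
  shows "crossed_pairing G (integer_mod_group m) (\<lambda>g h. \<phi> g * \<psi> h mod int m)"
proof -
  interpret Z: group "integer_mod_group m" by simp
  have mult: "\<phi> (x \<otimes> y) = (\<phi> x + \<phi> y) mod int m" "\<psi> (x \<otimes> y) = (\<psi> x + \<psi> y) mod int m"
    if "x \<in> carrier G" "y \<in> carrier G" for x y
    using that assms by (auto simp: hom_mult)
  show ?thesis
    by unfold_locales
      (use assms in \<open>auto simp: carrier_integer_mod_group mult conj_by_hom_comm[OF _ abelian_integer_mod_group]
        mod_simps algebra_simps\<close>)
qed

lemma tensor_square_epi_cyclic:
  assumes ab: "abelianization G \<cong> integer_mod_group m" and m: "m > 1"
  obtains f where "f \<in> hom (tensor_square G) (integer_mod_group m)"
    and "f ` carrier (tensor_square G) = carrier (integer_mod_group m)"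
proof -
  obtain \<phi> where \<phi>: "\<phi> \<in> hom G (integer_mod_group m)" "\<phi> ` carrier G = carrier (integer_mod_group m)"
    using abelianization_epi[OF ab group_integer_mod_group] by metis
  interpret c: crossed_pairing G "integer_mod_group m" "\<lambda>g h. \<phi> g * \<phi> h mod int m"
    using \<phi>(1) m by (intro crossed_pairing_product) auto
  have "1 \<in> \<phi> ` carrier G"
    unfolding \<phi>(2) using m by simp
  then obtain a where a: "a \<in> carrier G" "\<phi> a = 1"
    by auto
  have "1 \<in> generate (integer_mod_group m) {\<phi> g * \<phi> h mod int m | g h. g \<in> carrier G \<and> h \<in> carrier G}"
    using a m by (intro generate.incl) (auto intro!: exI[of _ a])
  then show ?thesis
    by (intro c.tensor_square_epi[OF generate_integer_mod_group[OF m] _ that]) auto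
qed

text \<open>
  The four coordinates are the products of one coordinate of \<open>\<phi> g\<close> and one of \<open>\<phi> h\<close>; index \<open>i\<close> stands for
  the pair \<open>(i div 2, i mod 2)\<close>. This is the tensor product of the abelianization with itself.
\<close>
lemma tensor_square_epi_bicyclic:
  assumes ab: "abelianization G \<cong> integer_mod_group m \<times>\<times> integer_mod_group m" and m: "m > 1"
  obtains f where "f \<in> hom (tensor_square G) (cyclic_power m 4)"
    and "f ` carrier (tensor_square G) = carrier (cyclic_power m 4)"
proof -
  let ?L = "integer_mod_group m \<times>\<times> integer_mod_group m" and ?Z = "integer_mod_group m"
  obtain \<phi> where \<phi>: "\<phi> \<in> hom G ?L" "\<phi> ` carrier G = carrier ?L"
    using abelianization_epi[OF ab DirProd_group[OF group_integer_mod_group group_integer_mod_group]] by metis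
  have comp: "(\<lambda>g. fst (\<phi> g)) \<in> hom G ?Z" "(\<lambda>g. snd (\<phi> g)) \<in> hom G ?Z"
    using \<phi>(1) by (auto simp: hom_def Pi_iff mult_DirProd' mem_Times_iff)
  define \<psi> where "\<psi> i = (if i = (0 :: nat) then \<lambda>g. fst (\<phi> g) else (\<lambda>g. snd (\<phi> g)))" for i
  have \<psi>: "\<psi> i \<in> hom G ?Z" for i
    using comp by (cases "i = 0") (simp_all add: \<psi>_def)
  define \<tau> where "\<tau> g h = (\<lambda>i\<in>{..<4 :: nat}. \<psi> (i div 2) g * \<psi> (i mod 2) h mod int m)" for g h
  interpret L4: group "cyclic_power m 4" by (simp add: cyclic_power_def)
  interpret c: crossed_pairing G "cyclic_power m 4" \<tau>
  proof -
    interpret c: crossed_pairing G ?Z "\<lambda>g h. \<psi> i g * \<psi> j h mod int m" for i j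
      using \<psi> m by (intro crossed_pairing_product) auto
    show "crossed_pairing G (cyclic_power m 4) \<tau>"
    proof unfold_locales
      show "\<tau> g h \<in> carrier (cyclic_power m 4)" if "g \<in> carrier G" "h \<in> carrier G" for g h
        using c.closed[OF that] by (simp add: cyclic_power_def \<tau>_def)
    next
      fix g1 g h assume a: "g1 \<in> carrier G" "g \<in> carrier G" "h \<in> carrier G"
      show "\<tau> (g1 \<otimes> g) h = \<tau> (conj_by G g1 g) (conj_by G g1 h) \<otimes>\<^bsub>cyclic_power m 4\<^esub> \<tau> g1 h"
        unfolding cyclic_power_def mult_product_group \<tau>_def
        by (rule restrict_ext) (simp only: restrict_apply' c.mult_left[OF a])
      show "\<tau> g1 (g \<otimes> h) = \<tau> g1 g \<otimes>\<^bsub>cyclic_power m 4\<^esub> \<tau> (conj_by G g g1) (conj_by G g h)"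
        unfolding cyclic_power_def mult_product_group \<tau>_def
        by (rule restrict_ext) (simp only: restrict_apply' c.mult_right[OF a])
    qed
  qed
  have "(1, 0) \<in> \<phi> ` carrier G" "(0, 1) \<in> \<phi> ` carrier G"
    unfolding \<phi>(2) using m by simp_all
  then obtain a b where ab: "a \<in> carrier G" "\<phi> a = (1, 0)" "b \<in> carrier G" "\<phi> b = (0, 1)"
    by (metis imageE)
  define c where "c i = (if i = (0 :: nat) then a else b)" for i
  have c_in: "c i \<in> carrier G" for i
    using ab by (simp add: c_def)
  have c_val: "\<psi> i (c j) = (if i = j then 1 else 0)" if "i < 2" "j < 2" for i j
    using that ab by (auto simp: \<psi>_def c_def)
  have unit: "\<tau> (c (k div 2)) (c (k mod 2)) = (\<lambda>i\<in>{..<4}. if i = k then 1 else 0)" if k: "k < 4" for k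
  proof -
    have "i = k \<longleftrightarrow> i div 2 = k div 2 \<and> i mod 2 = k mod 2" for i :: nat
      by (metis div_mult_mod_eq)
    then show ?thesis
      unfolding \<tau>_def using k m by (intro restrict_ext) (simp add: c_val less_mult_imp_div_less)
  qed
  have "(\<lambda>k. \<lambda>i\<in>{..<4}. if i = k then 1 else 0) ` {..<4}
      \<subseteq> generate (cyclic_power m 4) {\<tau> g h | g h. g \<in> carrier G \<and> h \<in> carrier G}"
    using c_in unit by (auto intro!: generate.incl) metis
  then show ?thesis
    by (rule c.tensor_square_epi[OF generate_cyclic_power_four[OF m] _ that])
qed

lemma tensor_square_epi_derived:
  obtains f where "f \<in> hom (tensor_square G) (G\<lparr>carrier := derived G (carrier G)\<rparr>)"
    and "f ` carrier (tensor_square G) = derived G (carrier G)"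
proof -
  let ?D = "derived G (carrier G)"
  have sub: "subgroup ?D G"
    by (simp add: derived_is_subgroup)
  interpret D: group "G\<lparr>carrier := ?D\<rparr>"
    using sub by (rule subgroup_imp_group)
  interpret c: crossed_pairing G "G\<lparr>carrier := ?D\<rparr>" "commutator G"
  proof unfold_locales
    fix g1 g h assume [simp]: "g1 \<in> carrier G" "g \<in> carrier G" "h \<in> carrier G"
    show "commutator G (g1 \<otimes> g) h
        = commutator G (conj_by G g1 g) (conj_by G g1 h) \<otimes>\<^bsub>G\<lparr>carrier := ?D\<rparr>\<^esub> commutator G g1 h"
      by (simp add: commutator_def conj_by_def m_assoc inv_mult_group)
    show "commutator G g1 (g \<otimes> h)
        = commutator G g1 g \<otimes>\<^bsub>G\<lparr>carrier := ?D\<rparr>\<^esub> commutator G (conj_by G g g1) (conj_by G g h)"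
      by (simp add: commutator_def conj_by_def m_assoc inv_mult_group)
  qed (simp add: commutator_in_derived)
  let ?C = "{commutator G g h | g h. g \<in> carrier G \<and> h \<in> carrier G}"
  have "?C = derived_set G (carrier G)"
    unfolding commutator_def by blast
  then have "?D = generate G ?C"
    unfolding derived_def by simp
  also have "\<dots> = generate (G\<lparr>carrier := ?D\<rparr>) ?C"
    by (rule generate_consistent[symmetric, OF _ sub]) (auto intro: commutator_in_derived)
  finally have "generate (G\<lparr>carrier := ?D\<rparr>) ?C = carrier (G\<lparr>carrier := ?D\<rparr>)"
    by simp
  moreover have "?C \<subseteq> generate (G\<lparr>carrier := ?D\<rparr>) ?C"
    by (auto intro: generate.incl)
  ultimately obtain f where "f \<in> hom (tensor_square G) (G\<lparr>carrier := ?D\<rparr>)"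
    "f ` carrier (tensor_square G) = carrier (G\<lparr>carrier := ?D\<rparr>)"
    by (rule c.tensor_square_epi)
  then show ?thesis
    by (intro that) simp_all
qed

end

section \<open>Bounds for the tensor square\<close>

context crossed_pairing
begin

text \<open>
  By \<open>conj_by_tau\<close> and \<open>commutator_right\<close>, \<open>[g, h] \<otimes> [g, h]\<close> is the commutator of \<open>g \<otimes> h\<close> with itself.
\<close>
lemma commutator_self:
  assumes [simp]: "g \<in> carrier G" "h \<in> carrier G"
  shows "\<tau> (commutator G g h) (commutator G g h) = \<one>\<^bsub>M\<^esub>"
proof -
  let ?c = "commutator G g h"
  have "\<tau> g h \<otimes>\<^bsub>M\<^esub> \<tau> g h = (\<tau> ?c ?c \<otimes>\<^bsub>M\<^esub> \<tau> g h) \<otimes>\<^bsub>M\<^esub> \<tau> g h"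
    using conj_by_tau[of g h g h] commutator_right[of g h ?c] by simp
  then show ?thesis
    by simp
qed

lemma conj_by_commute:
  assumes "c \<in> carrier G" "d \<in> carrier G" "c \<otimes> d = d \<otimes> c"
  shows "conj_by G c d = d"
  using assms G.conj_by_eq_self_iff by simp

lemma mult_commuting:
  assumes "c \<in> carrier G" "c' \<in> carrier G" "d \<in> carrier G" "c \<otimes> c' = c' \<otimes> c" "c \<otimes> d = d \<otimes> c"
  shows "\<tau> (c \<otimes> c') d = \<tau> c' d \<otimes>\<^bsub>M\<^esub> \<tau> c d" "\<tau> d (c \<otimes> c') = \<tau> d c \<otimes>\<^bsub>M\<^esub> \<tau> d c'"
proof -
  have "conj_by G c c' = c'" "conj_by G c d = d"
    using assms by (simp_all only: conj_by_commute)
  then show "\<tau> (c \<otimes> c') d = \<tau> c' d \<otimes>\<^bsub>M\<^esub> \<tau> c d" "\<tau> d (c \<otimes> c') = \<tau> d c \<otimes>\<^bsub>M\<^esub> \<tau> d c'"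
    using mult_left[of c c' d] mult_right[of d c c'] assms(1-3) by simp_all
qed

lemma subgroup_trivial_pairing:
  assumes A: "subgroup A G" and comm: "\<And>c d. c \<in> A \<Longrightarrow> d \<in> A \<Longrightarrow> c \<otimes> d = d \<otimes> c" and a: "a \<in> A"
  shows "subgroup {d \<in> A. \<tau> a d = \<one>\<^bsub>M\<^esub>} G"
proof (rule G.subgroupI)
  have c: "x \<in> carrier G" if "x \<in> A" for x
    using that A by (rule subgroup.mem_carrier[rotated])
  show "{d \<in> A. \<tau> a d = \<one>\<^bsub>M\<^esub>} \<subseteq> carrier G"
    using c by auto
  have "\<one> \<in> {d \<in> A. \<tau> a d = \<one>\<^bsub>M\<^esub>}"
    using a c subgroup.one_closed[OF A] by simp
  then show "{d \<in> A. \<tau> a d = \<one>\<^bsub>M\<^esub>} \<noteq> {}"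
    by blast
  show "inv d \<in> {d \<in> A. \<tau> a d = \<one>\<^bsub>M\<^esub>}" if "d \<in> {d \<in> A. \<tau> a d = \<one>\<^bsub>M\<^esub>}" for d
    using that a c[of a] c[of d] comm[of d a] inv_right[of a d] subgroup.m_inv_closed[OF A]
    by (simp add: conj_by_commute)
  show "d \<otimes> e \<in> {d \<in> A. \<tau> a d = \<one>\<^bsub>M\<^esub>}"
    if "d \<in> {d \<in> A. \<tau> a d = \<one>\<^bsub>M\<^esub>}" "e \<in> {d \<in> A. \<tau> a d = \<one>\<^bsub>M\<^esub>}" for d e
    using that a c comm[of d a] comm[of d e] mult_commuting(2)[of d e a] subgroup.m_closed[OF A]
    by simp
qed

end

context group
begin

text \<open>
  Some \<open>k\<close> does not centralize the derived subgroup and, the order of the latter being prime, centralizes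
  none of its non-trivial elements, so that every \<open>x\<close> in it is a commutator with \<open>k\<close> and \<open>x \<otimes> x = 1\<close>. The elements
  \<open>d\<close> of the derived subgroup with \<open>x \<otimes> d = 1\<close> form a subgroup containing \<open>x\<close>, so \<open>N\<close> can be taken trivial.
\<close>
lemma tensor_square_le_prime:
  assumes nc: "\<not> comm_group G" and fin: "finite (carrier G)" and q: "Factorial_Ring.prime q"
    and D: "card (derived G (carrier G)) = q"
    and cop: "coprime q (card (rcosets (derived G (carrier G))))"
    and A: "finite A" "A \<subseteq> carrier G" "generate G (A \<union> derived G (carrier G)) = carrier G"
    and m: "m > 0" "\<And>a. a \<in> A \<Longrightarrow> a [^] (m :: nat) \<in> derived G (carrier G)"
  shows "finite (carrier (tensor_square G))"
    "card (carrier (tensor_square G)) \<le> m ^ (card A * card A) * q"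
proof -
  let ?D = "derived G (carrier G)" and ?T = "tensor_square G"
  interpret c: crossed_pairing G ?T "simple_tensor G"
    by (rule crossed_pairing_simple_tensor)
  obtain c k where ck: "c \<in> ?D" "k \<in> carrier G" "c \<otimes> k \<noteq> k \<otimes> c"
    using derived_not_central[OF nc fin] D cop by auto
  have sub: "subgroup ?D G"
    by (simp add: derived_is_subgroup)
  have prime: "Factorial_Ring.prime (card ?D)"
    using D q by simp
  have Dc: "x \<in> carrier G" if "x \<in> ?D" for x
    using that sub by (rule subgroup.mem_carrier[rotated])
  have D_le: "?D \<subseteq> {y \<in> carrier G. x \<otimes> y = y \<otimes> x}"
    if "x \<in> carrier G" "e \<in> ?D" "e \<noteq> \<one>" "x \<otimes> e = e \<otimes> x" for x e
    using that Dc by (intro prime_subgroup_subset[OF sub prime subgroup_centralizer, of x e]) auto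
  have comm: "x \<otimes> y = y \<otimes> x" if "x \<in> ?D" "y \<in> ?D" for x y
    using D_le[of x x] that Dc by (cases "x = \<one>") auto
  have fpf: "e = \<one>" if "e \<in> ?D" "e \<otimes> k = k \<otimes> e" for e
  proof (rule ccontr)
    assume "e \<noteq> \<one>"
    then have "?D \<subseteq> {y \<in> carrier G. k \<otimes> y = y \<otimes> k}"
      using that ck by (intro D_le[of k e]) simp_all
    then have "k \<otimes> c = c \<otimes> k"
      using ck(1) by blast
    then show False
      using ck(3) by simp
  qed
  have finD: "finite ?D"
    using fin Dc by (meson finite_subset subsetI)
  have comms: "\<exists>c1\<in>?D. x = commutator G c1 k" if "x \<in> ?D" for x
    using derived_eq_commutators[OF finD ck(2) fpf that] .
  have trivial: "simple_tensor G x y = \<one>\<^bsub>?T\<^esub>" if xy: "x \<in> ?D" "y \<in> ?D" for x y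
  proof (cases "x = \<one>")
    case True
    then show ?thesis
      using xy Dc by simp
  next
    case False
    obtain c1 where "c1 \<in> ?D" "x = commutator G c1 k"
      using comms[OF xy(1)] by blast
    then have "simple_tensor G x x = \<one>\<^bsub>?T\<^esub>"
      using c.commutator_self[of c1 k] Dc ck by simp
    then have "?D \<subseteq> {d \<in> ?D. simple_tensor G x d = \<one>\<^bsub>?T\<^esub>}"
      using xy False
      by (intro prime_subgroup_subset[OF sub prime c.subgroup_trivial_pairing[OF sub comm xy(1)], of x]) auto
    then show ?thesis
      using xy by blast
  qed
  interpret d: derived_pairing G ?T "simple_tensor G" k "{\<one>\<^bsub>?T\<^esub>}"
    by unfold_locales
      (use ck comm comms trivial generate_simple_tensor c.M.triv_subgroup in \<open>auto simp: subgroup_def\<close>)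
  show "finite (carrier ?T)" "card (carrier ?T) \<le> m ^ (card A * card A) * q"
    using d.card_le[OF A m] finD D by simp_all
qed

end

context alternating_pair
begin

text \<open>
  On the Klein four-group \<open>\<otimes>\<close> is bilinear, and \<open>d \<otimes> d = 1\<close> because all its elements are commutators. So
  all values are powers of \<open>z = u \<otimes> v\<close>, where \<open>v = \<^sup>x u\<close>. The square of \<open>z\<close> is \<open>u\<^sup>2 \<otimes> v = 1\<close>, and \<open>z\<close> is central
  because \<open>u\<close> and \<open>v\<close> commute.
\<close>
lemma tensor_square_le:
  assumes A: "finite A" "A \<subseteq> carrier G" "generate G (A \<union> derived G (carrier G)) = carrier G"
    and m: "m > 0" "\<And>a. a \<in> A \<Longrightarrow> a [^] (m :: nat) \<in> derived G (carrier G)"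
  shows "finite (carrier (tensor_square G))"
    "card (carrier (tensor_square G)) \<le> m ^ (card A * card A) * 8"
proof -
  let ?D = "derived G (carrier G)" and ?T = "tensor_square G" and ?v = "conj_by G x u"
  let ?\<tau> = "simple_tensor G"
  interpret c: crossed_pairing G ?T ?\<tau>
    by (rule crossed_pairing_simple_tensor)
  have finD: "finite ?D"
    by (simp add: derived_eq)
  have sub: "subgroup ?D G"
    by (simp add: derived_is_subgroup)
  have Dc: "d \<in> carrier G" if "d \<in> ?D" for d
    using that sub by (rule subgroup.mem_carrier[rotated])
  have comms: "\<exists>c1\<in>?D. d = commutator G c1 x" if "d \<in> ?D" for d
    using derived_eq_commutators[OF finD x fixed_point_free that] .
  have self: "?\<tau> d d = \<one>\<^bsub>?T\<^esub>" if "d \<in> ?D" for d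
    using comms[OF that] c.commutator_self[of _ x] Dc by auto
  have comm: "c \<otimes> d = d \<otimes> c" if "c \<in> ?D" "d \<in> ?D" for c d
  proof -
    have "?v \<otimes> (u \<otimes> ?v) = u \<otimes> (?v \<otimes> ?v)" "u \<otimes> ?v \<otimes> u = u \<otimes> u \<otimes> ?v"
      by (simp_all add: commute m_assoc flip: m_assoc[of ?v u ?v])
    then show ?thesis
      using that unfolding derived_eq by (auto simp: commute m_assoc)
  qed
  have mem: "u \<in> ?D" "?v \<in> ?D" "u \<otimes> ?v \<in> ?D"
    by (simp_all add: derived_eq)
  let ?z = "?\<tau> u ?v"
  note [simp] = self[OF mem(1)] self[OF mem(2)] self[OF mem(3)]
  have left: "?\<tau> (c \<otimes> c') d = ?\<tau> c' d \<otimes>\<^bsub>?T\<^esub> ?\<tau> c d"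
    and right: "?\<tau> d (c \<otimes> c') = ?\<tau> d c \<otimes>\<^bsub>?T\<^esub> ?\<tau> d c'" if "c \<in> ?D" "c' \<in> ?D" "d \<in> ?D" for c c' d
    using that c.mult_commuting[of c c' d] comm Dc by simp_all
  have zz: "?z \<otimes>\<^bsub>?T\<^esub> ?z = \<one>\<^bsub>?T\<^esub>"
    using left[OF mem(1,1,2)] by (simp add: square)
  have "?\<tau> ?v u \<otimes>\<^bsub>?T\<^esub> ?z = \<one>\<^bsub>?T\<^esub>"
    using left[OF mem(1,2,3)] right[OF mem(1,2,1)] right[OF mem(1,2,2)] by simp
  then have vu: "?\<tau> ?v u = ?z"
    using zz c.M.right_cancel[of ?z "?\<tau> ?v u" ?z] by simp
  have vals: "?\<tau> u (u \<otimes> ?v) = ?z" "?\<tau> ?v (u \<otimes> ?v) = ?z" "?\<tau> (u \<otimes> ?v) u = ?z" "?\<tau> (u \<otimes> ?v) ?v = ?z"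
    using left[OF mem(1,2,1)] left[OF mem(1,2,2)] right[OF mem(1,2,1)] right[OF mem(1,2,2)]
    by (simp_all add: vu)
  let ?N = "{\<one>\<^bsub>?T\<^esub>, ?z}"
  have in_N: "?\<tau> c d \<in> ?N" if "c \<in> ?D" "d \<in> ?D" for c d
    using that unfolding derived_eq by (auto simp: vu vals)
  have "inv\<^bsub>?T\<^esub> ?z = ?z"
    using zz by (simp add: c.M.inv_equality)
  then have N: "subgroup ?N ?T"
    using zz by (intro c.M.subgroupI) auto
  have z_central: "?z \<otimes>\<^bsub>?T\<^esub> t = t \<otimes>\<^bsub>?T\<^esub> ?z" if t: "t \<in> carrier ?T" for t
  proof -
    have "commutator G u ?v = \<one>"
      by (simp add: commutator_eq_one_iff commute)
    then have "?z \<otimes>\<^bsub>?T\<^esub> ?\<tau> g h = ?\<tau> g h \<otimes>\<^bsub>?T\<^esub> ?z" if "g \<in> carrier G" "h \<in> carrier G" for g h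
      using that c.conj_by_tau[of u ?v g h] by simp
    then have "generate ?T {?\<tau> g h | g h. g \<in> carrier G \<and> h \<in> carrier G}
        \<subseteq> {t \<in> carrier ?T. ?z \<otimes>\<^bsub>?T\<^esub> t = t \<otimes>\<^bsub>?T\<^esub> ?z}"
      by (intro c.M.generate_subgroup_incl c.M.subgroup_centralizer) auto
    then show ?thesis
      using t generate_simple_tensor by auto
  qed
  have central: "t \<otimes>\<^bsub>?T\<^esub> n = n \<otimes>\<^bsub>?T\<^esub> t" if "n \<in> ?N" "t \<in> carrier ?T" for n t
    using that z_central[of t] by auto
  interpret d: derived_pairing G ?T ?\<tau> x ?N
    by (rule derived_pairing.intro[OF c.crossed_pairing_axioms], rule derived_pairing_axioms.intro,
        rule x, erule (1) comm, erule comms, rule N, erule (1) central, erule (1) in_N,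
        rule generate_simple_tensor)
  have "card ?N * card ?D \<le> 8"
    using card_insert_le_m1[of 2 "{?z}" "\<one>\<^bsub>?T\<^esub>"] by (simp add: card_derived)
  then have le: "m ^ (card A * card A) * (card ?N * card ?D) \<le> m ^ (card A * card A) * 8"
    by (rule mult_le_mono2)
  have finN: "finite ?N"
    by simp
  show "finite (carrier ?T)"
    by (rule d.card_le(1)[OF A m finN finD])
  show "card (carrier ?T) \<le> m ^ (card A * card A) * 8"
    by (rule order_trans[OF d.card_le(2)[OF A m finN finD] le])
qed

end

context group
begin

lemma generators_cyclic:
  assumes ab: "abelianization G \<cong> integer_mod_group m" and m: "m > 1"
  obtains a where "a \<in> carrier G" "generate G ({a} \<union> derived G (carrier G)) = carrier G"
    "a [^] m \<in> derived G (carrier G)"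
proof -
  let ?D = "derived G (carrier G)" and ?L = "integer_mod_group m"
  obtain \<phi> where \<phi>: "\<phi> \<in> hom G ?L" "\<phi> ` carrier G = carrier ?L"
    and ker: "\<forall>g\<in>carrier G. \<phi> g = \<one>\<^bsub>?L\<^esub> \<longleftrightarrow> g \<in> ?D"
    using abelianization_epi[OF ab group_integer_mod_group] by metis
  interpret \<phi>: group_hom G ?L \<phi>
    using \<phi>(1) by (simp add: group_hom_def group_hom_axioms_def is_group)
  have "1 \<in> \<phi> ` carrier G"
    unfolding \<phi>(2) using m by simp
  then obtain a where a: "a \<in> carrier G" "\<phi> a = 1"
    by auto
  show ?thesis
  proof (rule that[OF a(1)])
    show "generate G ({a} \<union> ?D) = carrier G"
      using ker a m derived_in_carrier[of "carrier G"]
      by (intro generate_if_image_generates[OF \<phi>(1)]) (simp_all add: generate_integer_mod_group)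
    have "\<phi> (a [^] m) = \<one>\<^bsub>?L\<^esub>"
      using a \<phi>.hom_nat_pow[OF a(1), of m] by simp
    then show "a [^] m \<in> ?D"
      using ker a by simp
  qed
qed

lemma generators_bicyclic:
  assumes ab: "abelianization G \<cong> integer_mod_group m \<times>\<times> integer_mod_group m" and m: "m > 1"
  obtains a b where "a \<in> carrier G" "b \<in> carrier G" "a \<noteq> b"
    "generate G ({a, b} \<union> derived G (carrier G)) = carrier G"
    "a [^] m \<in> derived G (carrier G)" "b [^] m \<in> derived G (carrier G)"
proof -
  let ?D = "derived G (carrier G)" and ?L = "integer_mod_group m \<times>\<times> integer_mod_group m"
  have L: "group ?L"
    by (simp add: DirProd_group)
  obtain \<phi> where \<phi>: "\<phi> \<in> hom G ?L" "\<phi> ` carrier G = carrier ?L"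
    and ker: "\<forall>g\<in>carrier G. \<phi> g = \<one>\<^bsub>?L\<^esub> \<longleftrightarrow> g \<in> ?D"
    using abelianization_epi[OF ab L] by metis
  interpret \<phi>: group_hom G ?L \<phi>
    using \<phi>(1) L by (simp add: group_hom_def group_hom_axioms_def is_group)
  have "(1, 0) \<in> \<phi> ` carrier G" "(0, 1) \<in> \<phi> ` carrier G"
    unfolding \<phi>(2) using m by simp_all
  then obtain a b where a: "a \<in> carrier G" "\<phi> a = (1, 0)" and b: "b \<in> carrier G" "\<phi> b = (0, 1)"
    by (metis imageE)
  have pow_mem: "c [^] m \<in> ?D" if "c \<in> carrier G" for c
  proof -
    obtain i j where ij: "\<phi> c = (i, j)"
      by (cases "\<phi> c")
    have "\<phi> (c [^] m) = \<one>\<^bsub>?L\<^esub>"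
      using \<phi>.hom_nat_pow[OF that, of m] unfolding ij pow_DirProd_integer_mod_group by simp
    then show ?thesis
      using ker that by simp
  qed
  have "\<phi> ` {a, b} = {(1, 0), (0, 1)}"
    using a b by simp
  then have "generate G ({a, b} \<union> ?D) = carrier G"
    using ker a b m derived_in_carrier[of "carrier G"] generate_DirProd_integer_mod_group[OF m]
    by (intro generate_if_image_generates[OF \<phi>(1) L]) simp_all
  then show ?thesis
    using a b pow_mem by (intro that[of a b]) auto
qed

lemma tensor_square_epi_prime:
  assumes q: "Factorial_Ring.prime q" and D: "card (derived G (carrier G)) = q"
  obtains f where "f \<in> hom (tensor_square G) (integer_mod_group q)"
    and "f ` carrier (tensor_square G) = carrier (integer_mod_group q)"
proof -
  let ?D = "derived G (carrier G)"
  interpret D: group "G\<lparr>carrier := ?D\<rparr>"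
    by (rule subgroup_imp_group) (simp add: derived_is_subgroup)
  have o: "order (G\<lparr>carrier := ?D\<rparr>) = q"
    using D by (simp add: order_def)
  have "finite (carrier (G\<lparr>carrier := ?D\<rparr>))"
    using D q prime_gt_0_nat[OF q] by (simp add: card_ge_0_finite)
  moreover obtain c where "c \<in> carrier (G\<lparr>carrier := ?D\<rparr>)"
    "group.ord (G\<lparr>carrier := ?D\<rparr>) c = order (G\<lparr>carrier := ?D\<rparr>)"
    using D.prime_order_generator q o by metis
  ultimately have "G\<lparr>carrier := ?D\<rparr> \<cong> integer_mod_group q"
    using D.cyclic_iso_integer_mod_group o by metis
  then obtain h where h: "h \<in> hom (G\<lparr>carrier := ?D\<rparr>) (integer_mod_group q)"
    "h ` ?D = carrier (integer_mod_group q)"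
    by (auto simp: is_iso_def iso_def bij_betw_def)
  obtain f where f: "f \<in> hom (tensor_square G) (G\<lparr>carrier := ?D\<rparr>)"
    "f ` carrier (tensor_square G) = ?D"
    by (rule tensor_square_epi_derived)
  show ?thesis
  proof (rule that[of "h \<circ> f"])
    show "h \<circ> f \<in> hom (tensor_square G) (integer_mod_group q)"
      using f(1) h(1) by (auto simp: hom_def Pi_iff)
    show "(h \<circ> f) ` carrier (tensor_square G) = carrier (integer_mod_group q)"
      unfolding image_comp[symmetric] f(2) h(2) ..
  qed
qed

end

section \<open>Groups of order \<open>p\<^sup>2 q\<close>\<close>

theorem theoremB:
  fixes G :: "('a, 'b) monoid_scheme" and p q :: nat
  assumes "Factorial_Ring.prime p" and "Factorial_Ring.prime q" and "p < q"
    and "group G" and "\<not> comm_group G" and "order G = p\<^sup>2 * q"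
  shows "(abelianization G \<cong> integer_mod_group (p\<^sup>2) \<or>
          abelianization G \<cong> integer_mod_group p \<times>\<times> integer_mod_group p \<or>
          abelianization G \<cong> integer_mod_group 3) \<and>
         (abelianization G \<cong> integer_mod_group (p\<^sup>2) \<longrightarrow>
            tensor_square G \<cong> integer_mod_group (p\<^sup>2 * q)) \<and>
         (abelianization G \<cong> integer_mod_group p \<times>\<times> integer_mod_group p \<longrightarrow>
            tensor_square G \<cong> cyclic_power p 4 \<times>\<times> integer_mod_group q) \<and>
         (abelianization G \<cong> integer_mod_group 3 \<longrightarrow>
            tensor_square G \<cong> integer_mod_group 3 \<times>\<times> quaternion_group)"
proof -
  note p = \<open>Factorial_Ring.prime p\<close> and q = \<open>Factorial_Ring.prime q\<close> and pq = \<open>p < q\<close>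
    and nc = \<open>\<not> comm_group G\<close> and o = \<open>order G = p\<^sup>2 * q\<close>
  interpret group G by fact
  let ?D = "derived G (carrier G)" and ?T = "tensor_square G"
  interpret T: group ?T
    unfolding tensor_square_def by (rule group_presented_group)
  interpret D: normal ?D G
    by (rule derived_self_is_normal)
  interpret ab: group "abelianization G"
    unfolding abelianization_def by (rule D.factorgroup_is_group)
  have p1: "p > 1" and q1: "q > 1"
    using p q prime_gt_1_nat by blast+
  have fin: "finite (carrier G)"
    using o p1 q1 order_gt_0_iff_finite by simp
  have cop: "coprime p q"
    using p q pq by (simp add: primes_coprime)
  have pp1: "p\<^sup>2 > 1"
    using one_less_power[OF p1, of 2] by simp
  have pp3: "p\<^sup>2 \<noteq> 3"
  proof
    assume "p\<^sup>2 = 3"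
    then have "p * p = 3" by (simp add: power2_eq_square)
    moreover have "p \<ge> 2" using p1 by simp
    then have "2 * 2 \<le> p * p" by (rule mult_le_mono) fact
    ultimately show False by simp
  qed
  have o_ab: "order (abelianization G) = card (rcosets\<^bsub>G\<^esub> ?D)"
    by (simp add: order_def abelianization_def FactGroup_def)
  have Z_card: "finite (carrier (integer_mod_group n)) \<and> card (carrier (integer_mod_group n)) = n"
    if "n > 0" for n
    using that by (simp add: carrier_integer_mod_group)
  have square_index: "card ?D = q" if "card (rcosets\<^bsub>G\<^esub> ?D) = p\<^sup>2"
    using lagrange[OF D.subgroup_axioms] that o p1 by simp
  have cop': "coprime q (card (rcosets\<^bsub>G\<^esub> ?D))" if "card (rcosets\<^bsub>G\<^esub> ?D) = p\<^sup>2"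
    using that cop by (simp add: coprime_commute)
  have cases: "abelianization G \<cong> integer_mod_group (p\<^sup>2) \<or>
      abelianization G \<cong> integer_mod_group p \<times>\<times> integer_mod_group p \<or>
      abelianization G \<cong> integer_mod_group 3"
    using p q pq o nc
  proof (cases rule: derived_cases)
    case prime
    then have "order (abelianization G) = p\<^sup>2"
      using o_ab by simp
    then show ?thesis
      using ab.iso_if_order_prime_square[OF p] by blast
  next
    case (alternating x u)
    interpret alternating_pair G x u by fact
    have "order (abelianization G) = 3"
      using lagrange[OF D.subgroup_axioms] o alternating card_derived by (simp add: o_ab)
    moreover have "finite (carrier (abelianization G))"
      using ab.order_gt_0_iff_finite calculation by simp
    moreover have "Factorial_Ring.prime (order (abelianization G))"
      using calculation(1) by simp
    then obtain c where "c \<in> carrier (abelianization G)"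
      "group.ord (abelianization G) c = order (abelianization G)"
      by (rule ab.prime_order_generator)
    ultimately show ?thesis
      using ab.cyclic_iso_integer_mod_group by metis
  qed
  have cyclic: "?T \<cong> integer_mod_group (p\<^sup>2 * q)" if ab: "abelianization G \<cong> integer_mod_group (p\<^sup>2)"
  proof -
    have idx: "card (rcosets\<^bsub>G\<^esub> ?D) = p\<^sup>2"
      using card_rcosets_derived[OF ab] Z_card[of "p\<^sup>2"] p1 by simp
    obtain a where a: "a \<in> carrier G" "generate G ({a} \<union> ?D) = carrier G" "a [^]\<^bsub>G\<^esub> (p\<^sup>2) \<in> ?D"
      using generators_cyclic[OF ab pp1] .
    have le: "finite (carrier ?T)" "card (carrier ?T) \<le> p\<^sup>2 * q"
      using tensor_square_le_prime[OF nc fin q square_index[OF idx] cop'[OF idx], of "{a}" "p\<^sup>2"] a p1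
      by simp_all
    obtain f where f: "f \<in> hom ?T (integer_mod_group (p\<^sup>2))" "f ` carrier ?T = carrier (integer_mod_group (p\<^sup>2))"
      by (rule tensor_square_epi_cyclic[OF ab pp1])
    obtain g where g: "g \<in> hom ?T (integer_mod_group q)" "g ` carrier ?T = carrier (integer_mod_group q)"
      by (rule tensor_square_epi_prime[OF q square_index[OF idx]])
    have "?T \<cong> integer_mod_group (p\<^sup>2) \<times>\<times> integer_mod_group q"
      using le f g cop Z_card[of "p\<^sup>2"] Z_card[of q] p1 q1
      by (intro T.iso_DirProd_if_coprime_epis) auto
    moreover have "integer_mod_group (p\<^sup>2) \<times>\<times> integer_mod_group q \<cong> integer_mod_group (p\<^sup>2 * q)"
      using cop p1 q1 by (intro DirProd_integer_mod_group_iso) auto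
    ultimately show ?thesis
      by (rule iso_trans)
  qed
  have bicyclic: "?T \<cong> cyclic_power p 4 \<times>\<times> integer_mod_group q"
    if ab: "abelianization G \<cong> integer_mod_group p \<times>\<times> integer_mod_group p"
  proof -
    have idx: "card (rcosets\<^bsub>G\<^esub> ?D) = p\<^sup>2"
      using card_rcosets_derived[OF ab] Z_card[of p] p1
      by (simp add: card_cartesian_product power2_eq_square)
    obtain a b where a: "a \<in> carrier G" "b \<in> carrier G" "a \<noteq> b"
      "generate G ({a, b} \<union> ?D) = carrier G" "a [^]\<^bsub>G\<^esub> p \<in> ?D" "b [^]\<^bsub>G\<^esub> p \<in> ?D"
      using generators_bicyclic[OF ab p1] .
    have pow: "c [^]\<^bsub>G\<^esub> p \<in> ?D" if "c \<in> {a, b}" for c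
      using that a by auto
    have four: "card {a, b} * card {a, b} = 4"
      using a(3) by simp
    have le: "finite (carrier ?T)" "card (carrier ?T) \<le> p ^ 4 * q"
      using tensor_square_le_prime[OF nc fin q square_index[OF idx] cop'[OF idx] _ _ a(4) _ pow] a(1,2) p1
      unfolding four by simp_all
    obtain f where f: "f \<in> hom ?T (cyclic_power p 4)" "f ` carrier ?T = carrier (cyclic_power p 4)"
      by (rule tensor_square_epi_bicyclic[OF ab p1])
    obtain g where g: "g \<in> hom ?T (integer_mod_group q)" "g ` carrier ?T = carrier (integer_mod_group q)"
      by (rule tensor_square_epi_prime[OF q square_index[OF idx]])
    have "group (cyclic_power p 4)"
      by (simp add: cyclic_power_def)
    then show ?thesis
      using le f g cop card_cyclic_power[of p 4] Z_card[of q] p1 q1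
      by (intro T.iso_DirProd_if_coprime_epis) auto
  qed
  have alternating: "?T \<cong> integer_mod_group 3 \<times>\<times> quaternion_group"
    if ab: "abelianization G \<cong> integer_mod_group 3"
    using p q pq o nc
  proof (cases rule: derived_cases)
    case prime
    then show ?thesis
      using card_rcosets_derived[OF ab] Z_card[of 3] pp3 by simp
  next
    case (alternating x u)
    interpret alternating_pair G x u by fact
    have o12: "order G = 12"
      using o alternating by simp
    obtain a where a: "a \<in> carrier G" "generate G ({a} \<union> ?D) = carrier G" "a [^]\<^bsub>G\<^esub> (3 :: nat) \<in> ?D"
      using generators_cyclic[OF ab] by auto
    have le: "finite (carrier ?T)" "card (carrier ?T) \<le> 3 * 8"
      using tensor_square_le[of "{a}" 3] a by simp_all
    obtain f where f: "f \<in> hom ?T (integer_mod_group 3)" "f ` carrier ?T = carrier (integer_mod_group 3)"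
      using tensor_square_epi_cyclic[OF ab] by auto
    obtain g where g: "g \<in> hom ?T quaternion_group" "g ` carrier ?T = carrier quaternion_group"
      by (rule tensor_square_epi_quaternion_group[OF o12])
    have "coprime 3 (8 :: nat)"
      by (simp add: coprime_iff_gcd_eq_1 gcd_nat.simps)
    then show ?thesis
      using le f g Z_card[of 3] card_quaternion_group finite_quaternion_group group_quaternion_group
      by (intro T.iso_DirProd_if_coprime_epis) auto
  qed
  show ?thesis
    using cases cyclic bicyclic alternating by blast
qed

end
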